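(* Let $B^3_{21}\subset (P_9-\mathcal{R}^2_6)^4$ be the quasi-projective variety of quadruples $(q_1,q_2,q_3,b)$ of distinct quadric surfaces of rank at least three such that $b$ is a common basket for $q_1,q_2$ and $q_3$. Then $B^3_{21}$ is irreducible, of dimension twenty one, and the triple $(q_1,q_2,q_3)$ of a generic point $(q_1,q_2,q_3,b)\in B^3_{21}$ is characterized by the following property: the span $[q_1,q_2,q_3]\subset P_9$ is a plane ($\approx P_2$) which contains a pencil of cones with the same vertex, and the rank two points in this pencil are precisely the points where it meets the lines $[q_i,q_j]$, $1\le i<j\le 3$.
   Context: Quadric surfaces in $P_3=P_3(\mathbb{C})$ are identified with points of $P_9=P(\mathrm{Sym}_{\mathbb{C}}(4))$ (complex symmetric $4\times4$ matrices up to scale); the rank of a quadric is the rank of its matrix. Quadrics of rank at most three are called cones. $\mathcal{R}^2_6\subset P_9$ is the locus of quadrics of rank at most two. A pencil is a line in $P_9$; $[\cdot,\ldots,\cdot]$ denotes projective span in $P_9$. Basket: for distinct quadric surfaces $q_1,q_2$ of rank at least three, $q_1$ is a basket for $q_2$ (and vice versa) when they are tangent along a conic, so that their intersection is twice this conic. Whenever one speaks of a common basket $b$ for quadrics $q_i$, all quadrics concerned are assumed distinct and of rank at least three. "The triple of a generic point is characterized by property (P)" means: for all points of a dense open subset of the variety the triple has (P), and conversely a generic triple of distinct quadrics of rank at least three with (P) admits a common basket. *)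

theory Defs
  imports "HOL-Analysis.Analysis" "HOL-Library.Extended_Nat"
begin

section \<open>Topological notions\<close>

definition irreducible_space :: "'a topology \<Rightarrow> bool" where
  "irreducible_space X \<longleftrightarrow> topspace X \<noteq> {} \<and>
     (\<forall>C D. closedin X C \<longrightarrow> closedin X D \<longrightarrow> topspace X = C \<union> D \<longrightarrow> C = topspace X \<or> D = topspace X)"

text \<open>Krull dimension; the value on the empty space is 0 by this convention.\<close>

definition krull_dim :: "'a topology \<Rightarrow> enat" where
  "krull_dim X = Sup {enat n | n. \<exists>Z :: nat \<Rightarrow> 'a set.
     (\<forall>i\<le>n. closedin X (Z i) \<and> irreducible_space (subtopology X (Z i))) \<and>
     (\<forall>i<n. Z i \<subset> Z (Suc i))}"

definition generically :: "'a topology \<Rightarrow> ('a \<Rightarrow> bool) \<Rightarrow> bool" where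
  "generically X P \<longleftrightarrow>
     (\<exists>U. openin X U \<and> X closure_of U = topspace X \<and> (\<forall>x\<in>U. P x))"

section \<open>Polynomial functions\<close>

text \<open>The algebra of functions generated by a set of coordinate functions. The field of complex
  numbers is infinite, so polynomial functions on an affine space are the same as polynomials.\<close>

inductive_set polyfun :: "('a \<Rightarrow> complex) set \<Rightarrow> ('a \<Rightarrow> complex) set"
  for X :: "('a \<Rightarrow> complex) set" where
  const: "(\<lambda>_. c) \<in> polyfun X"
| coord: "f \<in> X \<Longrightarrow> f \<in> polyfun X"
| add: "f \<in> polyfun X \<Longrightarrow> g \<in> polyfun X \<Longrightarrow> (\<lambda>x. f x + g x) \<in> polyfun X"
| mult: "f \<in> polyfun X \<Longrightarrow> g \<in> polyfun X \<Longrightarrow> (\<lambda>x. f x * g x) \<in> polyfun X"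

definition poly_ring :: "(complex^'n \<Rightarrow> complex) set" where
  "poly_ring = polyfun (range (\<lambda>i x. x $ i))"

definition ideal2 :: "(complex^'n \<Rightarrow> complex) \<Rightarrow> (complex^'n \<Rightarrow> complex) \<Rightarrow> (complex^'n \<Rightarrow> complex) set" where
  "ideal2 f g = {(\<lambda>x. u x * f x + v x * g x) | u v. u \<in> poly_ring \<and> v \<in> poly_ring}"

section \<open>The projective space of quadrics\<close>

text \<open>On \<open>complex^'n^'m\<close> the library operation \<open>*s\<close> scales by vectors, hence the following.\<close>

definition smat :: "complex \<Rightarrow> complex^'n^'m \<Rightarrow> complex^'n^'m" where
  "smat c A = (\<chi> i j. c * A $ i $ j)"

global_interpretation smat: vector_space smat
  by unfold_locales (simp_all add: smat_def vec_eq_iff algebra_simps)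

definition proportional :: "complex^4^4 \<Rightarrow> complex^4^4 \<Rightarrow> bool" where
  "proportional A B \<longleftrightarrow> transpose A = A \<and> A \<noteq> 0 \<and> (\<exists>c. c \<noteq> 0 \<and> B = smat c A)"

lemma part_equivp_proportional: "part_equivp proportional"
proof (rule part_equivpI)
  have 1: "transpose (mat 1 :: complex^4^4) = mat 1" by (rule transpose_mat)
  have 2: "(mat 1 :: complex^4^4) \<noteq> 0" by (auto simp: mat_def vec_eq_iff)
  show "\<exists>A. proportional A A"
    using 1 2 smat.scale_one[of "mat 1 :: complex^4^4"] unfolding proportional_def
    by (metis one_neq_zero)
  have T: "transpose (smat c A) = smat c (transpose A)" for c and A :: "complex^4^4"
    by (simp add: smat_def transpose_def vec_eq_iff)
  show "symp proportional"
  proof (rule sympI)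
    fix A B assume "proportional A B"
    then obtain c where c: "transpose A = A" "A \<noteq> 0" "c \<noteq> 0" "B = smat c A"
      by (auto simp: proportional_def)
    have "A = smat (inverse c) B" using c by simp
    moreover have "B \<noteq> 0" using c by simp
    moreover have "transpose B = B" using c T by simp
    ultimately show "proportional B A" using c(3) unfolding proportional_def
      by (metis inverse_nonzero_iff_nonzero)
  qed
  show "transp proportional"
  proof (rule transpI)
    fix A B C assume "proportional A B" "proportional B C"
    then obtain c d where "transpose A = A" "A \<noteq> 0" "c \<noteq> 0" "d \<noteq> 0" "C = smat (d * c) A"
      by (auto simp: proportional_def)
    then show "proportional A C" unfolding proportional_def by (metis mult_eq_0_iff)
  qed
qed

quotient_type quadric = "complex^4^4" / partial: proportional
  morphisms rep_quadric Quadric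
  by (rule part_equivp_proportional)

text \<open>The function \<open>rep_quadric\<close> chooses a representing matrix. Everything below that is
  defined through it is invariant under rescaling this matrix.\<close>

definition qrank :: "quadric \<Rightarrow> nat" where
  "qrank q = rank (rep_quadric q)"

definition is_cone :: "quadric \<Rightarrow> bool" where
  "is_cone q \<longleftrightarrow> qrank q \<le> 3"

definition qbilin :: "quadric \<Rightarrow> complex^4 \<Rightarrow> complex^4 \<Rightarrow> complex" where
  "qbilin q x y = (\<Sum>i\<in>UNIV. x $ i * (rep_quadric q *v y) $ i)"

definition qform :: "quadric \<Rightarrow> complex^4 \<Rightarrow> complex" where
  "qform q x = qbilin q x x"

text \<open>Affine cone over the singular locus of the quadric surface.\<close>

definition vertex :: "quadric \<Rightarrow> (complex^4) set" where
  "vertex q = {v. rep_quadric q *v v = 0}"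

definition proj_subspace :: "nat \<Rightarrow> quadric set \<Rightarrow> bool" where
  "proj_subspace d P \<longleftrightarrow> (\<exists>V. smat.subspace V \<and> V \<subseteq> {A. transpose A = A} \<and>
     smat.dim V = d + 1 \<and> P = {q. rep_quadric q \<in> V})"

abbreviation "is_pencil \<equiv> proj_subspace 1"
abbreviation "is_plane \<equiv> proj_subspace 2"

definition proj_span :: "quadric set \<Rightarrow> quadric set" where
  "proj_span S = {q. rep_quadric q \<in> smat.span (rep_quadric ` S)}"

section \<open>Zariski topology on products of copies of the space of quadrics\<close>

definition multihomogeneous :: "((complex^4^4)^'k \<Rightarrow> complex) set" where
  "multihomogeneous = {f \<in> polyfun (range (\<lambda>(k, i, j) A. A $ k $ i $ j)).
     \<exists>d :: 'k \<Rightarrow> nat. \<forall>(c :: 'k \<Rightarrow> complex) A.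
       f (\<chi> k. smat (c k) (A $ k)) = (\<Prod>k\<in>UNIV. c k ^ d k) * f A}"

text \<open>The generating sets are the complements of multiprojective hypersurfaces. They are
  closed under finite intersections and cover the space, so they form a basis. Every
  multihomogeneous polynomial on symmetric matrices extends to all matrices.\<close>

definition zariski :: "(quadric^'k) topology" where
  "zariski = topology_generated_by
     {{q. f (\<chi> k. rep_quadric (q $ k)) \<noteq> 0} | f. f \<in> multihomogeneous}"

section \<open>Baskets\<close>

definition linform :: "complex^4 \<Rightarrow> complex^4 \<Rightarrow> complex" where
  "linform l x = (\<Sum>i\<in>UNIV. l $ i * x $ i)"

definition plane_section :: "quadric \<Rightarrow> complex^4 \<Rightarrow> (complex^4) set" where
  "plane_section q l = {x. linform l x = 0 \<and> qform q x = 0}"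

definition tangent_space :: "quadric \<Rightarrow> complex^4 \<Rightarrow> (complex^4) set" where
  "tangent_space q x = {y. qbilin q x y = 0}"

definition tangent_along :: "quadric \<Rightarrow> quadric \<Rightarrow> complex^4 \<Rightarrow> bool" where
  "tangent_along q1 q2 l \<longleftrightarrow> plane_section q1 l = plane_section q2 l \<and>
     (\<forall>x \<in> plane_section q1 l. tangent_space q1 x = tangent_space q2 x)"

text \<open>The scheme-theoretic intersection of the two quadrics is twice the conic \<open>l = 0\<close> on \<open>q1\<close>,
  that is, the divisor of \<open>l\<^sup>2\<close> on \<open>q1\<close>. Both ideals belong to complete intersections and
  are therefore saturated, so they are equal if and only if the subschemes are.\<close>

definition meet_in_double_conic :: "quadric \<Rightarrow> quadric \<Rightarrow> complex^4 \<Rightarrow> bool" where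
  "meet_in_double_conic q1 q2 l \<longleftrightarrow>
     ideal2 (qform q1) (qform q2) = ideal2 (qform q1) (\<lambda>x. (linform l x)\<^sup>2)"

text \<open>A conic is the section of a quadric by a plane \<open>l = 0\<close>; it may be degenerate.\<close>

definition basket :: "quadric \<Rightarrow> quadric \<Rightarrow> bool" where
  "basket q1 q2 \<longleftrightarrow> q1 \<noteq> q2 \<and> qrank q1 \<ge> 3 \<and> qrank q2 \<ge> 3 \<and>
     (\<exists>l. l \<noteq> 0 \<and> tangent_along q1 q2 l \<and> meet_in_double_conic q1 q2 l)"

definition common_basket :: "quadric \<Rightarrow> quadric list \<Rightarrow> bool" where
  "common_basket b qs \<longleftrightarrow> distinct (b # qs) \<and> (\<forall>q \<in> set (b # qs). qrank q \<ge> 3) \<and>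
     (\<forall>q \<in> set qs. basket b q)"

definition B21 :: "(quadric^4) set" where
  "B21 = {p. common_basket (p $ 4) [p $ 1, p $ 2, p $ 3]}"

section \<open>The characterizing property\<close>

text \<open>A cone of rank two has a whole line of singular points, so that the cones of the
  pencil have the same vertex means that they share a singular point.\<close>

definition triple_property :: "quadric^3 \<Rightarrow> bool" where
  "triple_property t \<longleftrightarrow>
     is_plane (proj_span {t $ 1, t $ 2, t $ 3}) \<and>
     (\<exists>L. is_pencil L \<and> L \<subseteq> proj_span {t $ 1, t $ 2, t $ 3} \<and>
        (\<forall>q\<in>L. is_cone q) \<and> (\<exists>v. v \<noteq> 0 \<and> (\<forall>q\<in>L. v \<in> vertex q)) \<and>
        {q \<in> L. qrank q = 2} =
          L \<inter> (proj_span {t $ 1, t $ 2} \<union> proj_span {t $ 1, t $ 3} \<union> proj_span {t $ 2, t $ 3}))"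

definition property_triples :: "(quadric^3) set" where
  "property_triples = {t. distinct [t $ 1, t $ 2, t $ 3] \<and> (\<forall>i. qrank (t $ i) \<ge> 3) \<and> triple_property t}"

definition triple_of :: "quadric^4 \<Rightarrow> quadric^3" where
  "triple_of p = (\<chi> i. if i = 1 then p $ 1 else if i = 2 then p $ 2 else p $ 3)"

end

theory Submission
  imports Defs "HOL-Computational_Algebra.Polynomial"
begin

text \<open>Comparing terms of degree two in the ideals shows that \<open>b\<close> is a basket for \<open>q\<close> if and only if
  \<open>q = b + l\<^sup>2\<close> for suitable representing matrices and a linear form \<open>l\<close>. So \<open>B21\<close> is parametrized
  by an open part of the space of all \<open>(b, l\<^sub>1, l\<^sub>2, l\<^sub>3)\<close>; irreducibility and all density claims follow
  by joining points by images of lines, since a nonzero polynomial in one variable has finitely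
  many roots.

  If \<open>l\<^sub>1, l\<^sub>2, l\<^sub>3\<close> are independent, the pencil is the span of the differences \<open>l\<^sub>i\<^sup>2 - l\<^sub>j\<^sup>2\<close>. Conversely,
  the three singular members of the given pencil are differences of representatives of the \<open>q\<^sub>i\<close> and
  are simultaneously diagonalizable, so the \<open>q\<^sub>i\<close> differ by squares from a common matrix \<open>b\<close>; the
  rank of \<open>b\<close> is at least three as soon as \<open>q\<^sub>1\<close> has rank four.

  For the dimension, choose for each step of a chain of irreducible closed sets a polynomial that
  vanishes on the smaller set but not on the larger one. In an affine chart these polynomials are
  algebraically independent, while they are rational functions of \<open>9 + 3 \<cdot> 4 = 21\<close> parameters.
  A chain of length 21 is obtained by releasing the parameters one at a time.\<close>

section \<open>Rank of complex matrices\<close>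

text \<open>Only matrices can be added, a quadric is a matrix up to scale, and the topology sees
  only the zeros of multihomogeneous functions. The proof therefore chooses the scales of
  representing matrices so that \<open>q = b + l^2\<close> holds exactly, and returns to quadrics
  through functions whose vanishing does not depend on the scales. This forces the elimination
  formula for the genericity condition, the homogenization in charts and the special test functions
  of the chain.

  Rank at least three is not a single polynomial inequality. For a symmetric \<open>A\<close> it
  means that some \<open>A + outer u\<close> is invertible; with \<open>u\<close> fixed this is one
  inequality, which can be followed along a line.

  A basket exists only generically for triples with the property: if \<open>q_1\<close> has rank
  three, subtracting its square may leave a matrix of rank two.\<close>

definition outer :: "complex^4 \<Rightarrow> complex^4^4" where
  "outer l = (\<chi> i j. l $ i * l $ j)"

lemma smat_nth [simp]: "smat c A $ i $ j = c * A $ i $ j"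
  by (simp add: smat_def)

lemma outer_nth [simp]: "outer l $ i $ j = l $ i * l $ j"
  by (simp add: outer_def)

lemma rank_add_rank_one:
  fixes A B :: "complex^'n^'m"
  assumes "\<And>i. \<exists>c. B $ i = A $ i + c *s v"
  shows "rank B \<le> rank A + 1"
proof -
  obtain S where S: "S \<subseteq> rows A" "vec.independent S" "rows A \<subseteq> vec.span S" "card S = rank A"
    using vec.basis_exists[of "rows A"] unfolding row_rank_def_gen by metis
  have finS: "finite S" using S(2) vec.independent_bound_general by blast
  have "rows B \<subseteq> vec.span (insert v S)"
  proof
    fix r assume "r \<in> rows B"
    then obtain i where r: "r = B $ i" by (auto simp: rows_def row_def vec_lambda_eta)
    obtain c where c: "B $ i = A $ i + c *s v" using assms by blast
    have "A $ i \<in> vec.span S" using S(3) by (auto simp: rows_def row_def vec_lambda_eta)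
    then have "A $ i \<in> vec.span (insert v S)"
      by (meson subsetD subset_insertI vec.span_mono)
    then show "r \<in> vec.span (insert v S)" unfolding r c
      by (rule vec.span_add) (simp add: vec.span_base vec.span_scale)
  qed
  then have "vec.dim (rows B) \<le> card (insert v S)"
    using finS by (intro vec.dim_le_card) auto
  also have "\<dots> \<le> rank A + 1" using S(4) finS by (simp add: card_insert_if)
  finally show ?thesis unfolding row_rank_def_gen .
qed

lemma rank_0_complex [simp]: "rank (0 :: complex^'n^'m) = 0"
proof -
  have "rows (0 :: complex^'n^'m) \<subseteq> {0}" by (auto simp: rows_def row_def vec_eq_iff)
  then have "rows (0 :: complex^'n^'m) \<subseteq> vec.span {}" by simp
  from vec.dim_le_card[OF this] show ?thesis unfolding row_rank_def_gen by simp
qed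

lemma rank_add_outer: "rank (A + smat c (outer l)) \<le> rank A + 1"
proof (rule rank_add_rank_one[where v = l])
  show "\<exists>d. (A + smat c (outer l)) $ i = A $ i + d *s l" for i
    by (rule exI[of _ "c * l $ i"]) (simp add: vec_eq_iff)
qed

lemma rank_le_add_outer: "rank A \<le> rank (A + smat c (outer l)) + 1"
  using rank_add_outer[of "A + smat c (outer l)" "-c" l]
  by (simp add: smat.scale_minus_left)

lemma rank_smat: assumes "c \<noteq> 0" shows "rank (smat c A) = rank A"
proof -
  have le: "rank (smat c A) \<le> rank A" for c and A :: "complex^'n^'m"
  proof -
    have "rows (smat c A) \<subseteq> vec.span (rows A)"
    proof
      fix r assume "r \<in> rows (smat c A)"
      then obtain i where "r = smat c A $ i" unfolding rows_def row_def vec_lambda_eta by auto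
      then have "r = c *s (A $ i)" by (simp add: vec_eq_iff)
      moreover have "A $ i \<in> rows A" by (auto simp: rows_def row_def vec_lambda_eta)
      ultimately show "r \<in> vec.span (rows A)" by (simp add: vec.span_base vec.span_scale)
    qed
    then show ?thesis unfolding row_rank_def_gen
      by (metis vec.dim_span vec.dim_subset)
  qed
  show ?thesis using le[of c A] le[of "inverse c" "smat c A"] assms by simp
qed

lemma dim_UNIV_4 [simp]:
  "finite_dimensional_vector_space.dimension (cart_basis :: (complex^4) set) = 4"
  by (simp add: vec.dimension_def card_cart_basis)

lemma rank_le_4: "rank (A :: complex^4^4) \<le> 4"
  unfolding row_rank_def_gen using vec.dim_subset_UNIV[of "rows A"] by (simp add: dim_UNIV_4)

lemma rank_eq_4_iff: "rank (A :: complex^4^4) = 4 \<longleftrightarrow> det A \<noteq> 0"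
proof -
  have "det A \<noteq> 0 \<longleftrightarrow> vec.span (rows A) = UNIV"
    by (simp add: invertible_det_nz[symmetric] invertible_left_inverse matrix_left_invertible_span_rows_gen)
  also have "\<dots> \<longleftrightarrow> vec.dim (rows A) = 4"
    by (simp add: vec.dim_eq_full[symmetric] dim_UNIV_4)
  finally show ?thesis unfolding row_rank_def_gen by simp
qed

lemma det_eq_0_iff_kernel: "det (A :: complex^'n^'n) = 0 \<longleftrightarrow> (\<exists>v. v \<noteq> 0 \<and> A *v v = 0)"
proof -
  have "det A \<noteq> 0 \<longleftrightarrow> (\<forall>v. A *v v = 0 \<longrightarrow> v = 0)"
    by (simp add: invertible_det_nz[symmetric] invertible_left_inverse matrix_left_invertible_ker)
  then show ?thesis by blast
qed

lemma rank_ge_3_if_det: "det (A + smat c (outer u)) \<noteq> 0 \<Longrightarrow> rank A \<ge> 3"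
  using rank_add_outer[of A c u] rank_eq_4_iff[of "A + smat c (outer u)"] by linarith

lemma rank_le_3_if_kernel: "v \<noteq> 0 \<Longrightarrow> A *v v = 0 \<Longrightarrow> rank (A :: complex^4^4) \<le> 3"
  using rank_le_4[of A] rank_eq_4_iff[of A] det_eq_0_iff_kernel[of A] by (metis le_neq_implies_less less_Suc_eq_le numeral_eq_Suc pred_numeral_simps(2) semiring_norm(26,27))

section \<open>The bilinear pairing, symmetric matrices and their kernels\<close>

lemma linform_add: "linform l (x + y) = linform l x + linform l y"
  by (simp add: linform_def algebra_simps sum.distrib)

lemma linform_scale: "linform l (c *s x) = c * linform l x"
  by (simp add: linform_def sum_distrib_left algebra_simps)

lemma linform_diff: "linform l (x - y) = linform l x - linform l y"
  by (simp add: linform_def algebra_simps sum_subtractf)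

lemma linform_add_left: "linform (l + m) x = linform l x + linform m x"
  by (simp add: linform_def algebra_simps sum.distrib)

lemma linform_scale_left: "linform (c *s l) x = c * linform l x"
  by (simp add: linform_def sum_distrib_left algebra_simps)

lemma linform_0 [simp]: "linform l 0 = 0" "linform 0 x = 0"
  by (simp_all add: linform_def)

lemma linform_commute: "linform x y = linform y x"
  by (simp add: linform_def mult.commute)

lemma linform_axis [simp]: "linform x (axis i 1) = x $ i" "linform (axis i 1) x = x $ i"
  by (simp_all add: linform_def axis_def if_distrib if_distribR cong: if_cong)

lemma linform_eq_0_imp: assumes "\<And>x. linform x y = 0" shows "y = 0"
  using assms[of "axis _ 1"] by (simp add: vec_eq_iff)

lemma matrix_vector_nth: "(A *v x) $ i = linform (A $ i) x" for A :: "complex^4^4"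
  by (simp add: matrix_vector_mult_def linform_def)

lemma smat_mult_vec: "smat c A *v x = c *s (A *v x)"
  by (simp add: vec_eq_iff matrix_vector_mult_def sum_distrib_left algebra_simps)

lemma outer_mult_vec: "outer l *v x = linform l x *s l"
  by (simp add: vec_eq_iff matrix_vector_mult_def linform_def sum_distrib_left sum_distrib_right algebra_simps)

lemma symmetric_nth: "transpose A = A \<Longrightarrow> A $ i $ j = A $ j $ i"
  by (metis transpose_def vec_lambda_beta)

lemma linform_symmetric:
  assumes "transpose A = A"
  shows "linform x (A *v y) = linform y (A *v x)"
proof -
  have "linform x (A *v y) = (\<Sum>i\<in>UNIV. \<Sum>j\<in>UNIV. x $ i * A $ i $ j * y $ j)"
    by (simp add: linform_def matrix_vector_mult_def sum_distrib_left mult.assoc)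
  also have "\<dots> = (\<Sum>j\<in>UNIV. \<Sum>i\<in>UNIV. x $ i * A $ i $ j * y $ j)"
    by (rule sum.swap)
  also have "\<dots> = linform y (A *v x)"
    by (simp add: linform_def matrix_vector_mult_def sum_distrib_left symmetric_nth[OF assms, of _ ] mult_ac)
  finally show ?thesis .
qed

lemma proportional_vecI:
  fixes x v :: "complex^4"
  assumes "v \<noteq> 0" "\<And>i j. x $ i * v $ j = x $ j * v $ i"
  shows "\<exists>c. x = c *s v"
proof -
  obtain j where j: "v $ j \<noteq> 0" using assms(1) by (auto simp: vec_eq_iff)
  have "x = (x $ j / v $ j) *s v"
    using assms(2)[of _ j] j by (simp add: vec_eq_iff field_simps)
  then show ?thesis ..
qed

text \<open>Every row is annihilated by \<open>x\<close> and \<open>v\<close>. The vector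
  \<open>p\<close> is annihilated by \<open>v\<close> but not by \<open>x\<close>, and
  \<open>q\<close> is not annihilated by \<open>v\<close>; both nonzero values are the given minor.
  So the rows together with \<open>p\<close> and \<open>q\<close> span a space of dimension
  \<open>rank A + 2\<close> inside dimension four.\<close>

lemma rank_le_2_if_kernel:
  fixes A :: "complex^4^4"
  assumes x: "A *v x = 0" and v: "A *v v = 0" and ij: "x $ i * v $ j \<noteq> x $ j * v $ i"
  shows "rank A \<le> 2"
proof -
  define p where "p = v $ j *s axis i 1 - v $ i *s axis j 1"
  define q where "q = x $ i *s axis j 1 - x $ j *s axis i 1"
  have px: "linform x p \<noteq> 0" and pv: "linform v p = 0" and qv: "linform v q \<noteq> 0"
    using ij by (simp_all add: p_def q_def linform_diff linform_scale algebra_simps)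
  have rx: "linform x r = 0" and rv: "linform v r = 0" if "r \<in> vec.span (rows A)" for r
  proof -
    have k: "linform y r = 0" if y: "A *v y = 0" and r: "r \<in> vec.span (rows A)" for y r
    proof -
      have "linform y (A $ i) = 0" for i
        using y by (metis linform_commute matrix_vector_nth zero_index)
      then have "rows A \<subseteq> {r. linform y r = 0}"
        unfolding rows_def row_def vec_lambda_eta by blast
      moreover have "vec.subspace {r. linform y r = 0}"
        by (intro vec.subspaceI) (simp_all add: linform_add linform_scale)
      ultimately have "vec.span (rows A) \<subseteq> {r. linform y r = 0}"
        by (rule vec.span_minimal)
      then show ?thesis using r by blast
    qed
    show "linform x r = 0" "linform v r = 0" using k x v that by auto
  qed
  have rv2: "linform v r = 0" if "r \<in> vec.span (insert p (rows A))" for r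
    using that pv rv by (auto simp: vec.span_insert linform_diff linform_scale)
      (metis diff_zero linform_diff linform_scale mult_zero_right pv right_minus_eq rv)
  have "p \<notin> vec.span (rows A)" using rx px by blast
  moreover have "q \<notin> vec.span (insert p (rows A))" using rv2 qv by blast
  ultimately have "vec.dim (insert q (insert p (rows A))) = rank A + 2"
    unfolding row_rank_def_gen by (simp add: vec.dim_insert)
  moreover have "vec.dim (insert q (insert p (rows A))) \<le> 4"
    using vec.dim_subset_UNIV[of "insert q (insert p (rows A))"] by simp
  ultimately show ?thesis by simp
qed

lemma kernel_rank_3:
  fixes A :: "complex^4^4"
  assumes "rank A \<ge> 3" "A *v x = 0" "A *v v = 0" "v \<noteq> 0"
  shows "\<exists>c. x = c *s v"
  using rank_le_2_if_kernel[OF assms(2,3)] proportional_vecI[OF assms(4)] assms(1)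
  by (metis Suc_n_not_le_n le_trans numeral_2_eq_2 numeral_3_eq_3)

lemma transpose_add: "transpose (A + B) = transpose A + transpose B"
  by (simp add: transpose_def vec_eq_iff)

lemma transpose_diff: "transpose (A - B) = transpose A - transpose B"
  by (simp add: transpose_def vec_eq_iff)

lemma transpose_smat: "transpose (smat c A) = smat c (transpose A)"
  by (simp add: transpose_def vec_eq_iff)

lemma transpose_outer [simp]: "transpose (outer l) = outer l"
  by (simp add: transpose_def vec_eq_iff)

text \<open>Pair the kernel equation of \<open>A + outer u\<close> with \<open>v\<close>: by
  symmetry the term of \<open>A\<close> drops out, so \<open>linform u x = 0\<close>. Then
  \<open>x\<close> lies in the kernel of \<open>A\<close>, a line on which \<open>u\<close> vanishes
  only at the origin.\<close>

lemma det_add_outer_nonzero: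
  fixes A :: "complex^4^4"
  assumes sym: "transpose A = A" and v: "A *v v = 0" and uv: "linform u v \<noteq> 0"
    and ker: "\<And>x. A *v x = 0 \<Longrightarrow> \<exists>c. x = c *s v"
  shows "det (A + outer u) \<noteq> 0"
proof
  assume "det (A + outer u) = 0"
  then obtain x where x: "x \<noteq> 0" "A *v x + linform u x *s u = 0"
    by (auto simp: det_eq_0_iff_kernel matrix_vector_mult_add_rdistrib outer_mult_vec)
  have "0 = linform v (A *v x + linform u x *s u)" using x by simp
  also have "\<dots> = linform x (A *v v) + linform u x * linform v u"
    by (simp add: linform_add linform_scale linform_symmetric[OF sym])
  finally have ux: "linform u x = 0" using v uv by (simp add: linform_commute)
  then have "A *v x = 0" using x by simp
  then obtain c where "x = c *s v" using ker by blast
  then show False using ux uv x by (auto simp: linform_scale)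
qed

text \<open>If \<open>A\<close> is singular of rank three, its kernel is a line, and every
  \<open>u\<close> that does not vanish on it works; if \<open>A\<close> is invertible, take
  \<open>u = 0\<close>. The converse holds because a square changes the rank by at most one.\<close>

lemma rank_ge_3_iff:
  fixes A :: "complex^4^4"
  assumes sym: "transpose A = A"
  shows "rank A \<ge> 3 \<longleftrightarrow> (\<exists>u. det (A + outer u) \<noteq> 0)"
proof
  assume r: "rank A \<ge> 3"
  show "\<exists>u. det (A + outer u) \<noteq> 0"
  proof (cases "det A = 0")
    case True
    then obtain v where v: "v \<noteq> 0" "A *v v = 0" by (auto simp: det_eq_0_iff_kernel)
    then obtain u where "linform v u \<noteq> 0" by (metis linform_commute linform_eq_0_imp)
    then have "linform u v \<noteq> 0" by (simp add: linform_commute)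
    then show ?thesis
      using det_add_outer_nonzero[OF sym v(2)] kernel_rank_3[OF r _ v(2) v(1)] by blast
  next
    case False
    moreover have "outer 0 = 0" by (simp add: vec_eq_iff)
    ultimately show ?thesis by (metis add.right_neutral)
  qed
next
  assume "\<exists>u. det (A + outer u) \<noteq> 0"
  then show "rank A \<ge> 3" using rank_ge_3_if_det[of A 1] by auto
qed

text \<open>If the kernel were only the line of \<open>v\<close>, adding the square of a form that
  is nonzero at \<open>v\<close> would give an invertible matrix, so \<open>A\<close> would have
  rank at least three.\<close>

lemma kernel_rank_le_2:
  fixes A :: "complex^4^4"
  assumes sym: "transpose A = A" and r: "rank A \<le> 2" and v: "v \<noteq> 0" "A *v v = 0"
  shows "\<exists>x. A *v x = 0 \<and> (\<forall>c. x \<noteq> c *s v)"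
proof (rule ccontr)
  assume *: "\<not> ?thesis"
  obtain u where "linform v u \<noteq> 0" using v(1) by (metis linform_commute linform_eq_0_imp)
  then have "linform u v \<noteq> 0" by (simp add: linform_commute)
  then have "det (A + outer u) \<noteq> 0" using det_add_outer_nonzero[OF sym v(2)] * by blast
  then show False using r rank_ge_3_iff[OF sym] by fastforce
qed

lemma rank_le_1_minors:
  fixes A :: "complex^4^4"
  assumes "rank A \<le> 1"
  shows "A $ i $ j * A $ k $ m = A $ i $ m * A $ k $ j"
proof -
  obtain S where S: "S \<subseteq> rows A" "vec.independent S" "rows A \<subseteq> vec.span S" "card S = rank A"
    using vec.basis_exists[of "rows A"] unfolding row_rank_def_gen by metis
  have "finite S" using S(2) vec.independent_bound_general by blast
  then obtain r where "S \<subseteq> {r}" using S(4) assms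
    by (metis One_nat_def card_0_eq card_1_singletonE empty_subsetI le_Suc_eq le_zero_eq subset_refl)
  then have "rows A \<subseteq> vec.span {r}" using S(3) by (meson order_trans vec.span_mono)
  then have "\<exists>c. A $ i = c *s r" for i
    by (force simp: vec.span_singleton rows_def row_def vec_lambda_eta)
  then obtain c where "\<And>i. A $ i = c i *s r" by metis
  then show ?thesis by simp
qed

text \<open>A nonzero entry at \<open>(k, m)\<close> makes every row a multiple of row
  \<open>k\<close>. Together with the converse this expresses rank at most one by equations in the
  entries, which pass from almost all members of a pencil to all of them.\<close>

lemma rank_le_1_if_minors:
  fixes A :: "complex^4^4"
  assumes "\<And>i j k m. A $ i $ j * A $ k $ m = A $ i $ m * A $ k $ j"
  shows "rank A \<le> 1"
proof (cases "A = 0")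
  case False
  then obtain k m where km: "A $ k $ m \<noteq> 0" by (auto simp: vec_eq_iff)
  have "rank A \<le> rank (0 :: complex^4^4) + 1"
  proof (rule rank_add_rank_one[where v = "A $ k"])
    fix i
    have "A $ i = 0 $ i + (A $ i $ m / A $ k $ m) *s A $ k"
      using km assms[of i _ k m] by (simp add: vec_eq_iff field_simps)
    then show "\<exists>c. A $ i = 0 $ i + c *s A $ k" ..
  qed
  then show ?thesis by simp
qed simp

section \<open>Dual bases\<close>

definition dual_basis :: "(4 \<Rightarrow> complex^4) \<Rightarrow> (4 \<Rightarrow> complex^4) \<Rightarrow> bool" where
  "dual_basis l w \<longleftrightarrow> (\<forall>i j. linform (l i) (w j) = (if i = j then 1 else 0))"

lemma dual_basis_commute: "dual_basis l w \<Longrightarrow> dual_basis w l"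
  by (auto simp: dual_basis_def linform_commute)

lemma dual_basis_exists:
  assumes "det (\<chi> i. l i) \<noteq> 0"
  shows "\<exists>w. dual_basis l w"
proof -
  obtain B where B: "(\<chi> i. l i) ** B = mat 1"
    using assms by (auto simp: invertible_det_nz[symmetric] invertible_def)
  have "linform (l i) (column j B) = ((\<chi> i. l i) ** B) $ i $ j" for i j
    by (simp add: linform_def column_def matrix_matrix_mult_def)
  then have "dual_basis l (\<lambda>j. column j B)" by (simp add: dual_basis_def B mat_def)
  then show ?thesis by blast
qed

lemma dual_basis_complete:
  assumes d: "dual_basis l w" and x: "\<And>j. linform (l j) x = 0"
  shows "x = 0"
proof -
  have "(\<chi> i. l i) ** (\<chi> i j. w j $ i) = mat 1"
    using d by (simp add: dual_basis_def vec_eq_iff mat_def matrix_matrix_mult_def linform_def)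
  then have "invertible (\<chi> i. l i)" using invertible_right_inverse by blast
  then have "det (\<chi> i. l i) \<noteq> 0" by (simp add: invertible_det_nz)
  moreover have "(\<chi> i. l i) *v x = 0" using x by (simp add: vec_eq_iff matrix_vector_nth)
  ultimately show ?thesis by (auto simp: det_eq_0_iff_kernel)
qed

text \<open>Each \<open>(A - B) *v w j\<close> is orthogonal to all \<open>w i\<close> and hence
  zero; then each row of \<open>A - B\<close> is orthogonal to all \<open>w j\<close>.\<close>

lemma matrix_eq_on_basis:
  fixes A B :: "complex^4^4"
  assumes d: "dual_basis l w"
    and eq: "\<And>i j. linform (w i) (A *v w j) = linform (w i) (B *v w j)"
  shows "A = B"
proof -
  note d' = dual_basis_commute[OF d]
  have "(A - B) *v w j = 0" for j
    by (rule dual_basis_complete[OF d']) (simp add: matrix_vector_mult_diff_rdistrib linform_diff eq)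
  then have "linform (w j) ((A - B) $ i) = 0" for i j
    by (metis linform_commute matrix_vector_nth zero_index)
  then have "(A - B) $ i = 0" for i by (rule dual_basis_complete[OF d'])
  then show ?thesis by (metis eq_iff_diff_eq_0 vec_eq_iff zero_index)
qed

lemma sum_mult_vec: "(\<Sum>i\<in>I. M i) *v x = (\<Sum>i\<in>I. M i *v x)" for M :: "'a \<Rightarrow> complex^4^4"
  by (induction I rule: infinite_finite_induct) (auto simp: matrix_vector_mult_add_rdistrib)

lemma linform_sum: "linform l (\<Sum>i\<in>I. f i) = (\<Sum>i\<in>I. linform l (f i))"
  by (induction I rule: infinite_finite_induct) (auto simp: linform_add)

lemma rank_add_sum_outer:
  "finite I \<Longrightarrow> rank (M + (\<Sum>i\<in>I. smat (a i) (outer (l i)))) \<le> rank M + card I"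
proof (induction I rule: finite_induct)
  case (insert i I)
  have "M + (\<Sum>i\<in>insert i I. smat (a i) (outer (l i)))
     = (M + (\<Sum>i\<in>I. smat (a i) (outer (l i)))) + smat (a i) (outer (l i))"
    using insert by simp
  then show ?case using insert rank_add_outer[of "M + (\<Sum>i\<in>I. smat (a i) (outer (l i)))" "a i" "l i"]
    by (simp del: sum.insert add: add.assoc)
qed simp

lemma sum_outer_mult_dual:
  assumes d: "dual_basis l w"
  shows "linform (w j) ((\<Sum>i\<in>I. smat (a i) (outer (l i))) *v x) = (if j \<in> I then a j * linform (l j) x else 0)"
proof -
  have "linform (w j) ((\<Sum>i\<in>I. smat (a i) (outer (l i))) *v x)
      = (\<Sum>i\<in>I. if i = j then a i * linform (l i) x else 0)"
    unfolding sum_mult_vec linform_sum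
    by (rule sum.cong) (use dual_basis_commute[OF d] in \<open>auto simp: smat_mult_vec outer_mult_vec linform_scale dual_basis_def\<close>)
  moreover have "finite I" by simp
  ultimately show ?thesis by (simp add: sum.delta)
qed

lemma rank_sum_outer:
  assumes d: "dual_basis l w" and a: "\<And>i. i \<in> I \<Longrightarrow> a i \<noteq> 0"
  shows "rank (\<Sum>i\<in>I. smat (a i) (outer (l i))) = card I"
proof (rule antisym)
  show "rank (\<Sum>i\<in>I. smat (a i) (outer (l i))) \<le> card I"
    using rank_add_sum_outer[of I 0] by simp
  \<comment> \<open>For the lower bound the squares with index outside \<open>I\<close> are added
    with coefficient 1. The resulting diagonal form \<open>D\<close> is invertible, and each added
    square raises the rank by at most one.\<close>
  define c where "c i = (if i \<in> I then a i else 1)" for i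
  define D where "D = (\<Sum>i\<in>UNIV. smat (c i) (outer (l i)))"
  have "det D \<noteq> 0"
  proof
    assume "det D = 0"
    then obtain x where x: "x \<noteq> 0" "D *v x = 0" by (auto simp: det_eq_0_iff_kernel)
    have "linform (l j) x = 0" for j
    proof -
      have "c j * linform (l j) x = 0"
        using sum_outer_mult_dual[OF d, of j c UNIV x] x by (simp add: D_def)
      then show ?thesis using a by (auto simp: c_def split: if_splits)
    qed
    then show False using x dual_basis_complete[OF d] by blast
  qed
  then have "rank D = 4" by (simp add: rank_eq_4_iff)
  moreover have "D = (\<Sum>i\<in>I. smat (c i) (outer (l i))) + (\<Sum>i\<in>-I. smat (c i) (outer (l i)))"
    unfolding D_def by (subst sum.union_disjoint[symmetric]) auto
  moreover have "(\<Sum>i\<in>I. smat (c i) (outer (l i))) = (\<Sum>i\<in>I. smat (a i) (outer (l i)))"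
    by (simp add: c_def)
  ultimately have "4 \<le> rank (\<Sum>i\<in>I. smat (a i) (outer (l i))) + card (-I)"
    using rank_add_sum_outer[of "-I" "\<Sum>i\<in>I. smat (a i) (outer (l i))" c l] by simp
  moreover have "card (-I) + card I = 4"
    using card_Un_disjoint[of I "-I"] by simp
  ultimately show "card I \<le> rank (\<Sum>i\<in>I. smat (a i) (outer (l i)))" by linarith
qed

section \<open>Polynomial functions along curves\<close>

lemma poly_eq_0_cofinite:
  fixes p :: "complex poly"
  assumes "finite {t. poly p t \<noteq> 0}"
  shows "p = 0"
proof (rule ccontr)
  assume "p \<noteq> 0"
  then have "finite {t. poly p t = 0}" by (rule poly_roots_finite)
  with assms have "finite ({t. poly p t \<noteq> 0} \<union> {t. poly p t = 0})" by simp
  moreover have "{t. poly p t \<noteq> 0} \<union> {t. poly p t = 0} = UNIV" by auto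
  ultimately show False using infinite_UNIV_char_0 by metis
qed

definition polynomial_map :: "(complex \<Rightarrow> complex) \<Rightarrow> bool" where
  "polynomial_map f \<longleftrightarrow> (\<exists>p. \<forall>t. f t = poly p t)"

lemma polynomial_map_const [intro]: "polynomial_map (\<lambda>t. c)"
  unfolding polynomial_map_def by (rule exI[of _ "[:c:]"]) simp

lemma polynomial_map_id [intro]: "polynomial_map (\<lambda>t. t)"
  unfolding polynomial_map_def by (rule exI[of _ "[:0, 1:]"]) simp

lemma polynomial_map_add [intro]:
  "polynomial_map f \<Longrightarrow> polynomial_map g \<Longrightarrow> polynomial_map (\<lambda>t. f t + g t)"
  unfolding polynomial_map_def by (metis poly_add)

lemma polynomial_map_mult [intro]:
  "polynomial_map f \<Longrightarrow> polynomial_map g \<Longrightarrow> polynomial_map (\<lambda>t. f t * g t)"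
  unfolding polynomial_map_def by (metis poly_mult)

lemma polynomial_map_diff [intro]:
  "polynomial_map f \<Longrightarrow> polynomial_map g \<Longrightarrow> polynomial_map (\<lambda>t. f t - g t)"
  unfolding polynomial_map_def by (metis poly_diff)

lemma polynomial_map_sum [intro]:
  "(\<And>i. i \<in> I \<Longrightarrow> polynomial_map (f i)) \<Longrightarrow> polynomial_map (\<lambda>t. \<Sum>i\<in>I. f i t)"
  by (induction I rule: infinite_finite_induct) auto

lemma polynomial_map_prod [intro]:
  "(\<And>i. i \<in> I \<Longrightarrow> polynomial_map (f i)) \<Longrightarrow> polynomial_map (\<lambda>t. \<Prod>i\<in>I. f i t)"
  by (induction I rule: infinite_finite_induct) auto

lemma polynomial_map_det:
  fixes M :: "complex \<Rightarrow> complex^'n^'n"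
  assumes "\<And>i j. polynomial_map (\<lambda>t. M t $ i $ j)"
  shows "polynomial_map (\<lambda>t. det (M t))"
  unfolding det_def
  by (intro polynomial_map_sum polynomial_map_mult polynomial_map_const polynomial_map_prod assms)

lemma polynomial_map_cofinite:
  assumes "polynomial_map f" "f s \<noteq> 0"
  shows "finite {t. f t = 0}"
proof -
  obtain p where p: "f = poly p" using assms(1) by (auto simp: polynomial_map_def)
  then have "p \<noteq> 0" using assms(2) by auto
  then show ?thesis unfolding p by (rule poly_roots_finite)
qed

lemma polynomial_map_eq_0:
  assumes "polynomial_map f" "finite {t. f t \<noteq> 0}"
  shows "f s = 0"
proof -
  obtain p where p: "f = poly p" using assms(1) by (auto simp: polynomial_map_def)
  then have "p = 0" using assms(2) by (simp add: poly_eq_0_cofinite)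
  then show ?thesis by (simp add: p)
qed

lemma polynomial_map_mult_eq_0:
  assumes "polynomial_map f" "polynomial_map g" "finite {t. f t * g t \<noteq> 0}"
  shows "(\<forall>t. f t = 0) \<or> (\<forall>t. g t = 0)"
proof -
  obtain p q where p: "\<And>t. f t = poly p t" and q: "\<And>t. g t = poly q t"
    using assms unfolding polynomial_map_def by blast
  have "p * q = 0" by (rule poly_eq_0_cofinite) (use assms(3) p q in simp)
  then show ?thesis using p q by auto
qed

lemma polyfun_along_curve:
  assumes "f \<in> polyfun X" "\<And>g. g \<in> X \<Longrightarrow> polynomial_map (\<lambda>t. g (\<gamma> t))"
  shows "polynomial_map (\<lambda>t. f (\<gamma> t))"
  using assms(1) by induction (use assms(2) in auto)

lemma polyfun_sum:
  "(\<And>i. i \<in> I \<Longrightarrow> f i \<in> polyfun X) \<Longrightarrow> (\<lambda>x. \<Sum>i\<in>I. f i x) \<in> polyfun X"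
  by (induction I rule: infinite_finite_induct) (auto intro: polyfun.intros)

lemma polyfun_prod:
  "(\<And>i. i \<in> I \<Longrightarrow> f i \<in> polyfun X) \<Longrightarrow> (\<lambda>x. \<Prod>i\<in>I. f i x) \<in> polyfun X"
  by (induction I rule: infinite_finite_induct) (auto intro: polyfun.intros)

lemma polyfun_power: "f \<in> polyfun X \<Longrightarrow> (\<lambda>x. f x ^ n) \<in> polyfun X"
  by (induction n) (auto intro: polyfun.intros)

lemma polyfun_cmult: "f \<in> polyfun X \<Longrightarrow> (\<lambda>x. c * f x) \<in> polyfun X"
  using polyfun.mult[OF polyfun.const] by blast

lemma polyfun_comp:
  assumes "f \<in> polyfun X" "\<And>g. g \<in> X \<Longrightarrow> (\<lambda>x. g (\<phi> x)) \<in> polyfun Y"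
  shows "(\<lambda>x. f (\<phi> x)) \<in> polyfun Y"
  using assms(1) by induction (use assms(2) in \<open>auto intro: polyfun.intros\<close>)

section \<open>Matrices representing a quadric\<close>

text \<open>Leaves the scale of the matrix free, whereas \<open>rep_quadric\<close> fixes one scale,
  for which a relation such as \<open>q = b + l^2\<close> need not hold.\<close>

definition represents :: "complex^4^4 \<Rightarrow> quadric \<Rightarrow> bool" where
  "represents A q \<longleftrightarrow> (\<exists>c. c \<noteq> 0 \<and> A = smat c (rep_quadric q))"

lemma proportional_rep: "proportional (rep_quadric q) (rep_quadric q)"
  by (rule Quotient3_rep_reflp[OF Quotient3_quadric])

lemma transpose_rep [simp]: "transpose (rep_quadric q) = rep_quadric q"
  using proportional_rep by (simp add: proportional_def)

lemma rep_nonzero [simp]: "rep_quadric q \<noteq> 0"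
  using proportional_rep by (simp add: proportional_def)

lemma represents_rep [simp]: "represents (rep_quadric q) q"
  unfolding represents_def by (rule exI[of _ 1]) simp

lemma represents_symmetric: "represents A q \<Longrightarrow> transpose A = A"
  by (auto simp: represents_def transpose_smat)

lemma represents_smat:
  assumes "represents A q" "c \<noteq> 0"
  shows "represents (smat c A) q"
proof -
  obtain d where "d \<noteq> 0" "A = smat d (rep_quadric q)" using assms by (auto simp: represents_def)
  then have "c * d \<noteq> 0" "smat c A = smat (c * d) (rep_quadric q)" using assms by simp_all
  then show ?thesis unfolding represents_def by blast
qed

lemma represents_unique:
  assumes "represents A q" "represents A q'"
  shows "q = q'"
proof -
  obtain c d where cd: "c \<noteq> 0" "d \<noteq> 0" "smat c (rep_quadric q) = smat d (rep_quadric q')"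
    using assms by (auto simp: represents_def)
  have "smat (c / d) (rep_quadric q) = smat (inverse d) (smat c (rep_quadric q))"
    by (simp add: field_simps)
  also have "\<dots> = rep_quadric q'" unfolding cd(3) using cd(2) by simp
  finally have "rep_quadric q' = smat (c / d) (rep_quadric q)" ..
  then have "proportional (rep_quadric q) (rep_quadric q')"
    using cd by (auto simp: proportional_def)
  then show ?thesis by (simp add: Quotient3_rel_rep[OF Quotient3_quadric])
qed

lemma represents_exists:
  assumes "transpose A = A" "A \<noteq> 0"
  shows "\<exists>q. represents A q"
proof -
  have "proportional A A" using assms unfolding proportional_def by (auto intro!: exI[of _ "1::complex"])
  then have "proportional (rep_quadric (Quadric A)) A"
    by (rule Quotient3_rep_abs[OF Quotient3_quadric])
  then show ?thesis by (auto simp: proportional_def represents_def)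
qed

lemma represents_proportional:
  assumes "represents A q" "represents B q"
  shows "\<exists>c. c \<noteq> 0 \<and> B = smat c A"
proof -
  obtain c d where "c \<noteq> 0" "d \<noteq> 0" "A = smat c (rep_quadric q)" "B = smat d (rep_quadric q)"
    using assms by (auto simp: represents_def)
  then show ?thesis by (intro exI[of _ "d / c"]) simp
qed

lemma represents_qrank: "represents A q \<Longrightarrow> rank A = qrank q"
  by (auto simp: represents_def qrank_def rank_smat)

section \<open>Baskets\<close>

lemma qbilin_linform: "qbilin q x y = linform x (rep_quadric q *v y)"
  by (simp add: qbilin_def linform_def)

lemma outer_scale: "outer (c *s l) = smat (c\<^sup>2) (outer l)"
  by (simp add: vec_eq_iff power2_eq_square)

text \<open>Polarization: unit vectors give the diagonal entries, sums of two unit vectors the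
  others.\<close>

lemma symmetric_eq_0:
  fixes M :: "complex^4^4"
  assumes sym: "transpose M = M" and M: "\<And>x. linform x (M *v x) = 0"
  shows "M = 0"
proof -
  have d: "M $ i $ i = 0" for i using M[of "axis i 1"] by (simp add: matrix_vector_nth)
  have "M $ i $ j = 0" for i j
  proof -
    have "linform (axis i 1 + axis j 1) (M *v (axis i 1 + axis j 1)) = 0" by (rule M)
    then have "M $ i $ i + M $ j $ j + (M $ i $ j + M $ j $ i) = 0"
      by (simp add: matrix_vector_right_distrib linform_add linform_add_left matrix_vector_nth add_ac)
    then show ?thesis using d symmetric_nth[OF sym, of i j] by simp
  qed
  then show ?thesis by (simp add: vec_eq_iff)
qed

lemma poly_ring_const: "(\<lambda>x. c) \<in> poly_ring"
  unfolding poly_ring_def by (rule polyfun.const)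

text \<open>Equality of the ideals gives \<open>q = u b + v l^2\<close> with polynomials
  \<open>u\<close> and \<open>v\<close>. Replacing \<open>x\<close> by \<open>t x\<close> and
  dividing by \<open>t^2\<close> leaves, at \<open>t = 0\<close>, only the constant terms of
  \<open>u\<close> and \<open>v\<close>.\<close>

lemma ideal2_double_conic:
  assumes eq: "ideal2 (qform b) (qform q) = ideal2 (qform b) (\<lambda>x. (linform l x)\<^sup>2)"
  shows "\<exists>c e. rep_quadric q = smat c (rep_quadric b) + smat e (outer l)"
proof -
  have "qform q \<in> ideal2 (qform b) (qform q)"
    unfolding ideal2_def
    using poly_ring_const[of 0] poly_ring_const[of 1] by force
  then have "qform q \<in> ideal2 (qform b) (\<lambda>x. (linform l x)\<^sup>2)" by (simp only: eq)
  then obtain u v where uv: "u \<in> poly_ring" "v \<in> poly_ring"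
    and q': "qform q = (\<lambda>x. u x * qform b x + v x * (linform l x)\<^sup>2)"
    unfolding ideal2_def by blast
  have q: "qform q x = u x * qform b x + v x * (linform l x)\<^sup>2" for x
    by (simp add: q')
  have hom: "qform r (t *s x) = t\<^sup>2 * qform r x" for r t x
    by (simp add: qform_def qbilin_linform linform_scale vector_scalar_commute linform_scale_left
        power2_eq_square)
  have pm: "polynomial_map (\<lambda>t. w (t *s x))" if "w \<in> poly_ring" for w and x :: "complex^4"
    using that unfolding poly_ring_def by (rule polyfun_along_curve) (auto intro!: polynomial_map_mult)
  have "qform q x = u 0 * qform b x + v 0 * (linform l x)\<^sup>2" for x
  proof -
    \<comment> \<open>This is polynomial in \<open>t\<close> and vanishes for
      \<open>t \<noteq> 0\<close>, where \<open>t^2\<close> can be cancelled; hence it vanishes at 0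
      too.\<close>
    define f where "f t = u (t *s x) * qform b x + v (t *s x) * (linform l x)\<^sup>2 - qform q x" for t
    have "polynomial_map f" unfolding f_def
      by (intro polynomial_map_diff polynomial_map_add polynomial_map_mult polynomial_map_const pm uv)
    moreover have "f t = 0" if "t \<noteq> 0" for t
    proof -
      have "t\<^sup>2 * f t = 0"
        using q[of "t *s x"] by (simp add: f_def hom linform_scale algebra_simps power_mult_distrib)
      then show ?thesis using that by simp
    qed
    then have "{t. f t \<noteq> 0} \<subseteq> {0}" by auto
    then have "finite {t. f t \<noteq> 0}" by (rule finite_subset) simp
    ultimately have "f 0 = 0" by (rule polynomial_map_eq_0)
    then show ?thesis by (simp add: f_def)
  qed
  then have "rep_quadric q - (smat (u 0) (rep_quadric b) + smat (v 0) (outer l)) = 0"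
    by (intro symmetric_eq_0)
      (simp_all add: transpose_diff transpose_add transpose_smat qform_def qbilin_linform
        matrix_vector_mult_diff_rdistrib matrix_vector_mult_add_rdistrib smat_mult_vec outer_mult_vec
        linform_diff linform_add linform_scale linform_commute[of _ l] power2_eq_square)
  then show ?thesis by (metis right_minus_eq)
qed

lemma ideal2_eqI:
  assumes g: "\<And>x. g x = c * f x + e * h x" and e: "e \<noteq> 0"
  shows "ideal2 f g = ideal2 f h"
proof
  show "ideal2 f g \<subseteq> ideal2 f h"
  proof
    fix k assume "k \<in> ideal2 f g"
    then obtain u v where uv: "u \<in> poly_ring" "v \<in> poly_ring" "k = (\<lambda>x. u x * f x + v x * g x)"
      by (auto simp: ideal2_def)
    then have "k = (\<lambda>x. (u x + c * v x) * f x + (e * v x) * h x)"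
      by (auto simp: g algebra_simps)
    moreover have "(\<lambda>x. u x + c * v x) \<in> poly_ring" "(\<lambda>x. e * v x) \<in> poly_ring"
      using uv unfolding poly_ring_def by (auto intro: polyfun.intros polyfun_cmult)
    ultimately show "k \<in> ideal2 f h" unfolding ideal2_def mem_Collect_eq by (metis (no_types))
  qed
  show "ideal2 f h \<subseteq> ideal2 f g"
  proof
    fix k assume "k \<in> ideal2 f h"
    then obtain u v where uv: "u \<in> poly_ring" "v \<in> poly_ring" "k = (\<lambda>x. u x * f x + v x * h x)"
      by (auto simp: ideal2_def)
    then have "k = (\<lambda>x. (u x + (- c / e) * v x) * f x + ((1 / e) * v x) * g x)"
      using e by (auto simp: g field_simps)
    moreover have "(\<lambda>x. u x + (- c / e) * v x) \<in> poly_ring" "(\<lambda>x. (1 / e) * v x) \<in> poly_ring"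
      using uv unfolding poly_ring_def by (intro polyfun.add polyfun_cmult; simp)+
    ultimately show "k \<in> ideal2 f g" unfolding ideal2_def mem_Collect_eq by (metis (no_types))
  qed
qed

text \<open>Rank at least three prevents \<open>q\<close> from being a multiple of
  \<open>l^2\<close>, so \<open>b\<close> occurs with a nonzero coefficient, which scaling removes;
  the coefficient of \<open>l^2\<close> is absorbed into \<open>l\<close> by a complex square root.
  Conversely, up to a factor the bilinear forms differ by a multiple of \<open>l(x) l(y)\<close>. It
  vanishes for every \<open>x\<close> with \<open>l(x) = 0\<close>, which is tangency along the
  conic.\<close>

lemma basket_iff_outer:
  assumes B: "represents B b"
  shows "basket b q \<longleftrightarrow> b \<noteq> q \<and> qrank b \<ge> 3 \<and> qrank q \<ge> 3 \<and> (\<exists>l. represents (B + outer l) q)"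
proof
  assume *: "basket b q"
  then have r: "b \<noteq> q" "qrank b \<ge> 3" "qrank q \<ge> 3" by (auto simp: basket_def)
  obtain l c e where ce: "rep_quadric q = smat c (rep_quadric b) + smat e (outer l)"
    using * ideal2_double_conic unfolding basket_def meet_in_double_conic_def by blast
  have "c \<noteq> 0"
  proof
    assume "c = 0"
    then have "qrank q \<le> 1" using rank_add_outer[of 0 e l] by (simp add: qrank_def ce)
    then show False using r by simp
  qed
  obtain d where d: "d \<noteq> 0" "B = smat d (rep_quadric b)" using B by (auto simp: represents_def)
  define s where "s = csqrt (d / c * e)"
  have "smat (d / c) (rep_quadric q) = B + outer (s *s l)"
    using \<open>c \<noteq> 0\<close> by (simp add: ce d smat.scale_right_distrib outer_scale s_def)
  then have "represents (B + outer (s *s l)) q"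
    using \<open>c \<noteq> 0\<close> d(1) represents_smat[OF represents_rep[of q], of "d / c"] by simp
  then show "b \<noteq> q \<and> qrank b \<ge> 3 \<and> qrank q \<ge> 3 \<and> (\<exists>l. represents (B + outer l) q)" using r by blast
next
  assume *: "b \<noteq> q \<and> qrank b \<ge> 3 \<and> qrank q \<ge> 3 \<and> (\<exists>l. represents (B + outer l) q)"
  then obtain l where l: "represents (B + outer l) q" by blast
  obtain d where d: "d \<noteq> 0" "B = smat d (rep_quadric b)" using B by (auto simp: represents_def)
  obtain c where c: "c \<noteq> 0" "rep_quadric q = smat c (B + outer l)"
    using represents_proportional[OF l represents_rep] by blast
  have "l \<noteq> 0"
  proof
    assume "l = 0"
    then have "B + outer l = B" by (simp add: vec_eq_iff)
    then show False using l B represents_unique * by metis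
  qed
  have q: "rep_quadric q = smat (c * d) (rep_quadric b) + smat c (outer l)"
    by (simp add: c d smat.scale_right_distrib)
  have bil: "qbilin q x y = c * d * qbilin b x y + c * (linform l x * linform l y)" for x y
    by (simp add: qbilin_linform q matrix_vector_mult_add_rdistrib smat_mult_vec outer_mult_vec
        linform_add linform_scale linform_commute[of _ l] algebra_simps)
  have "tangent_along b q l"
    using c(1) d(1) by (auto simp: tangent_along_def plane_section_def tangent_space_def qform_def bil)
  moreover have "meet_in_double_conic b q l"
    unfolding meet_in_double_conic_def
    by (rule ideal2_eqI[of _ "c * d" _ c]) (simp_all add: qform_def bil c(1) power2_eq_square)
  ultimately show "basket b q" using * \<open>l \<noteq> 0\<close> unfolding basket_def by blast
qed

section \<open>The Zariski topology\<close>

abbreviation coordinates :: "((complex^4^4)^'k \<Rightarrow> complex) set" where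
  "coordinates \<equiv> range (\<lambda>(k, i, j) A. A $ k $ i $ j)"

definition value_at :: "((complex^4^4)^'k \<Rightarrow> complex) \<Rightarrow> quadric^'k \<Rightarrow> complex" where
  "value_at f p = f (\<chi> k. rep_quadric (p $ k))"

definition represents_tuple :: "(complex^4^4)^'k \<Rightarrow> quadric^'k \<Rightarrow> bool" where
  "represents_tuple A p \<longleftrightarrow> (\<forall>k. represents (A $ k) (p $ k))"

definition multidegree :: "((complex^4^4)^'k \<Rightarrow> complex) \<Rightarrow> ('k \<Rightarrow> nat) \<Rightarrow> bool" where
  "multidegree f d \<longleftrightarrow> f \<in> polyfun coordinates \<and>
     (\<forall>c A. f (\<chi> k. smat (c k) (A $ k)) = (\<Prod>k\<in>UNIV. c k ^ d k) * f A)"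

lemma multihomogeneous_iff: "f \<in> multihomogeneous \<longleftrightarrow> (\<exists>d. multidegree f d)"
  by (auto simp: multihomogeneous_def multidegree_def)

lemma multidegree_mult:
  "multidegree f d \<Longrightarrow> multidegree g e \<Longrightarrow> multidegree (\<lambda>A. f A * g A) (\<lambda>k. d k + e k)"
  by (auto simp: multidegree_def power_add prod.distrib intro: polyfun.mult)

lemma multidegree_add: "multidegree f d \<Longrightarrow> multidegree g d \<Longrightarrow> multidegree (\<lambda>A. f A + g A) d"
  by (auto simp: multidegree_def algebra_simps intro: polyfun.add)

lemma multidegree_cmult: "multidegree f d \<Longrightarrow> multidegree (\<lambda>A. c * f A) d"
  by (auto simp: multidegree_def intro: polyfun_cmult)

lemma multidegree_diff: "multidegree f d \<Longrightarrow> multidegree g d \<Longrightarrow> multidegree (\<lambda>A. f A - g A) d"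
  using multidegree_add[OF _ multidegree_cmult[of g d "-1"], of f] by simp

lemma multidegree_const: "multidegree (\<lambda>A. c) (\<lambda>k. 0)"
  by (auto simp: multidegree_def intro: polyfun.const)

lemma multidegree_sum:
  "(\<And>i. i \<in> I \<Longrightarrow> multidegree (f i) d) \<Longrightarrow> multidegree (\<lambda>A. \<Sum>i\<in>I. f i A) d"
proof (induction I rule: infinite_finite_induct)
  case (insert i I)
  then show ?case using multidegree_add[of "f i" d "\<lambda>A. \<Sum>i\<in>I. f i A"] by simp
qed (auto simp: multidegree_def intro: polyfun.const)

lemma multidegree_prod:
  "finite I \<Longrightarrow> (\<And>i. i \<in> I \<Longrightarrow> multidegree (f i) (d i)) \<Longrightarrow> multidegree (\<lambda>A. \<Prod>i\<in>I. f i A) (\<lambda>k. \<Sum>i\<in>I. d i k)"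
proof (induction I rule: finite_induct)
  case (insert i I)
  then show ?case using multidegree_mult[of "f i" "d i" "\<lambda>A. \<Prod>i\<in>I. f i A"] by simp
qed (simp add: multidegree_const)

lemma multidegree_power: "multidegree f d \<Longrightarrow> multidegree (\<lambda>A. f A ^ n) (\<lambda>k. n * d k)"
proof (induction n)
  case (Suc n)
  then show ?case using multidegree_mult[of f d] by fastforce
qed (simp add: multidegree_const)

lemma multidegree_coordinate: "multidegree (\<lambda>A. A $ k $ i $ j) (\<lambda>k'. if k' = k then 1 else 0)"
proof -
  have "(\<lambda>A. A $ k $ i $ j) \<in> coordinates" by (rule range_eqI[of _ _ "(k, i, j)"]) simp
  moreover have "(\<Prod>k'\<in>UNIV. c k' ^ (if k' = k then 1 else 0)) = c k" for c :: "'a \<Rightarrow> complex"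
    by (simp add: if_distrib cong: if_cong)
  ultimately show ?thesis by (simp add: multidegree_def polyfun.coord)
qed

lemma multidegree_multihomogeneous: "multidegree f d \<Longrightarrow> f \<in> multihomogeneous"
  by (auto simp: multihomogeneous_iff)

lemma multihomogeneous_mult:
  "f \<in> multihomogeneous \<Longrightarrow> g \<in> multihomogeneous \<Longrightarrow> (\<lambda>A. f A * g A) \<in> multihomogeneous"
  unfolding multihomogeneous_iff by (blast intro: multidegree_mult)

lemma multihomogeneous_polyfun: "f \<in> multihomogeneous \<Longrightarrow> f \<in> polyfun coordinates"
  by (auto simp: multihomogeneous_def)

text \<open>Two representing tuples differ by nonzero factors, one for each quadric, and
  multihomogeneity turns them into a nonzero factor of the value.\<close>

lemma value_at_eq_0_iff:
  assumes f: "f \<in> multihomogeneous" and A: "represents_tuple A p"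
  shows "value_at f p = 0 \<longleftrightarrow> f A = 0"
proof -
  obtain d where d: "multidegree f d" using f by (auto simp: multihomogeneous_iff)
  obtain c where c: "\<And>k. c k \<noteq> 0 \<and> A $ k = smat (c k) (rep_quadric (p $ k))"
    using A unfolding represents_tuple_def represents_def by metis
  have "A = (\<chi> k. smat (c k) ((\<chi> k. rep_quadric (p $ k)) $ k))" using c by (simp add: vec_eq_iff)
  then have "f A = f (\<chi> k. smat (c k) ((\<chi> k. rep_quadric (p $ k)) $ k))" by (rule arg_cong)
  also have "\<dots> = (\<Prod>k\<in>UNIV. c k ^ d k) * value_at f p"
    using d unfolding multidegree_def value_at_def by blast
  finally have "f A = (\<Prod>k\<in>UNIV. c k ^ d k) * value_at f p" .
  then show ?thesis using c by simp
qed

lemma value_at_mult: "value_at (\<lambda>A. f A * g A) p = value_at f p * value_at g p"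
  by (simp add: value_at_def)

lemma openin_zariski_value_at: "f \<in> multihomogeneous \<Longrightarrow> openin zariski {p. value_at f p \<noteq> 0}"
  unfolding zariski_def value_at_def by (rule topology_generated_by_Basis) blast

lemma topspace_zariski [simp]: "topspace zariski = UNIV"
proof -
  have "(\<lambda>A. 1) \<in> multihomogeneous" by (rule multidegree_multihomogeneous[OF multidegree_const])
  from openin_zariski_value_at[OF this] have "openin zariski UNIV" by (simp add: value_at_def)
  then show ?thesis by (meson openin_subset top.extremum_uniqueI)
qed

lemma openin_zariski_basis:
  assumes "openin zariski U" "p \<in> U"
  shows "\<exists>f\<in>multihomogeneous. value_at f p \<noteq> 0 \<and> {q. value_at f q \<noteq> 0} \<subseteq> U"
proof -
  have "generate_topology_on {{q. f (\<chi> k. rep_quadric (q $ k)) \<noteq> 0} | f. f \<in> multihomogeneous} U"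
    using assms(1) by (simp add: zariski_def openin_topology_generated_by_iff)
  then show ?thesis using assms(2)
  proof (induction arbitrary: p)
    case (Int U V)
    obtain f g where "f \<in> multihomogeneous" "value_at f p \<noteq> 0" "{q. value_at f q \<noteq> 0} \<subseteq> U"
      "g \<in> multihomogeneous" "value_at g p \<noteq> 0" "{q. value_at g q \<noteq> 0} \<subseteq> V"
      using Int.IH(1)[of p] Int.IH(2)[of p] Int.prems by blast
    then show ?case
      by (intro bexI[of _ "\<lambda>A. f A * g A"]) (auto simp: value_at_mult multihomogeneous_mult)
  next
    case (UN K)
    then obtain k where k: "k \<in> K" "p \<in> k" by blast
    then show ?case using UN.IH[OF k] by blast
  next
    case (Basis s)
    then show ?case unfolding value_at_def by blast
  qed simp
qed

lemma closedin_separate: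
  assumes Z: "closedin (subtopology zariski S) Z" and p: "p \<in> S" "p \<notin> Z"
  obtains f where "f \<in> multihomogeneous" "value_at f p \<noteq> 0" "\<And>z. z \<in> Z \<Longrightarrow> value_at f z = 0"
proof -
  obtain T where T: "closedin zariski T" "Z = T \<inter> S" using Z by (auto simp: closedin_subtopology)
  then have "openin zariski (- T)" "p \<in> - T" using p by (auto simp: closedin_def Compl_eq_Diff_UNIV)
  then obtain f where "f \<in> multihomogeneous" "value_at f p \<noteq> 0" "{q. value_at f q \<noteq> 0} \<subseteq> - T"
    using openin_zariski_basis by blast
  then show ?thesis using that[of f] T by blast
qed

lemma closedin_zero_set:
  assumes "f \<in> multihomogeneous"
  shows "closedin (subtopology zariski S) {p \<in> S. value_at f p = 0}"
proof -
  have "{p. value_at f p = 0} = - {p. value_at f p \<noteq> 0}" by auto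
  then have "closedin zariski {p. value_at f p = 0}"
    using openin_zariski_value_at[OF assms] by (simp add: closedin_def Compl_eq_Diff_UNIV Diff_Diff_Int)
  then show ?thesis unfolding closedin_subtopology by blast
qed

section \<open>Rational curves of tuples of quadrics\<close>

definition polynomial_curve :: "(complex \<Rightarrow> (complex^4^4)^'k) \<Rightarrow> bool" where
  "polynomial_curve \<gamma> \<longleftrightarrow> (\<forall>k i j. polynomial_map (\<lambda>t. \<gamma> t $ k $ i $ j))"

text \<open>At finitely many parameters a matrix may vanish, a rank may drop or two quadrics may
  coincide. This is harmless, since a polynomial in \<open>t\<close> is determined by all but
  finitely many of its values.\<close>

definition curve_in :: "(quadric^'k) set \<Rightarrow> (complex \<Rightarrow> (complex^4^4)^'k) \<Rightarrow> bool" where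
  "curve_in S \<gamma> \<longleftrightarrow> polynomial_curve \<gamma> \<and> finite {t. \<not> (\<exists>s\<in>S. represents_tuple (\<gamma> t) s)}"

lemma polynomial_map_along_curve:
  assumes "f \<in> multihomogeneous" "polynomial_curve \<gamma>"
  shows "polynomial_map (\<lambda>t. f (\<gamma> t))"
  using multihomogeneous_polyfun[OF assms(1)]
  by (rule polyfun_along_curve) (use assms(2) in \<open>auto simp: polynomial_curve_def\<close>)

text \<open>A product of two functions that vanishes on \<open>S\<close> vanishes along the curve, hence one of the
  factors vanishes along the curve.\<close>

lemma irreducible_if_curves:
  assumes ne: "S \<noteq> {}" and ST: "S \<subseteq> T" "T \<subseteq> zariski closure_of S"
    and curves: "\<And>p q. p \<in> S \<Longrightarrow> q \<in> S \<Longrightarrow>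
      \<exists>\<gamma>. curve_in S \<gamma> \<and> represents_tuple (\<gamma> 0) p \<and> represents_tuple (\<gamma> 1) q"
  shows "irreducible_space (subtopology zariski T)"
  unfolding irreducible_space_def
proof (intro conjI allI impI)
  show "topspace (subtopology zariski T) \<noteq> {}" using ne ST by auto
  fix C D assume C: "closedin (subtopology zariski T) C" and D: "closedin (subtopology zariski T) D"
    and CD: "topspace (subtopology zariski T) = C \<union> D"
  have sub: "C \<subseteq> T" "D \<subseteq> T" using C D closedin_subset by fastforce+
  \<comment> \<open>Since \<open>S\<close> is dense in \<open>T\<close>, a function that is not zero
    on all of \<open>T\<close> is nonzero at some point of \<open>S\<close>; thus only points of
    \<open>S\<close> have to be joined by curves.\<close>
  have sep: "\<exists>f p. f \<in> multihomogeneous \<and> p \<in> S \<and> value_at f p \<noteq> 0 \<and> (\<forall>z\<in>E. value_at f z = 0)"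
    if E: "closedin (subtopology zariski T) E" "E \<noteq> T" "E \<subseteq> T" for E
  proof -
    obtain p where p: "p \<in> T" "p \<notin> E" using E by blast
    obtain f where f: "f \<in> multihomogeneous" "value_at f p \<noteq> 0" "\<And>z. z \<in> E \<Longrightarrow> value_at f z = 0"
      using closedin_separate[OF E(1) p] by metis
    have "p \<in> zariski closure_of S" using p ST by blast
    moreover have "p \<in> {p. value_at f p \<noteq> 0}" using f(2) by simp
    ultimately have "\<exists>s. s \<in> S \<and> s \<in> {p. value_at f p \<noteq> 0}"
      using openin_zariski_value_at[OF f(1)] unfolding in_closure_of by (metis (lifting))
    then show ?thesis using f(1,3) by auto
  qed
  show "C = topspace (subtopology zariski T) \<or> D = topspace (subtopology zariski T)"
  proof (rule ccontr)
    assume "\<not> ?thesis"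
    then have "C \<noteq> T" "D \<noteq> T" by auto
    then obtain f p g q where f: "f \<in> multihomogeneous" "p \<in> S" "value_at f p \<noteq> 0" "\<forall>z\<in>C. value_at f z = 0"
      and g: "g \<in> multihomogeneous" "q \<in> S" "value_at g q \<noteq> 0" "\<forall>z\<in>D. value_at g z = 0"
      using sep[OF C _ sub(1)] sep[OF D _ sub(2)] by metis
    obtain \<gamma> where \<gamma>: "curve_in S \<gamma>" "represents_tuple (\<gamma> 0) p" "represents_tuple (\<gamma> 1) q"
      using curves f(2) g(2) by blast
    have "finite {t. f (\<gamma> t) * g (\<gamma> t) \<noteq> 0}"
    proof (rule finite_subset)
      show "{t. f (\<gamma> t) * g (\<gamma> t) \<noteq> 0} \<subseteq> {t. \<not> (\<exists>s\<in>S. represents_tuple (\<gamma> t) s)}"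
      proof clarsimp
        fix t s assume *: "f (\<gamma> t) \<noteq> 0" "g (\<gamma> t) \<noteq> 0" "s \<in> S" "represents_tuple (\<gamma> t) s"
        then have "value_at f s \<noteq> 0" "value_at g s \<noteq> 0"
          using value_at_eq_0_iff f(1) g(1) by blast+
        moreover have "s \<in> C \<union> D" using CD ST * by auto
        ultimately show False using f(4) g(4) by blast
      qed
      show "finite {t. \<not> (\<exists>s\<in>S. represents_tuple (\<gamma> t) s)}" using \<gamma>(1) by (simp add: curve_in_def)
    qed
    then have "(\<forall>t. f (\<gamma> t) = 0) \<or> (\<forall>t. g (\<gamma> t) = 0)"
      using \<gamma>(1) f(1) g(1) by (intro polynomial_map_mult_eq_0 polynomial_map_along_curve) (auto simp: curve_in_def)
    then show False
      using value_at_eq_0_iff[OF f(1) \<gamma>(2)] value_at_eq_0_iff[OF g(1) \<gamma>(3)] f(3) g(3) by blast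
  qed
qed

text \<open>Along the curve through \<open>p\<close>, both \<open>h\<close> and a function
  describing a neighbourhood of \<open>p\<close> have finitely many zeros. So every neighbourhood of
  \<open>p\<close> contains a point of \<open>S\<close> at which \<open>h\<close> is
  nonzero.\<close>

lemma generically_if_curves:
  assumes h: "h \<in> multihomogeneous"
    and P: "\<And>p. p \<in> S \<Longrightarrow> value_at h p \<noteq> 0 \<Longrightarrow> P p"
    and curves: "\<And>p. p \<in> S \<Longrightarrow> \<exists>\<gamma> t. curve_in S \<gamma> \<and> represents_tuple (\<gamma> 0) p \<and> h (\<gamma> t) \<noteq> 0"
  shows "generically (subtopology zariski S) P"
  unfolding generically_def
proof (intro exI conjI)
  define U where "U = S \<inter> {p. value_at h p \<noteq> 0}"
  show "openin (subtopology zariski S) U"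
    unfolding U_def by (rule openin_subtopology_Int2[OF openin_zariski_value_at[OF h]])
  show "\<forall>x\<in>U. P x" using P by (auto simp: U_def)
  have "p \<in> subtopology zariski S closure_of U" if p: "p \<in> S" for p
    unfolding in_closure_of
  proof (intro conjI allI impI)
    show "p \<in> topspace (subtopology zariski S)" using p by simp
    fix V assume V: "p \<in> V \<and> openin (subtopology zariski S) V"
    then obtain W where W: "openin zariski W" "V = W \<inter> S" by (auto simp: openin_subtopology)
    then obtain f where f: "f \<in> multihomogeneous" "value_at f p \<noteq> 0" "{q. value_at f q \<noteq> 0} \<subseteq> W"
      using openin_zariski_basis V by blast
    obtain \<gamma> t where \<gamma>: "curve_in S \<gamma>" "represents_tuple (\<gamma> 0) p" "h (\<gamma> t) \<noteq> 0"
      using curves[OF p] by blast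
    have "f (\<gamma> 0) \<noteq> 0" using value_at_eq_0_iff[OF f(1) \<gamma>(2)] f(2) by blast
    then have "finite {t. f (\<gamma> t) = 0}" "finite {t. h (\<gamma> t) = 0}"
      using \<gamma> f(1) h by (auto intro!: polynomial_map_cofinite polynomial_map_along_curve simp: curve_in_def)
    then have "finite ({t. f (\<gamma> t) = 0} \<union> {t. h (\<gamma> t) = 0} \<union> {t. \<not> (\<exists>s\<in>S. represents_tuple (\<gamma> t) s)})"
      using \<gamma>(1) by (auto simp: curve_in_def)
    then have "\<exists>t'. t' \<notin> {t. f (\<gamma> t) = 0} \<union> {t. h (\<gamma> t) = 0} \<union> {t. \<not> (\<exists>s\<in>S. represents_tuple (\<gamma> t) s)}"
      by (rule ex_new_if_finite[OF infinite_UNIV_char_0])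
    then obtain t' s where s: "f (\<gamma> t') \<noteq> 0" "h (\<gamma> t') \<noteq> 0" "s \<in> S" "represents_tuple (\<gamma> t') s"
      by auto
    then have "value_at f s \<noteq> 0" "value_at h s \<noteq> 0"
      by (simp_all add: value_at_eq_0_iff[OF f(1) s(4)] value_at_eq_0_iff[OF h s(4)])
    then have "s \<in> U" "s \<in> V" using s(3) f(3) W(2) by (auto simp: U_def)
    then show "\<exists>y. y \<in> U \<and> y \<in> V" by blast
  qed
  then show "subtopology zariski S closure_of U = topspace (subtopology zariski S)"
    using closure_of_subset_topspace by fastforce
qed

section \<open>Spans of two and three matrices\<close>

lemma span_2: "smat.span {A, B} = {smat a A + smat b B | a b. True}"
proof -
  have "X \<in> smat.span {A, B} \<longleftrightarrow> (\<exists>a b. X = smat a A + smat b B)" for X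
  proof -
    have "X \<in> smat.span {A, B} \<longleftrightarrow> (\<exists>a b. X - smat a A = smat b B)"
      unfolding smat.span_insert[of A] by (auto simp: smat.span_singleton)
    then show ?thesis by (simp add: diff_eq_eq add.commute)
  qed
  then show ?thesis by blast
qed

lemma span_3: "smat.span {A, B, C} = {smat a A + smat b B + smat c C | a b c. True}"
proof -
  have "X \<in> smat.span {A, B, C} \<longleftrightarrow> (\<exists>a b c. X = smat a A + smat b B + smat c C)" for X
  proof -
    have "X \<in> smat.span {A, B, C} \<longleftrightarrow> (\<exists>a b c. X - smat a A = smat b B + smat c C)"
      unfolding smat.span_insert[of A] by (auto simp: span_2)
    then show ?thesis by (simp add: diff_eq_eq add_ac)
  qed
  then show ?thesis by blast
qed

lemma dim_span_2:
  assumes "\<And>a b. smat a A + smat b B = 0 \<Longrightarrow> a = 0 \<and> b = 0"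
  shows "smat.dim (smat.span {A, B}) = 2"
proof -
  have "B \<noteq> 0" using assms[of 0 1] by auto
  moreover have "A \<notin> smat.span {B}"
    using assms[of 1 "- _"] by (auto simp: smat.span_singleton)
  ultimately have "smat.independent {A, B}" "card {A, B} = 2"
    using smat.span_base[of B "{B}"] by (auto simp: smat.independent_insert card_insert_if)
  then show ?thesis by (metis smat.dim_span_eq_card_independent)
qed

lemma dim_span_3:
  assumes ind: "\<And>a b c. smat a A + smat b B + smat c C = 0 \<Longrightarrow> a = 0 \<and> b = 0 \<and> c = 0"
  shows "smat.dim (smat.span {A, B, C}) = 3"
proof -
  have C: "C \<noteq> 0" using ind[of 0 0 1] by auto
  have B: "B \<notin> smat.span {C}"
    using ind[of 0 1 "- _"] by (auto simp: smat.span_singleton)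
  have A: "A \<notin> smat.span {B, C}"
  proof
    assume "A \<in> smat.span {B, C}"
    then obtain b c where "A = smat b B + smat c C" by (auto simp: span_2)
    then show False using ind[of 1 "-b" "-c"] by simp
  qed
  have "smat.independent {A, B, C}"
    using A B C by (auto simp: smat.independent_insert smat.span_base)
  moreover have "card {A, B, C} = 3"
    using A B smat.span_base[of B "{B, C}"] smat.span_base[of C "{B, C}"] smat.span_base[of C "{C}"]
    by (auto simp: card_insert_if)
  ultimately show ?thesis by (metis smat.dim_span_eq_card_independent)
qed

lemma symmetric_subspace: "smat.subspace {A :: complex^4^4. transpose A = A}"
  by (rule smat.subspaceI) (auto simp: transpose_add transpose_smat transpose_def vec_eq_iff)

lemma represents_mem_subspace:
  assumes "smat.subspace V" "represents A q"
  shows "rep_quadric q \<in> V \<longleftrightarrow> A \<in> V"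
proof -
  obtain c where c: "c \<noteq> 0" "A = smat c (rep_quadric q)" using assms(2) by (auto simp: represents_def)
  then have "rep_quadric q = smat (inverse c) A" by simp
  then show ?thesis using assms(1) c by (metis smat.subspace_scale)
qed

lemma span_rep_image:
  assumes "\<And>q. q \<in> S \<Longrightarrow> represents (M q) q"
  shows "smat.span (rep_quadric ` S) = smat.span (M ` S)"
proof -
  have "rep_quadric q \<in> smat.span (M ` S) \<and> M q \<in> smat.span (rep_quadric ` S)" if "q \<in> S" for q
    using that represents_mem_subspace[OF smat.subspace_span assms[OF that]]
    by (auto intro: smat.span_base)
  then show ?thesis unfolding smat.span_eq by blast
qed

lemma proj_span_2:
  assumes "represents A q" "represents B r" "q \<noteq> r"
  shows "proj_span {q, r} = {p. \<exists>a b. rep_quadric p = smat a A + smat b B}"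
proof -
  have "smat.span (rep_quadric ` {q, r}) = smat.span ((\<lambda>p. if p = q then A else B) ` {q, r})"
    by (rule span_rep_image) (use assms in auto)
  also have "(\<lambda>p. if p = q then A else B) ` {q, r} = {A, B}" using assms(3) by auto
  finally show ?thesis by (simp add: proj_span_def span_2)
qed

lemma proj_span_3:
  assumes "represents A q" "represents B r" "represents C s" "distinct [q, r, s]"
  shows "proj_span {q, r, s} = {p. \<exists>a b c. rep_quadric p = smat a A + smat b B + smat c C}"
    and "proj_span {q, r, s} = {p. rep_quadric p \<in> smat.span {A, B, C}}"
proof -
  have "smat.span (rep_quadric ` {q, r, s})
      = smat.span ((\<lambda>p. if p = q then A else if p = r then B else C) ` {q, r, s})"
    by (rule span_rep_image) (use assms in auto)
  also have "(\<lambda>p. if p = q then A else if p = r then B else C) ` {q, r, s} = {A, B, C}"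
    using assms(4) by auto
  finally have e: "smat.span (rep_quadric ` {q, r, s}) = smat.span {A, B, C}" .
  show "proj_span {q, r, s} = {p. rep_quadric p \<in> smat.span {A, B, C}}"
    by (simp only: proj_span_def e)
  show "proj_span {q, r, s} = {p. \<exists>a b c. rep_quadric p = smat a A + smat b B + smat c C}"
    unfolding proj_span_def e by (simp add: span_3)
qed

section \<open>Triples with a common basket have the property\<close>

text \<open>In combinations with coefficient sum zero the matrix \<open>B\<close> cancels. What
  remains is diagonal in \<open>l 1, l 2, l 3\<close>, so its rank is the number of nonzero
  coefficients, and a vanishing coefficient places the point on one of the lines
  \<open>[q_i, q_j]\<close>. The common vertex is \<open>w 4\<close>, where the three forms
  vanish.\<close>

lemma property_triples_if_decomposition:
  fixes t :: "quadric^3"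
  assumes d: "dual_basis l w" and B: "transpose B = B"
    and t1: "represents (B + outer (l 1)) (t $ 1)"
    and t2: "represents (B + outer (l 2)) (t $ 2)"
    and t3: "represents (B + outer (l 3)) (t $ 3)"
    and r: "\<And>i. qrank (t $ i) \<ge> 3" and det: "det (B + outer (l 1)) \<noteq> 0"
  shows "t \<in> property_triples"
proof -
  define M where "M i = B + outer (l i)" for i
  have lw: "linform (l i) (w j) = (if i = j then 1 else 0)" for i j
    using d by (simp add: dual_basis_def)
  have wl: "linform (w i) (l j) = (if i = j then 1 else 0)" for i j
    using dual_basis_commute[OF d] by (simp add: dual_basis_def)
  have w4: "w 4 \<noteq> 0" using lw[of 4 4] by auto
  have Mw: "M i *v w 4 = B *v w 4" if "i \<noteq> 4" for i
    using that by (simp add: M_def matrix_vector_mult_add_rdistrib outer_mult_vec lw)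
  have "M 1 *v w 4 \<noteq> 0" using det w4 det_eq_0_iff_kernel[of "M 1"] by (auto simp: M_def)
  \<comment> \<open>At \<open>w 4\<close> a combination of \<open>M 1, M 2, M 3\<close> takes this
    vector times the coefficient sum. As the vector is nonzero, a linear relation must have
    coefficient sum zero, and then the squares alone are compared.\<close>
  then have Bw: "B *v w 4 \<noteq> 0" using Mw[of 1] by simp
  have comb: "smat a (M 1) + smat b (M 2) + smat c (M 3)
      = smat (a + b + c) B + (smat a (outer (l 1)) + smat b (outer (l 2)) + smat c (outer (l 3)))" for a b c
    by (simp add: M_def algebra_simps smat.scale_right_distrib smat.scale_left_distrib)
  have ind: "a = 0 \<and> b = 0 \<and> c = 0" if 0: "smat a (M 1) + smat b (M 2) + smat c (M 3) = 0" for a b c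
  proof -
    have "(a + b + c) *s (B *v w 4) = (smat a (M 1) + smat b (M 2) + smat c (M 3)) *v w 4"
      by (simp add: matrix_vector_mult_add_rdistrib smat_mult_vec Mw vec_eq_iff algebra_simps)
    also have "\<dots> = 0" by (simp add: 0)
    finally have s: "a + b + c = 0" using Bw by (simp only: vector_mul_eq_0) blast
    have "linform (w i) ((smat a (outer (l 1)) + smat b (outer (l 2)) + smat c (outer (l 3))) *v w i) = 0" for i
      using 0 unfolding comb s by simp
    from this[of 1] this[of 2] this[of 3] show ?thesis
      by (simp add: matrix_vector_mult_add_rdistrib smat_mult_vec outer_mult_vec linform_add linform_scale lw wl)
  qed
  have M: "represents (M 1) (t $ 1)" "represents (M 2) (t $ 2)" "represents (M 3) (t $ 3)"
    using t1 t2 t3 by (simp_all add: M_def)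
  have dist: "distinct [t $ 1, t $ 2, t $ 3]"
  proof -
    have "t $ 1 \<noteq> t $ 2"
    proof
      assume "t $ 1 = t $ 2"
      then obtain c where "c \<noteq> 0" "M 2 = smat c (M 1)" using represents_proportional M by metis
      then show False using ind[of c "-1" 0] by simp
    qed
    moreover have "t $ 1 \<noteq> t $ 3"
    proof
      assume "t $ 1 = t $ 3"
      then obtain c where "c \<noteq> 0" "M 3 = smat c (M 1)" using represents_proportional M by metis
      then show False using ind[of c 0 "-1"] by simp
    qed
    moreover have "t $ 2 \<noteq> t $ 3"
    proof
      assume "t $ 2 = t $ 3"
      then obtain c where "c \<noteq> 0" "M 3 = smat c (M 2)" using represents_proportional M by metis
      then show False using ind[of 0 c "-1"] by simp
    qed
    ultimately show ?thesis by simp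
  qed
  then have ne: "t $ 1 \<noteq> t $ 2" "t $ 1 \<noteq> t $ 3" "t $ 2 \<noteq> t $ 3" by auto
  have symM: "transpose (M i) = M i" for i by (simp add: M_def transpose_add B)
  have plane: "is_plane (proj_span {t $ 1, t $ 2, t $ 3})"
    unfolding proj_subspace_def
  proof (intro exI conjI)
    show "smat.subspace (smat.span {M 1, M 2, M 3})" by (rule smat.subspace_span)
    show "smat.span {M 1, M 2, M 3} \<subseteq> {A. transpose A = A}"
      by (rule smat.span_minimal[OF _ symmetric_subspace]) (simp add: symM)
    show "smat.dim (smat.span {M 1, M 2, M 3}) = 2 + 1" using dim_span_3[OF ind] by simp
    show "proj_span {t $ 1, t $ 2, t $ 3} = {q. rep_quadric q \<in> smat.span {M 1, M 2, M 3}}"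
      by (rule proj_span_3(2)[OF M dist])
  qed
  define V where "V = smat.span {M 1 - M 2, M 2 - M 3}"
  define L where "L = {q. rep_quadric q \<in> V}"
  have V: "A \<in> V \<longleftrightarrow> (\<exists>a b c. a + b + c = 0 \<and> A = smat a (M 1) + smat b (M 2) + smat c (M 3))" for A
  proof
    assume "A \<in> V"
    then obtain x y where A: "A = smat x (M 1 - M 2) + smat y (M 2 - M 3)" by (auto simp: V_def span_2)
    have "A = smat x (M 1) + smat (y - x) (M 2) + smat (- y) (M 3)"
      unfolding A by (simp add: vec_eq_iff algebra_simps)
    then show "\<exists>a b c. a + b + c = 0 \<and> A = smat a (M 1) + smat b (M 2) + smat c (M 3)"
      by (intro exI[of _ x] exI[of _ "y - x"] exI[of _ "- y"]) simp
  next
    assume "\<exists>a b c. a + b + c = 0 \<and> A = smat a (M 1) + smat b (M 2) + smat c (M 3)"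
    then obtain a b c where s: "a + b + c = 0" and A: "A = smat a (M 1) + smat b (M 2) + smat c (M 3)" by blast
    have b: "b = - a - c" using s by (simp add: algebra_simps eq_neg_iff_add_eq_0)
    have "A = smat a (M 1 - M 2) + smat (- c) (M 2 - M 3)"
      unfolding A b by (simp add: vec_eq_iff algebra_simps)
    then show "A \<in> V" unfolding V_def span_2 by blast
  qed
  have pencil: "is_pencil L"
    unfolding proj_subspace_def
  proof (intro exI conjI)
    show "smat.subspace V" unfolding V_def by (rule smat.subspace_span)
    show "V \<subseteq> {A. transpose A = A}"
      unfolding V_def by (rule smat.span_minimal[OF _ symmetric_subspace]) (simp add: symM transpose_diff)
    have "a = 0 \<and> b = 0" if "smat a (M 1 - M 2) + smat b (M 2 - M 3) = 0" for a b
    proof -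
      have "smat a (M 1) + smat (b - a) (M 2) + smat (- b) (M 3) = smat a (M 1 - M 2) + smat b (M 2 - M 3)"
        by (simp add: vec_eq_iff algebra_simps)
      then show ?thesis using ind[of a "b - a" "- b"] that by simp
    qed
    then show "smat.dim V = 1 + 1" unfolding V_def one_add_one by (rule dim_span_2)
  qed (rule L_def)
  have comb0: "smat a (M 1) + smat b (M 2) + smat c (M 3)
      = smat a (outer (l 1)) + smat b (outer (l 2)) + smat c (outer (l 3))" if "a + b + c = 0" for a b c
    using comb[of a b c] that by simp
  have ker: "A *v w 4 = 0" if A: "A \<in> V" for A
  proof -
    obtain a b c where "a + b + c = 0" "A = smat a (M 1) + smat b (M 2) + smat c (M 3)" using V[THEN iffD1, OF A] by (elim exE conjE)
    then show ?thesis using comb0[of a b c]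
      by (simp add: matrix_vector_mult_add_rdistrib smat_mult_vec outer_mult_vec lw)
  qed
  have rank3: "rank (smat a (outer (l 1)) + smat b (outer (l 2)) + smat c (outer (l 3))) = 3"
    if "a \<noteq> 0" "b \<noteq> 0" "c \<noteq> 0" for a b c
    using rank_sum_outer[OF d, of "{1, 2, 3}" "\<lambda>i. if i = 1 then a else if i = 2 then b else c"] that
    by (simp add: add.assoc)
  have rank2: "rank (smat a (outer (l i)) + smat b (outer (l j))) = 2"
    if "a \<noteq> 0" "b \<noteq> 0" "i \<noteq> j" for a b i j
    using rank_sum_outer[OF d, of "{i, j}" "\<lambda>k. if k = i then a else b"] that by auto
  have cone: "is_cone q" "w 4 \<in> vertex q" if "q \<in> L" for q
    using that ker rank_le_3_if_kernel[OF w4] by (auto simp: L_def is_cone_def vertex_def qrank_def)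
  have rk: "{q \<in> L. qrank q = 2} =
      L \<inter> (proj_span {t $ 1, t $ 2} \<union> proj_span {t $ 1, t $ 3} \<union> proj_span {t $ 2, t $ 3})"
  proof (intro Collect_cong set_eqI iffI)
    fix q assume "q \<in> {q \<in> L. qrank q = 2}"
    then have q: "q \<in> L" "rank (rep_quadric q) = 2" by (auto simp: qrank_def)
    then obtain a b c where s: "a + b + c = 0" and A: "rep_quadric q = smat a (M 1) + smat b (M 2) + smat c (M 3)"
      using V[of "rep_quadric q", THEN iffD1] by (auto simp: L_def)
    have "a = 0 \<or> b = 0 \<or> c = 0" using rank3[of a b c] q(2) A comb0[OF s] by auto
    then have "rep_quadric q = smat a (M 1) + smat b (M 2) \<or> rep_quadric q = smat a (M 1) + smat c (M 3)
        \<or> rep_quadric q = smat b (M 2) + smat c (M 3)"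
      using A by (elim disjE) simp_all
    then have "q \<in> proj_span {t $ 1, t $ 2} \<union> proj_span {t $ 1, t $ 3} \<union> proj_span {t $ 2, t $ 3}"
      unfolding proj_span_2[OF M(1,2) ne(1)] proj_span_2[OF M(1,3) ne(2)] proj_span_2[OF M(2,3) ne(3)]
      by blast
    then show "q \<in> L \<inter> (proj_span {t $ 1, t $ 2} \<union> proj_span {t $ 1, t $ 3} \<union> proj_span {t $ 2, t $ 3})"
      using q(1) by blast
  next
    fix q assume *: "q \<in> L \<inter> (proj_span {t $ 1, t $ 2} \<union> proj_span {t $ 1, t $ 3} \<union> proj_span {t $ 2, t $ 3})"
    then obtain a b c where s: "a + b + c = 0" and A: "rep_quadric q = smat a (M 1) + smat b (M 2) + smat c (M 3)"
      using V[of "rep_quadric q", THEN iffD1] by (auto simp: L_def)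
    have u: "a = x \<and> b = y \<and> c = z" if "rep_quadric q = smat x (M 1) + smat y (M 2) + smat z (M 3)" for x y z
    proof -
      have "smat (a - x) (M 1) + smat (b - y) (M 2) + smat (c - z) (M 3) = 0"
        using A that by (simp add: smat.scale_left_diff_distrib algebra_simps)
      then show ?thesis using ind[of "a - x" "b - y" "c - z"] by simp
    qed
    have z: "a = 0 \<or> b = 0 \<or> c = 0"
    proof -
      from * consider x y where "rep_quadric q = smat x (M 1) + smat y (M 2)"
        | x y where "rep_quadric q = smat x (M 1) + smat y (M 3)"
        | x y where "rep_quadric q = smat x (M 2) + smat y (M 3)"
        unfolding proj_span_2[OF M(1,2) ne(1)] proj_span_2[OF M(1,3) ne(2)] proj_span_2[OF M(2,3) ne(3)]
        by blast
      then show ?thesis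
      proof cases
        case 1 then show ?thesis using u[of _ _ 0] by simp
      next
        case 2 then show ?thesis using u[of _ 0] by simp
      next
        case 3 then show ?thesis using u[of 0] by simp
      qed
    qed
    have nz: "a \<noteq> 0 \<or> b \<noteq> 0 \<or> c \<noteq> 0" using A rep_nonzero[of q] by (auto simp del: rep_nonzero)
    have A': "rep_quadric q = smat a (outer (l 1)) + smat b (outer (l 2)) + smat c (outer (l 3))"
      using A comb0[OF s] by simp
    \<comment> \<open>The coefficients sum to zero, are not all zero, and one of them is zero; so
      exactly two squares remain.\<close>
    have "rank (rep_quadric q) = 2"
    proof (cases "c = 0")
      case True
      then have "b = - a" "a \<noteq> 0" using s nz by (auto simp: add_eq_0_iff)
      then show ?thesis using True A' rank2[of a b 1 2] by simp
    next
      case False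
      show ?thesis
      proof (cases "b = 0")
        case True
        then have "a \<noteq> 0" using s False by auto
        then show ?thesis using True False A' rank2[of a c 1 3] by simp
      next
        case b: False
        then have "a = 0" using z False by simp
        then show ?thesis using b False A' rank2[of b c 2 3] by simp
      qed
    qed
    then show "q \<in> {q \<in> L. qrank q = 2}" using * by (simp add: qrank_def)
  qed
  have sub: "L \<subseteq> proj_span {t $ 1, t $ 2, t $ 3}"
  proof
    fix q assume "q \<in> L"
    then show "q \<in> proj_span {t $ 1, t $ 2, t $ 3}"
      unfolding proj_span_3(1)[OF M dist] L_def mem_Collect_eq V by blast
  qed
  have "triple_property t"
    unfolding triple_property_def using plane pencil sub cone rk w4 by blast
  then show ?thesis using dist r by (simp add: property_triples_def)
qed

section \<open>Triples with the property admit a common basket\<close>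

lemma dual_basis_of_independent:
  assumes "\<And>c. (\<Sum>i\<in>UNIV. c i *s u i) = 0 \<Longrightarrow> c = (\<lambda>i. 0)"
  shows "\<exists>l. dual_basis l u"
proof -
  have "det (transpose (\<chi> i. u i)) \<noteq> 0"
  proof
    assume "det (transpose (\<chi> i. u i)) = 0"
    then obtain x where x: "x \<noteq> 0" "transpose (\<chi> i. u i) *v x = 0"
      unfolding det_eq_0_iff_kernel by blast
    have "(\<Sum>i\<in>UNIV. (x $ i) *s u i) = transpose (\<chi> i. u i) *v x"
      by (simp add: vec_eq_iff matrix_vector_mult_def transpose_def mult.commute)
    then have 0: "(\<lambda>i. x $ i) = (\<lambda>i. 0)" using assms[of "\<lambda>i. x $ i"] x(2) by simp
    have "x = 0" using fun_cong[OF 0] by (simp add: vec_eq_iff)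
    then show False using x(1) by simp
  qed
  then have "det (\<chi> i. u i) \<noteq> 0" by simp
  then obtain l where "dual_basis u l" using dual_basis_exists by blast
  then show ?thesis using dual_basis_commute by blast
qed

text \<open>Kernel vectors of the three singular members are orthogonal for the whole pencil.\<close>

lemma pencil_diagonalizable:
  fixes D :: "4 \<Rightarrow> complex^4^4"
  assumes sym: "\<And>i. i \<noteq> 4 \<Longrightarrow> transpose (D i) = D i"
    and sum: "D 1 + D 2 + D 3 = 0"
    and v: "v \<noteq> 0" "\<And>i. i \<noteq> 4 \<Longrightarrow> D i *v v = 0"
    and r2: "\<And>i. i \<noteq> 4 \<Longrightarrow> rank (D i) \<le> 2"
    and r3: "rank (D 1 + smat s (D 2)) \<ge> 3"
  obtains l u where "dual_basis l u" "\<And>i. i \<noteq> 4 \<Longrightarrow> D i *v u i = 0" "u 4 = v"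
    "\<And>i j k. k \<noteq> 4 \<Longrightarrow> i \<noteq> j \<Longrightarrow> linform (u i) (D k *v u j) = 0"
proof -
  \<comment> \<open>A member of rank at most two has a kernel of dimension at least two, so the
    kernel contains a vector off the line of the common vertex \<open>v\<close>.\<close>
  have "\<forall>i. i \<noteq> 4 \<longrightarrow> (\<exists>x. D i *v x = 0 \<and> (\<forall>c. x \<noteq> c *s v))"
    using kernel_rank_le_2 sym r2 v by blast
  then obtain u' where u': "\<And>i. i \<noteq> 4 \<Longrightarrow> D i *v u' i = 0 \<and> (\<forall>c. u' i \<noteq> c *s v)" by metis
  define u where "u i = (if i = 4 then v else u' i)" for i
  have u4: "u 4 = v" by (simp add: u_def)
  have Du: "D i *v u i = 0" and u_ne: "u i \<noteq> c *s v" if "i \<noteq> 4" for i c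
    using u'[OF that] that by (auto simp: u_def)
  define W where "W = D 1 + smat s (D 2)"
  have symW: "transpose W = W" by (simp add: W_def transpose_add transpose_smat sym)
  have Wv: "W *v v = 0" by (simp add: W_def matrix_vector_mult_add_rdistrib smat_mult_vec v)
  have kerW: "\<exists>c. x = c *s v" if "W *v x = 0" for x
    by (rule kernel_rank_3[OF r3[folded W_def] that Wv v(1)])
  have bil3: "linform x (D 3 *v y) = - linform x (D 1 *v y) - linform x (D 2 *v y)" for x y
  proof -
    have "linform x ((D 1 + D 2 + D 3) *v y) = 0" by (simp add: sum)
    then show ?thesis by (simp add: matrix_vector_mult_add_rdistrib linform_add eq_diff_eq eq_neg_iff_add_eq_0 algebra_simps)
  qed
  \<comment> \<open>\<open>D i\<close> kills \<open>u i\<close> and \<open>D j\<close> kills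
    \<open>u j\<close>, so by symmetry two of the three pairings of \<open>u i\<close> with
    \<open>u j\<close> vanish; the third follows because the members sum to zero.\<close>
  have orth: "linform (u i) (D k *v u j) = 0" if k: "k \<noteq> 4" and ij: "i \<noteq> j" for i j k
  proof (cases "i = 4 \<or> j = 4")
    case True
    then show ?thesis
      using linform_symmetric[OF sym[OF k], of "u i" "u j"] v(2)[OF k] u4 by auto
  next
    case False
    then have z: "linform (u i) (D j *v u j) = 0" "linform (u i) (D i *v u j) = 0"
      using Du linform_symmetric[OF sym[of i], of "u i" "u j"] by auto
    have "linform (u i) (D 1 *v u j) = 0 \<and> linform (u i) (D 2 *v u j) = 0 \<and> linform (u i) (D 3 *v u j) = 0"
      using z ij False bil3[of "u i" "u j"] exhaust_4[of i] exhaust_4[of j] by auto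
    then show ?thesis using k exhaust_4[of k] by auto
  qed
  have orthW: "linform (u i) (W *v u j) = 0" if "i \<noteq> j" for i j
    using orth[OF _ that] by (simp add: W_def matrix_vector_mult_add_rdistrib smat_mult_vec linform_add linform_scale)
  have pair: "\<alpha> = 0 \<and> \<beta> = 0 \<and> \<gamma> = 0"
    if 0: "\<alpha> *s u i + \<beta> *s u k + \<gamma> *s v = 0" and ik: "i \<noteq> 4" "k \<noteq> 4" "i \<noteq> k" for \<alpha> \<beta> \<gamma> i k
  proof -
    \<comment> \<open>A relation with \<open>b \<noteq> 0\<close> would put \<open>u k\<close> into
      the kernel of \<open>D i\<close>. It also lies in the kernel of \<open>D k\<close>, hence of
      all members and of \<open>W\<close>, whose kernel is only the line of
      \<open>v\<close>.\<close>
    have half: "b = 0" if 0: "a *s u i + b *s u k + c *s v = 0" and ik: "i \<noteq> 4" "k \<noteq> 4" "i \<noteq> k" for a b c i k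
    proof (rule ccontr)
      assume b: "b \<noteq> 0"
      have "D i *v (a *s u i + b *s u k + c *s v) = 0" unfolding 0 by simp
      then have "b *s (D i *v u k) = 0"
        using Du[OF ik(1)] v(2)[OF ik(1)] by (simp add: matrix_vector_right_distrib vector_scalar_commute)
      then have ki: "D i *v u k = 0" using b by simp
      have kk: "D k *v u k = 0" using Du ik by blast
      have "D 1 *v u k + D 2 *v u k + D 3 *v u k = 0"
        using arg_cong[OF sum, of "\<lambda>M. M *v u k"] by (simp add: matrix_vector_mult_add_rdistrib)
      then have "D 1 *v u k = 0 \<and> D 2 *v u k = 0"
        using ki kk ik exhaust_4[of i] exhaust_4[of k] by auto
      then have "W *v u k = 0" by (simp add: W_def matrix_vector_mult_add_rdistrib smat_mult_vec)
      then show False using kerW u_ne[OF ik(2)] by blast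
    qed
    have "\<beta> = 0" using half[OF 0 ik] .
    moreover have "\<alpha> = 0" using half[of \<beta> k \<alpha> i \<gamma>] 0 ik by (simp add: add_ac)
    ultimately show ?thesis using 0 v(1) by simp
  qed
  have "\<exists>l. dual_basis l u"
  proof (rule dual_basis_of_independent)
    fix c :: "4 \<Rightarrow> complex" assume "(\<Sum>i\<in>UNIV. c i *s u i) = 0"
    then have 0: "c 1 *s u 1 + c 2 *s u 2 + c 3 *s u 3 + c 4 *s v = 0" by (simp add: sum_4 u4)
    \<comment> \<open>Were all three nonzero, pairing the relation through \<open>W\<close> with
      \<open>u 1\<close> and \<open>u 2\<close> would make these isotropic. Then
      \<open>W *v u 1\<close> and \<open>W *v u 2\<close> would both be orthogonal to
      \<open>u 1, u 2, v\<close>, hence proportional. Some combination of \<open>u 1\<close> and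
      \<open>u 2\<close> would lie in the kernel of \<open>W\<close>, contrary to independence from
      \<open>v\<close>.\<close>
    have "c 1 = 0 \<or> c 2 = 0 \<or> c 3 = 0"
    proof (rule ccontr)
      assume "\<not> ?thesis"
      then have c: "c 1 \<noteq> 0" "c 2 \<noteq> 0" by auto
      have Wu: "linform (u j) (W *v (c 1 *s u 1 + c 2 *s u 2 + c 3 *s u 3 + c 4 *s v)) = 0" for j
        unfolding 0 by simp
      have e1: "linform (u 1) (W *v u 1) = 0" and e2: "linform (u 2) (W *v u 2) = 0"
        using Wu[of 1] Wu[of 2] c Wv
        by (simp_all add: matrix_vector_right_distrib vector_scalar_commute linform_add linform_scale orthW)
      have "W *v u 1 \<noteq> 0" using kerW u_ne[of 1] by auto
      then obtain x0 where x0: "linform x0 (W *v u 1) \<noteq> 0" using linform_eq_0_imp by blast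
      define u2 where "u2 i = (if i = 1 then u 1 else if i = 2 then u 2 else if i = 3 then x0 else v)" for i :: 4
      have "\<exists>l. dual_basis l u2"
      proof (rule dual_basis_of_independent)
        fix d :: "4 \<Rightarrow> complex" assume "(\<Sum>i\<in>UNIV. d i *s u2 i) = 0"
        then have d: "d 1 *s u 1 + d 2 *s u 2 + d 3 *s x0 + d 4 *s v = 0" by (simp add: sum_4 u2_def)
        have "linform (d 1 *s u 1 + d 2 *s u 2 + d 3 *s x0 + d 4 *s v) (W *v u 1) = 0"
          unfolding d by simp
        moreover have "linform v (W *v u 1) = 0" using orthW[of 4 1] by (simp add: u4)
        ultimately have "d 3 = 0"
          using x0 e1 orthW[of 2 1] by (simp add: linform_add_left linform_scale_left)
        then have "d 1 = 0 \<and> d 2 = 0 \<and> d 4 = 0" using d pair[of "d 1" 1 "d 2" 2 "d 4"] by simp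
        then show "d = (\<lambda>i. 0)" using \<open>d 3 = 0\<close> by (auto simp: fun_eq_iff forall_4)
      qed
      then obtain l where l: "dual_basis l u2" by blast
      \<comment> \<open>The coefficients make \<open>W *v y\<close> orthogonal to \<open>x0\<close>
        as well, hence to the whole basis \<open>u2\<close>.\<close>
      define y where "y = linform x0 (W *v u 2) *s u 1 - linform x0 (W *v u 1) *s u 2"
      have "W *v y = 0"
      proof (rule dual_basis_complete[OF dual_basis_commute[OF l]])
        have "linform v (W *v x) = 0" for x
          using linform_symmetric[OF symW, of v x] Wv by simp
        then show "linform (u2 j) (W *v y) = 0" for j
          using exhaust_4[of j] e1 e2 orthW[of 1 2] orthW[of 2 1]
          by (auto simp: u2_def y_def matrix_vector_mult_diff_distrib vector_scalar_commute linform_diff linform_scale)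
      qed
      then obtain a where "y = a *s v" using kerW by blast
      then have "linform x0 (W *v u 2) *s u 1 + (- linform x0 (W *v u 1)) *s u 2 + (- a) *s v = 0"
        by (simp add: y_def algebra_simps)
      then show False using pair[of _ 1 _ 2] x0 by fastforce
    qed
    then have "c 1 = 0 \<and> c 2 = 0 \<and> c 3 = 0 \<and> c 4 = 0"
      using 0 pair[of "c 2" 2 "c 3" 3 "c 4"] pair[of "c 1" 1 "c 3" 3 "c 4"] pair[of "c 1" 1 "c 2" 2 "c 4"]
      by auto
    then show "c = (\<lambda>i. 0)" by (auto simp: fun_eq_iff forall_4)
  qed
  then obtain l where "dual_basis l u" by blast
  then show thesis using that Du u4 orth by blast
qed

lemma diagonal_form:
  assumes d: "dual_basis l u" and off: "\<And>i j. i \<noteq> j \<Longrightarrow> linform (u i) (A *v u j) = 0"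
  shows "A = (\<Sum>i\<in>UNIV. smat (linform (u i) (A *v u i)) (outer (l i)))"
proof (rule matrix_eq_on_basis[OF d])
  fix i j
  have "linform (u i) ((\<Sum>i\<in>UNIV. smat (linform (u i) (A *v u i)) (outer (l i))) *v u j)
      = linform (u i) (A *v u i) * linform (l i) (u j)"
    by (simp add: sum_outer_mult_dual[OF d])
  then show "linform (u i) (A *v u j)
      = linform (u i) ((\<Sum>i\<in>UNIV. smat (linform (u i) (A *v u i)) (outer (l i))) *v u j)"
    using d off[of i j] by (auto simp: dual_basis_def)
qed

text \<open>Each of the three differences lacks one of the squares, and they sum to zero; hence
  removing from each matrix its own square leaves the same matrix \<open>B\<close>.\<close>

lemma common_summand:
  assumes sym: "transpose Q1 = Q1" "transpose Q2 = Q2" "transpose Q3 = Q3"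
    and v: "v \<noteq> 0" "(Q1 - Q2) *v v = 0" "(Q2 - Q3) *v v = 0"
    and r: "rank (Q1 - Q2) = 2" "rank (Q2 - Q3) = 2" "rank (Q3 - Q1) = 2"
    and r3: "rank ((Q2 - Q3) + smat s (Q3 - Q1)) \<ge> 3"
  obtains B l w where "transpose B = B" "dual_basis l w"
    "Q1 = B + outer (l 1)" "Q2 = B + outer (l 2)" "Q3 = B + outer (l 3)"
proof -
  \<comment> \<open>Cyclic numbering: \<open>D i\<close> omits the \<open>i\<close>-th matrix, and
    the square of \<open>l i\<close> is the one that it will lack. The index type is that of the
    dual basis, whose fourth vector is the vertex; the value at 4 repeats
    \<open>D 3\<close>.\<close>
  define D where "D i = (if i = 1 then Q2 - Q3 else if i = 2 then Q3 - Q1 else Q1 - Q2)" for i :: 4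
  have D: "D 1 = Q2 - Q3" "D 2 = Q3 - Q1" "D 3 = Q1 - Q2" by (simp_all add: D_def)
  have "(Q3 - Q1) *v v = - ((Q1 - Q2) *v v) - (Q2 - Q3) *v v"
    by (simp add: matrix_vector_mult_diff_rdistrib)
  then have v3: "(Q3 - Q1) *v v = 0" using v by simp
  obtain l u where lu: "dual_basis l u" and Du: "\<And>i. i \<noteq> 4 \<Longrightarrow> D i *v u i = 0" and u4: "u 4 = v"
    and off: "\<And>i j k. k \<noteq> 4 \<Longrightarrow> i \<noteq> j \<Longrightarrow> linform (u i) (D k *v u j) = 0"
  proof (rule pencil_diagonalizable[of D v s])
    show "transpose (D i) = D i" for i by (simp add: D_def transpose_diff sym)
    show "D 1 + D 2 + D 3 = 0" by (simp add: D)
    show "D i *v v = 0" for i using v v3 by (simp add: D_def)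
    show "rank (D i) \<le> 2" for i using r by (simp add: D_def)
    show "3 \<le> rank (D 1 + smat s (D 2))" using r3 by (simp add: D)
  qed (use v in auto)
  define g where "g k i = linform (u i) (D k *v u i)" for k i
  have g0: "g k k = 0" "g k 4 = 0" if "k \<noteq> 4" for k
  proof -
    show "g k k = 0" using Du[OF that] by (simp add: g_def)
    have "D k *v v = 0" using v v3 by (simp add: D_def)
    then show "g k 4 = 0" by (simp add: g_def u4)
  qed
  have Dg: "D k = (\<Sum>i\<in>UNIV. smat (g k i) (outer (l i)))" if "k \<noteq> 4" for k
    unfolding g_def by (rule diagonal_form[OF lu off[OF that]])
  have D1: "Q2 - Q3 = smat (g 1 2) (outer (l 2)) + smat (g 1 3) (outer (l 3))"
    using Dg[of 1] g0[of 1] by (simp add: D sum_4)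
  have D3: "Q1 - Q2 = smat (g 3 1) (outer (l 1)) + smat (g 3 2) (outer (l 2))"
    using Dg[of 3] g0[of 3] by (simp add: D sum_4)
  have one: "rank (smat a (outer x)) \<le> 1" for a x using rank_add_outer[of 0 a x] by simp
  have nz: "g 1 2 \<noteq> 0" "g 1 3 \<noteq> 0" "g 3 1 \<noteq> 0" "g 3 2 \<noteq> 0"
    using r(1,2) one[of "g 1 3" "l 3"] one[of "g 1 2" "l 2"] one[of "g 3 1" "l 1"] one[of "g 3 2" "l 2"]
    unfolding D1 D3 by auto
  have "g 1 2 + g 2 2 + g 3 2 = linform (u 2) ((D 1 + D 2 + D 3) *v u 2)"
    by (simp add: g_def matrix_vector_mult_add_rdistrib linform_add)
  also have "\<dots> = 0" by (simp add: D)
  \<comment> \<open>\<open>D 2\<close> contains no square of \<open>l 2\<close>, so the coefficients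
    of this square in \<open>D 1\<close> and \<open>D 3\<close> cancel.\<close>
  finally have g12: "g 1 2 = - g 3 2" using g0(1)[of 2] by (simp add: eq_neg_iff_add_eq_0)
  \<comment> \<open>From \<open>Q1 - Q2 = D 3\<close> and \<open>Q2 - Q3 = D 1\<close> the three
    matrices are \<open>B\<close> plus \<open>g 3 1\<close>, \<open>- g 3 2\<close> and
    \<open>- g 1 3\<close> times their squares. The value 1 at index 4 leaves the fourth form of the
    basis unchanged.\<close>
  define c where "c i = (if i = 1 then csqrt (g 3 1) else if i = 2 then csqrt (- g 3 2)
     else if i = 3 then csqrt (- g 1 3) else 1)" for i :: 4
  have c: "c i \<noteq> 0" for i using nz by (simp add: c_def)
  define B where "B = Q1 - smat (g 3 1) (outer (l 1))"
  have oc: "outer (c i *s l i) = smat ((c i)\<^sup>2) (outer (l i))" for i by (rule outer_scale)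
  show thesis
  proof (rule that[of B "\<lambda>i. c i *s l i" "\<lambda>i. inverse (c i) *s u i"])
    show "transpose B = B" by (simp add: B_def transpose_diff transpose_smat sym)
    show "dual_basis (\<lambda>i. c i *s l i) (\<lambda>i. inverse (c i) *s u i)"
      using lu c by (auto simp: dual_basis_def linform_scale linform_scale_left)
    show Q1: "Q1 = B + outer (c 1 *s l 1)" unfolding oc by (simp add: c_def B_def)
    have "Q2 = Q1 - (Q1 - Q2)" by simp
    also have "\<dots> = B + outer (c 2 *s l 2)" unfolding D3 oc by (simp add: c_def B_def smat.scale_minus_left)
    finally show Q2: "Q2 = B + outer (c 2 *s l 2)" .
    have "Q3 = Q2 - (smat (g 1 2) (outer (l 2)) + smat (g 1 3) (outer (l 3)))" unfolding D1[symmetric] by simp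
    also have "\<dots> = B + outer (c 3 *s l 3)" unfolding Q2 oc by (simp add: c_def g12 smat.scale_minus_left)
    finally show "Q3 = B + outer (c 3 *s l 3)" .
  qed
qed

text \<open>Otherwise every member with \<open>s\<close> different from 0 and 1 has rank at most
  one. Its 2 by 2 minors vanish for almost all \<open>s\<close>, hence also at \<open>s = 0\<close>,
  against the rank of \<open>P\<close>. The excluded values are those at which the pencil of
  differences is known to have members of rank two.\<close>

lemma exists_rank_3_member:
  fixes P Q :: "complex^4^4"
  assumes P: "rank P \<ge> 2" and ne: "\<And>s. s \<noteq> 0 \<Longrightarrow> s \<noteq> 1 \<Longrightarrow> rank (P + smat s Q) \<noteq> 2"
  shows "\<exists>s. rank (P + smat s Q) \<ge> 3"
proof (rule ccontr)
  assume "\<not> ?thesis"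
  then have le: "rank (P + smat s Q) \<le> 1" if "s \<noteq> 0" "s \<noteq> 1" for s
    using ne[OF that] by (metis One_nat_def Suc_leI le_less_linear less_2_cases_iff not_less_eq_eq numeral_2_eq_2 numeral_3_eq_3 le_antisym)
  have "P $ i $ j * P $ k $ m = P $ i $ m * P $ k $ j" for i j k m
  proof -
    define f where "f s = (P $ i $ j + s * Q $ i $ j) * (P $ k $ m + s * Q $ k $ m)
        - (P $ i $ m + s * Q $ i $ m) * (P $ k $ j + s * Q $ k $ j)" for s
    have "polynomial_map f" unfolding f_def
      by (intro polynomial_map_diff polynomial_map_mult polynomial_map_add polynomial_map_const polynomial_map_id)
    moreover have "f s = 0" if "s \<noteq> 0" "s \<noteq> 1" for s
      using rank_le_1_minors[OF le[OF that], of i j k m] by (simp add: f_def)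
    then have "{s. f s \<noteq> 0} \<subseteq> {0, 1}" by auto
    then have "finite {s. f s \<noteq> 0}" by (rule finite_subset) simp
    ultimately have "f 0 = 0" by (rule polynomial_map_eq_0)
    then show ?thesis by (simp add: f_def)
  qed
  then have "rank P \<le> 1" by (rule rank_le_1_if_minors)
  then show False using P by simp
qed

section \<open>From incidence of quadrics to matrices\<close>

lemma subspace_le_if_quadrics:
  assumes V: "smat.subspace V" "V \<subseteq> {A. transpose A = A}" and W: "smat.subspace W"
    and sub: "\<And>q. rep_quadric q \<in> V \<Longrightarrow> rep_quadric q \<in> W"
  shows "V \<subseteq> W"
proof
  fix A assume A: "A \<in> V"
  show "A \<in> W"
  proof (cases "A = 0")
    case True then show ?thesis using smat.subspace_0[OF W] by simp
  next
    case False
    have "transpose A = A" using A V(2) by blast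
    then obtain q where q: "represents A q" using represents_exists False by blast
    then show ?thesis
      using sub represents_mem_subspace[OF V(1) q] represents_mem_subspace[OF W q] A by blast
  qed
qed

lemma coefficient_zero_if_dim_3:
  assumes V: "V \<subseteq> smat.span {A, B, C}" "smat.dim V = 3"
    and 0: "smat a A + smat b B + smat c C = 0"
  shows "a = 0"
proof (rule ccontr)
  assume a: "a \<noteq> 0"
  have "smat a A = smat (- b) B + smat (- c) C"
    using 0 by (simp add: smat.scale_minus_left eq_neg_iff_add_eq_0 algebra_simps)
  then have "smat (inverse a) (smat a A) = smat (inverse a) (smat (- b) B + smat (- c) C)" by simp
  then have "A = smat (- b / a) B + smat (- c / a) C"
    using a by (simp add: smat.scale_right_distrib smat.scale_right_diff_distrib divide_inverse mult.commute)
  then have "A \<in> smat.span {B, C}" unfolding span_2 by blast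
  then have "smat.span {A, B, C} = smat.span {B, C}" by (rule smat.span_redundant)
  then have "smat.dim V \<le> card {B, C}" using V(1) by (intro smat.dim_le_card) auto
  also have "\<dots> \<le> 2" by (simp add: card_insert_if)
  finally show False using V(2) by simp
qed

lemma basis_of_dim_2:
  assumes V: "smat.dim V = 2"
  obtains A B where "A \<in> V" "B \<in> V" "\<And>x y. smat x A + smat y B = 0 \<Longrightarrow> x = 0 \<and> y = 0"
proof -
  obtain S where S: "S \<subseteq> V" "smat.independent S" "card S = 2"
    using smat.basis_exists[of V] V by metis
  then obtain A B where AB: "S = {A, B}" "A \<noteq> B" by (meson card_2_iff)
  have B0: "B \<noteq> 0" using S(2) AB smat.dependent_zero by blast
  have A: "A \<notin> smat.span {B}" using S(2) AB by (simp add: smat.independent_insert)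
  have "x = 0 \<and> y = 0" if 0: "smat x A + smat y B = 0" for x y
  proof -
    have "x = 0"
    proof (rule ccontr)
      assume x: "x \<noteq> 0"
      have "smat x A = smat (- y) B" using 0 by (simp add: smat.scale_minus_left eq_neg_iff_add_eq_0)
      then have "smat (inverse x) (smat x A) = smat (inverse x) (smat (- y) B)" by (rule arg_cong)
      then have "A = smat (inverse x * (- y)) B" using x by simp
      then have "A \<in> smat.span {B}" unfolding smat.span_singleton by (rule range_eqI)
      then show False using A by simp
    qed
    then show ?thesis using 0 B0 by simp
  qed
  then show thesis using that[of A B] S(1) AB(1) by simp
qed

text \<open>A plane with a line in it: after rescaling, the differences of the three points lie on the
  line. The scaling factors are the coefficients of the linear equation of the line.\<close>

lemma rescale_to_differences:
  assumes V: "smat.subspace V" "smat.dim V = 2" "V \<subseteq> smat.span {N1, N2, N3}"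
    and notin: "N1 \<notin> V" "N2 \<notin> V" "N3 \<notin> V"
  obtains x1 x2 x3 where "x1 \<noteq> 0" "x2 \<noteq> 0" "x3 \<noteq> 0"
    "smat x1 N1 - smat x2 N2 \<in> V" "smat x2 N2 - smat x3 N3 \<in> V" "smat x3 N3 - smat x1 N1 \<in> V"
proof -
  obtain A B where AB: "A \<in> V" "B \<in> V" and ind: "\<And>x y. smat x A + smat y B = 0 \<Longrightarrow> x = 0 \<and> y = 0"
    using basis_of_dim_2[OF V(2)] by blast
  obtain a1 a2 a3 where A: "A = smat a1 N1 + smat a2 N2 + smat a3 N3" using AB V(3) span_3 by blast
  obtain b1 b2 b3 where B: "B = smat b1 N1 + smat b2 N2 + smat b3 N3" using AB V(3) span_3 by blast
  \<comment> \<open>The cross product of the coefficient vectors of \<open>A\<close> and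
    \<open>B\<close> gives the equation of the line in coordinates with respect to
    \<open>N1, N2, N3\<close>. Scaling the \<open>i\<close>-th matrix by \<open>1 / c_i\<close>
    turns the equation into the vanishing of the coordinate sum.\<close>
  define c1 where "c1 = a2 * b3 - a3 * b2"
  define c2 where "c2 = a3 * b1 - a1 * b3"
  define c3 where "c3 = a1 * b2 - a2 * b1"
  note c = c1_def c2_def c3_def
  have comb: "smat x A + smat y B \<in> V" for x y
    by (intro smat.subspace_add[OF V(1)] smat.subspace_scale[OF V(1)] AB)
  have m12: "smat c2 N1 - smat c1 N2 \<in> V"
  proof -
    have "smat c2 N1 - smat c1 N2 = smat (- b3) A + smat a3 B"
      unfolding A B c by (simp add: vec_eq_iff algebra_simps)
    then show ?thesis using comb by (simp only:)
  qed
  have m23: "smat c3 N2 - smat c2 N3 \<in> V"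
  proof -
    have "smat c3 N2 - smat c2 N3 = smat (- b1) A + smat a1 B"
      unfolding A B c by (simp add: vec_eq_iff algebra_simps)
    then show ?thesis using comb by (simp only:)
  qed
  have m31: "smat c1 N3 - smat c3 N1 \<in> V"
  proof -
    have "smat c1 N3 - smat c3 N1 = smat (- b2) A + smat a2 B"
      unfolding A B c by (simp add: vec_eq_iff algebra_simps)
    then show ?thesis using comb by (simp only:)
  qed
  have zero: "x = 0" if "smat x N \<in> V" "N \<notin> V" for x N
  proof (rule ccontr)
    assume "x \<noteq> 0"
    then have "N = smat (inverse x) (smat x N)" by simp
    then show False using that smat.subspace_scale[OF V(1)] by metis
  qed
  have neg: "smat x N \<in> V" if "- smat x N \<in> V" for x N
    using smat.subspace_neg[OF V(1) that] by simp
  have nz: "\<not> (c1 = 0 \<and> c2 = 0 \<and> c3 = 0)"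
  proof
    assume c0: "c1 = 0 \<and> c2 = 0 \<and> c3 = 0"
    have "smat b1 A + smat (- a1) B = 0" "smat b2 A + smat (- a2) B = 0" "smat b3 A + smat (- a3) B = 0"
      using c0 unfolding A B c by (simp_all add: vec_eq_iff algebra_simps)
    then have "a1 = 0" "a2 = 0" "a3 = 0" using ind by fastforce+
    then have "A = 0" by (simp add: A)
    then show False using ind[of 1 0] by simp
  qed
  \<comment> \<open>If one \<open>c_i\<close> is zero, two of the three memberships reduce to
    multiples of the \<open>i\<close>-th matrix, which is outside \<open>V\<close>. So the other two
    coefficients vanish as well, against \<open>nz\<close>.\<close>
  have c: "c1 \<noteq> 0" "c2 \<noteq> 0" "c3 \<noteq> 0"
  proof -
    show "c1 \<noteq> 0"
    proof
      assume "c1 = 0"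
      then have "c2 = 0" "c3 = 0" using m12 m31 zero[OF _ notin(1)] neg by auto
      then show False using nz \<open>c1 = 0\<close> by simp
    qed
    show "c2 \<noteq> 0"
    proof
      assume "c2 = 0"
      then have "c1 = 0" "c3 = 0" using m12 m23 zero[OF _ notin(2)] neg by auto
      then show False using nz \<open>c2 = 0\<close> by simp
    qed
    show "c3 \<noteq> 0"
    proof
      assume "c3 = 0"
      then have "c1 = 0" "c2 = 0" using m31 m23 zero[OF _ notin(3)] neg by auto
      then show False using nz \<open>c3 = 0\<close> by simp
    qed
  qed
  show thesis
  proof (rule that[of "1 / c1" "1 / c2" "1 / c3"])
    have "smat (1 / c1) N1 - smat (1 / c2) N2 = smat (1 / (c1 * c2)) (smat c2 N1 - smat c1 N2)"
      using c by (simp add: smat.scale_right_diff_distrib)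
    then show "smat (1 / c1) N1 - smat (1 / c2) N2 \<in> V" using m12 smat.subspace_scale[OF V(1)] by simp
    have "smat (1 / c2) N2 - smat (1 / c3) N3 = smat (1 / (c2 * c3)) (smat c3 N2 - smat c2 N3)"
      using c by (simp add: smat.scale_right_diff_distrib)
    then show "smat (1 / c2) N2 - smat (1 / c3) N3 \<in> V" using m23 smat.subspace_scale[OF V(1)] by simp
    have "smat (1 / c3) N3 - smat (1 / c1) N1 = smat (1 / (c1 * c3)) (smat c1 N3 - smat c3 N1)"
      using c by (simp add: smat.scale_right_diff_distrib)
    then show "smat (1 / c3) N3 - smat (1 / c1) N1 \<in> V" using m31 smat.subspace_scale[OF V(1)] by simp
  qed (use c in auto)
qed

text \<open>After rescaling, the three differences lie both on the pencil and on the lines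
  \<open>[q_i, q_j]\<close>, so the property gives them rank exactly two. These are the singular
  members that the diagonalization needs.\<close>

lemma property_triples_decomposition:
  assumes t: "t \<in> property_triples"
  obtains B l w where "transpose B = B" "dual_basis l w"
    "represents (B + outer (l 1)) (t $ 1)" "represents (B + outer (l 2)) (t $ 2)"
    "represents (B + outer (l 3)) (t $ 3)"
proof -
  define N1 where "N1 = rep_quadric (t $ 1)"
  define N2 where "N2 = rep_quadric (t $ 2)"
  define N3 where "N3 = rep_quadric (t $ 3)"
  note N = N1_def N2_def N3_def
  have dist: "distinct [t $ 1, t $ 2, t $ 3]" and r: "\<And>i. qrank (t $ i) \<ge> 3" and tp: "triple_property t"
    using t by (auto simp: property_triples_def)
  then have ne: "t $ 1 \<noteq> t $ 2" "t $ 1 \<noteq> t $ 3" "t $ 2 \<noteq> t $ 3" by auto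
  have M: "represents N1 (t $ 1)" "represents N2 (t $ 2)" "represents N3 (t $ 3)" by (simp_all add: N)
  have span: "proj_span {t $ 1, t $ 2, t $ 3} = {q. rep_quadric q \<in> smat.span {N1, N2, N3}}"
    by (rule proj_span_3(2)[OF M dist])
  obtain V' where V': "smat.subspace V'" "V' \<subseteq> {A. transpose A = A}" "smat.dim V' = 3"
    "proj_span {t $ 1, t $ 2, t $ 3} = {q. rep_quadric q \<in> V'}"
    using tp unfolding triple_property_def proj_subspace_def by auto
  have sub': "V' \<subseteq> smat.span {N1, N2, N3}"
    by (rule subspace_le_if_quadrics[OF V'(1,2) smat.subspace_span]) (use V'(4) span in auto)
  have ind: "a = 0 \<and> b = 0 \<and> c = 0" if 0: "smat a N1 + smat b N2 + smat c N3 = 0" for a b c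
  proof -
    have "a = 0" by (rule coefficient_zero_if_dim_3[OF sub' V'(3) 0])
    moreover have "b = 0"
      by (rule coefficient_zero_if_dim_3[of V' N2 N1 N3 b a c])
        (use sub' V'(3) 0 in \<open>simp_all add: insert_commute add_ac\<close>)
    moreover have "c = 0"
      by (rule coefficient_zero_if_dim_3[of V' N3 N1 N2 c a b])
        (use sub' V'(3) 0 in \<open>simp_all add: insert_commute add_ac\<close>)
    ultimately show ?thesis by simp
  qed
  obtain L v where L: "is_pencil L" "L \<subseteq> proj_span {t $ 1, t $ 2, t $ 3}" "\<forall>q\<in>L. is_cone q"
    and v: "v \<noteq> 0" "\<forall>q\<in>L. v \<in> vertex q"
    and L2: "{q \<in> L. qrank q = 2} =
       L \<inter> (proj_span {t $ 1, t $ 2} \<union> proj_span {t $ 1, t $ 3} \<union> proj_span {t $ 2, t $ 3})"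
    using tp unfolding triple_property_def by blast
  obtain V where V: "smat.subspace V" "V \<subseteq> {A. transpose A = A}" "smat.dim V = 2"
    and LV: "L = {q. rep_quadric q \<in> V}"
    using L(1) unfolding proj_subspace_def by auto
  have VN: "V \<subseteq> smat.span {N1, N2, N3}"
    by (rule subspace_le_if_quadrics[OF V(1,2) smat.subspace_span]) (use L(2) LV span in auto)
  define E where "E A \<longleftrightarrow> A \<in> smat.span {N1, N2} \<union> smat.span {N1, N3} \<union> smat.span {N2, N3}" for A
  have V_quadric: "A *v v = 0 \<and> rank A \<le> 3 \<and> (rank A = 2 \<longleftrightarrow> E A)" if A: "A \<in> V" "A \<noteq> 0" for A
  proof -
    have "transpose A = A" using A V(2) by blast
    then obtain q where q: "represents A q" using represents_exists A(2) by blast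
    then obtain c where c: "c \<noteq> 0" "A = smat c (rep_quadric q)" by (auto simp: represents_def)
    have qL: "q \<in> L" using represents_mem_subspace[OF V(1) q] A LV by simp
    then have "rep_quadric q *v v = 0" using v by (simp add: vertex_def)
    then have "A *v v = 0" by (simp add: c smat_mult_vec)
    moreover have "rank A \<le> 3" using qL L(3) represents_qrank[OF q] by (simp add: is_cone_def)
    moreover have "rank A = 2 \<longleftrightarrow> E A"
    proof -
      have e: "q \<in> proj_span {t $ i, t $ j} \<longleftrightarrow> A \<in> smat.span {rep_quadric (t $ i), rep_quadric (t $ j)}" for i j
        using represents_mem_subspace[OF smat.subspace_span q] by (simp add: proj_span_def)
      have "rank A = 2 \<longleftrightarrow> q \<in> {q \<in> L. qrank q = 2}" using qL represents_qrank[OF q] by simp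
      also have "\<dots> \<longleftrightarrow> E A" unfolding L2 using qL by (simp add: E_def e N)
      finally show ?thesis .
    qed
    ultimately show ?thesis by blast
  qed
  \<comment> \<open>If \<open>q_i\<close> were on the pencil, it would be a point of the pencil on a
    line \<open>[q_i, q_j]\<close> and thus of rank two.\<close>
  have notV: "Nx \<notin> V" if "Nx \<in> {N1, N2, N3}" for Nx
  proof
    assume "Nx \<in> V"
    moreover have "Nx \<noteq> 0" "rank Nx \<ge> 3" using that r by (auto simp: N qrank_def)
    moreover have "E Nx" using that by (auto simp: E_def smat.span_base)
    ultimately show False using V_quadric by fastforce
  qed
  obtain x1 x2 x3 where x: "x1 \<noteq> 0" "x2 \<noteq> 0" "x3 \<noteq> 0"
    and xV: "smat x1 N1 - smat x2 N2 \<in> V" "smat x2 N2 - smat x3 N3 \<in> V" "smat x3 N3 - smat x1 N1 \<in> V"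
    using rescale_to_differences[OF V(1,3) VN notV notV notV] by blast
  define Q1 where "Q1 = smat x1 N1"
  define Q2 where "Q2 = smat x2 N2"
  define Q3 where "Q3 = smat x3 N3"
  note Q = Q1_def Q2_def Q3_def
  have repQ: "represents Q1 (t $ 1)" "represents Q2 (t $ 2)" "represents Q3 (t $ 3)"
    using M x by (simp_all add: Q represents_smat)
  have E_diff: "E (smat a N1 - smat b N2)" "E (smat a N2 - smat b N3)" "E (smat a N3 - smat b N1)" for a b
    unfolding E_def by (simp_all add: smat.span_diff smat.span_scale smat.span_base)
  have Qne: "Q1 - Q2 \<noteq> 0" "Q2 - Q3 \<noteq> 0" "Q3 - Q1 \<noteq> 0"
    using repQ represents_unique ne by (metis right_minus_eq)+
  have rQ: "rank (Q1 - Q2) = 2" "rank (Q2 - Q3) = 2" "rank (Q3 - Q1) = 2"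
    using V_quadric xV Qne E_diff by (simp_all add: Q)
  have vQ: "(Q1 - Q2) *v v = 0" "(Q2 - Q3) *v v = 0"
    using V_quadric xV Qne by (simp_all add: Q)
  have "\<exists>s. rank ((Q2 - Q3) + smat s (Q3 - Q1)) \<ge> 3"
  proof (rule exists_rank_3_member)
    fix s :: complex assume s: "s \<noteq> 0" "s \<noteq> 1"
    define P where "P = (Q2 - Q3) + smat s (Q3 - Q1)"
    \<comment> \<open>For \<open>s\<close> different from 0 and 1 all three coefficients are
      nonzero, so this member is on none of the three lines and the property excludes rank
      two.\<close>
    have P: "P = smat (- s * x1) N1 + smat x2 N2 + smat ((s - 1) * x3) N3"
      by (simp add: P_def Q vec_eq_iff algebra_simps)
    have "P \<in> V" unfolding P_def Q
      by (intro smat.subspace_add[OF V(1)] smat.subspace_scale[OF V(1)] xV)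
    moreover have neq: "P \<noteq> smat a N1 + smat b N2 + smat c N3" if "a = 0 \<or> b = 0 \<or> c = 0" for a b c
    proof
      assume "P = smat a N1 + smat b N2 + smat c N3"
      then have "smat (- s * x1 - a) N1 + smat (x2 - b) N2 + smat ((s - 1) * x3 - c) N3 = 0"
        unfolding P by (simp add: vec_eq_iff algebra_simps)
      then show False using ind s x that by fastforce
    qed
    then have "P \<noteq> 0" using neq[of 0 0 0] by simp
    moreover have "\<not> E P"
      using neq[of 0] neq[of _ 0] neq[of _ _ 0] by (auto simp: E_def span_2)
    ultimately show "rank ((Q2 - Q3) + smat s (Q3 - Q1)) \<noteq> 2" using V_quadric P_def by blast
  qed (simp add: rQ)
  then obtain s where s: "rank ((Q2 - Q3) + smat s (Q3 - Q1)) \<ge> 3" ..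
  have sym: "transpose Q1 = Q1" "transpose Q2 = Q2" "transpose Q3 = Q3"
    using repQ represents_symmetric by blast+
  obtain B l w where "transpose B = B" "dual_basis l w"
    "Q1 = B + outer (l 1)" "Q2 = B + outer (l 2)" "Q3 = B + outer (l 3)"
    by (rule common_summand[OF sym v(1) vQ rQ s])
  then show thesis using that[of B l w] repQ by simp
qed

section \<open>Generic triples with the property\<close>

lemma transpose_mat_1: "transpose (mat 1) = mat 1"
  by (simp add: transpose_def mat_def vec_eq_iff)

lemma finite_rank_less_3:
  fixes M :: "complex \<Rightarrow> complex^4^4"
  assumes M: "\<And>i j. polynomial_map (\<lambda>t. M t $ i $ j)"
    and sym: "transpose (M s) = M s" and r: "rank (M s) \<ge> 3"
  shows "finite {t. rank (M t) < 3}"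
proof -
  obtain u where u: "det (M s + outer u) \<noteq> 0" using r rank_ge_3_iff[OF sym] by blast
  have "polynomial_map (\<lambda>t. det (M t + outer u))"
    by (rule polynomial_map_det) (simp add: M polynomial_map_add polynomial_map_const)
  then have "finite {t. det (M t + outer u) = 0}" using polynomial_map_cofinite u by blast
  moreover have "{t. rank (M t) < 3} \<subseteq> {t. det (M t + outer u) = 0}"
    using rank_ge_3_if_det[of _ 1 u] by fastforce
  ultimately show ?thesis by (rule rev_finite_subset)
qed

lemma multihomogeneous_det: "(\<lambda>A. det (A $ k)) \<in> multihomogeneous"
proof -
  have "multidegree (\<lambda>A. det (A $ k)) (\<lambda>k'. \<Sum>i\<in>(UNIV :: 4 set). if k' = k then 1 else 0)"
    unfolding det_def
    by (intro multidegree_sum multidegree_cmult multidegree_prod multidegree_coordinate) simp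
  then show ?thesis by (rule multidegree_multihomogeneous)
qed

text \<open>The open set is nondegeneracy of \<open>q_1\<close>: removing one square from a matrix
  of rank four leaves rank at least three, so \<open>B\<close> is admissible as a basket. For
  density the forms are kept and only \<open>B\<close> is moved.\<close>

theorem generic_property_triple_has_basket:
  "generically (subtopology zariski property_triples) (\<lambda>t. \<exists>b. common_basket b [t $ 1, t $ 2, t $ 3])"
proof (rule generically_if_curves[OF multihomogeneous_det[of 1]])
  fix t assume t: "t \<in> property_triples" and v: "value_at (\<lambda>A. det (A $ 1)) t \<noteq> 0"
  obtain B l w where B: "transpose B = B" and d: "dual_basis l w"
    and rep: "represents (B + outer (l 1)) (t $ 1)" "represents (B + outer (l 2)) (t $ 2)"
      "represents (B + outer (l 3)) (t $ 3)"
    by (rule property_triples_decomposition[OF t])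
  have r: "qrank (t $ i) \<ge> 3" and dist: "distinct [t $ 1, t $ 2, t $ 3]" for i
    using t by (auto simp: property_triples_def)
  have "rank (rep_quadric (t $ 1)) = 4" using v by (simp add: value_at_def rank_eq_4_iff)
  then have "rank (B + outer (l 1)) = 4" using represents_qrank[OF rep(1)] by (simp add: qrank_def)
  then have rB: "rank B \<ge> 3" using rank_add_outer[of B 1 "l 1"] by simp
  then have "B \<noteq> 0" by auto
  then obtain b where b: "represents B b" using represents_exists B by blast
  have rb: "qrank b \<ge> 3" using represents_qrank[OF b] rB by simp
  have l0: "l i \<noteq> 0" for i
  proof
    assume "l i = 0"
    then have "linform (l i) (w i) = 0" by simp
    moreover have "linform (l i) (w i) = 1" using d by (simp add: dual_basis_def)
    ultimately show False by simp
  qed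
  have ne: "b \<noteq> q" if q: "represents (B + outer (l i)) q" for i q
  proof
    assume "b = q"
    then obtain c where c: "c \<noteq> 0" "B + outer (l i) = smat c B"
      using represents_proportional[OF b, of "B + outer (l i)"] q by auto
    \<comment> \<open>If \<open>b\<close> and \<open>q\<close> coincide, the square of
      \<open>l i\<close> is a multiple of \<open>B\<close>, hence zero or of rank at least three; it
      is neither.\<close>
    have "smat (c - 1) B = outer (l i)" using c by (simp add: smat.scale_left_diff_distrib algebra_simps)
    moreover have "rank (outer (l i)) \<le> 1" using rank_add_outer[of 0 1 "l i"] by simp
    moreover have "outer (l i) \<noteq> 0" using l0[of i] by (auto simp: vec_eq_iff)
    ultimately show False using rank_smat[of "c - 1" B] rB by (cases "c = 1") auto
  qed
  have "basket b (t $ 1)" "basket b (t $ 2)" "basket b (t $ 3)"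
    using basket_iff_outer[OF b] ne rep rb r by blast+
  then show "\<exists>b. common_basket b [t $ 1, t $ 2, t $ 3]"
    using dist ne[OF rep(1)] ne[OF rep(2)] ne[OF rep(3)] rb r by (auto simp: common_basket_def)
next
  fix t assume t: "t \<in> property_triples"
  obtain B l w where B: "transpose B = B" and d: "dual_basis l w"
    and rep: "represents (B + outer (l 1)) (t $ 1)" "represents (B + outer (l 2)) (t $ 2)"
      "represents (B + outer (l 3)) (t $ 3)"
    by (rule property_triples_decomposition[OF t])
  have r: "qrank (t $ i) \<ge> 3" for i using t by (auto simp: property_triples_def)
  \<comment> \<open>At \<open>s = 1\<close> the first matrix of the triple is the identity. As the
    forms stay independent, almost every point of this line has the property again.\<close>
  define C where "C s = B + smat s (mat 1 - outer (l 1) - B)" for s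
  define m where "m k = (if k = (1::3) then l 1 else if k = 2 then l 2 else l 3)" for k
  define \<gamma> where "\<gamma> s = (\<chi> k. C s + outer (m k))" for s
  have m: "m 1 = l 1" "m 2 = l 2" "m 3 = l 3" by (simp_all add: m_def)
  have C: "polynomial_map (\<lambda>s. (C s + outer x) $ i $ j)" for x i j
    by (simp add: C_def polynomial_map_add polynomial_map_const polynomial_map_mult polynomial_map_id)
  have symC: "transpose (C s) = C s" for s
    by (simp add: C_def transpose_add transpose_diff transpose_smat B transpose_mat_1)
  have rep0: "represents (\<gamma> 0 $ k) (t $ k)" for k
    using rep exhaust_3[of k] by (auto simp: \<gamma>_def C_def m_def)
  have det1: "det (\<gamma> 1 $ 1) \<noteq> 0" by (simp add: \<gamma>_def C_def m_def)
  have pm: "polynomial_map (\<lambda>s. \<gamma> s $ k $ i $ j)" for k i j unfolding \<gamma>_def using C by simp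
  have sym\<gamma>: "transpose (\<gamma> s $ k) = \<gamma> s $ k" for s k by (simp add: \<gamma>_def transpose_add symC)
  have "finite {s. rank (\<gamma> s $ k) < 3}" for k
    by (rule finite_rank_less_3[OF pm, of 0])
      (use sym\<gamma> represents_qrank[OF rep0] r in auto)
  moreover have "finite {s. det (\<gamma> s $ 1) = 0}"
    by (rule polynomial_map_cofinite[OF polynomial_map_det[OF pm] det1])
  ultimately have fin: "finite ((\<Union>k. {s. rank (\<gamma> s $ k) < 3}) \<union> {s. det (\<gamma> s $ 1) = 0})" by simp
  have ex: "\<exists>t'\<in>property_triples. represents_tuple (\<gamma> s) t'"
    if s: "\<And>k. rank (\<gamma> s $ k) \<ge> 3" "det (\<gamma> s $ 1) \<noteq> 0" for s
  proof -
    have "\<gamma> s $ k \<noteq> 0" for k using s(1)[of k] by auto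
    then have "\<forall>k. \<exists>q. represents (\<gamma> s $ k) q" using represents_exists sym\<gamma> by blast
    then obtain f where f: "\<And>k. represents (\<gamma> s $ k) (f k)" by metis
    define t' where "t' = (\<chi> k. f k)"
    have rt: "represents (C s + outer (m k)) (t' $ k)" for k using f[of k] by (simp add: t'_def \<gamma>_def)
    have "t' \<in> property_triples"
      by (rule property_triples_if_decomposition[OF d symC])
        (use rt[of 1] rt[of 2] rt[of 3] s f represents_qrank[OF f] in \<open>auto simp: m \<gamma>_def t'_def\<close>)
    moreover have "represents_tuple (\<gamma> s) t'" using f by (simp add: represents_tuple_def t'_def)
    ultimately show ?thesis by blast
  qed
  have "{s. \<not> (\<exists>t'\<in>property_triples. represents_tuple (\<gamma> s) t')}
      \<subseteq> (\<Union>k. {s. rank (\<gamma> s $ k) < 3}) \<union> {s. det (\<gamma> s $ 1) = 0}"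
  proof
    fix s assume s: "s \<in> {s. \<not> (\<exists>t'\<in>property_triples. represents_tuple (\<gamma> s) t')}"
    show "s \<in> (\<Union>k. {s. rank (\<gamma> s $ k) < 3}) \<union> {s. det (\<gamma> s $ 1) = 0}"
    proof (rule ccontr)
      assume "\<not> ?thesis"
      then have "rank (\<gamma> s $ k) \<ge> 3" "det (\<gamma> s $ 1) \<noteq> 0" for k by (auto simp: not_less)
      then show False using ex s by blast
    qed
  qed
  then have "curve_in property_triples \<gamma>"
    unfolding curve_in_def polynomial_curve_def using pm finite_subset[OF _ fin] by blast
  moreover have "represents_tuple (\<gamma> 0) t" using rep0 by (simp add: represents_tuple_def)
  ultimately show "\<exists>\<gamma> s. curve_in property_triples \<gamma> \<and> represents_tuple (\<gamma> 0) t \<and> det (\<gamma> s $ 1) \<noteq> 0"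
    using det1 by blast
qed

section \<open>Parametrization of the variety of baskets\<close>

text \<open>The unordered pair \<open>{i, j}\<close> indexes the entry of a symmetric matrix. The last quadric is
  the basket; it corresponds to the linear form 0.\<close>

type_synonym param = "4 set + 4 \<times> 4 \<Rightarrow> complex"

definition param_basket :: "param \<Rightarrow> complex^4^4" where
  "param_basket x = (\<chi> i j. x (Inl {i, j}))"

definition param_form :: "param \<Rightarrow> 4 \<Rightarrow> complex^4" where
  "param_form x k = (if k = 4 then 0 else \<chi> j. x (Inr (k, j)))"

definition param_tuple :: "param \<Rightarrow> (complex^4^4)^4" where
  "param_tuple x = (\<chi> k. param_basket x + outer (param_form x k))"

text \<open>Over the same basket, two quadrics coincide only if their forms agree up to sign. Since
  the fourth form is 0, the second condition also says that the other forms are nonzero, which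
  separates their quadrics from the basket.\<close>

definition good_param :: "param \<Rightarrow> bool" where
  "good_param x \<longleftrightarrow> (\<forall>k. rank (param_tuple x $ k) \<ge> 3) \<and>
     (\<forall>i k. i \<noteq> k \<longrightarrow> param_form x i \<noteq> param_form x k \<and> param_form x i \<noteq> - param_form x k)"

definition segment :: "param \<Rightarrow> param \<Rightarrow> complex \<Rightarrow> param" where
  "segment x y t = (\<lambda>j. x j + t * (y j - x j))"

lemma segment_endpoints [simp]: "segment x y 0 = x" "segment x y 1 = y"
  by (simp_all add: segment_def)

lemma outer_0 [simp]: "outer 0 = 0"
  by (simp add: vec_eq_iff)

lemma param_tuple_4: "param_tuple x $ 4 = param_basket x"
  by (simp add: param_tuple_def param_form_def)

lemma transpose_param_basket: "transpose (param_basket x) = param_basket x"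
  by (simp add: param_basket_def transpose_def vec_eq_iff insert_commute)

lemma transpose_param_tuple: "transpose (param_tuple x $ k) = param_tuple x $ k"
  by (simp add: param_tuple_def transpose_add transpose_param_basket)

lemma outer_eq_iff: "outer x = outer y \<longleftrightarrow> x = y \<or> x = - y"
proof
  assume e: "outer x = outer y"
  then have xy: "x $ i * x $ j = y $ i * y $ j" for i j by (metis outer_nth)
  show "x = y \<or> x = - y"
  proof (cases "y = 0")
    case True
    then show ?thesis using xy[of i i for i] by (simp add: vec_eq_iff)
  next
    case False
    then obtain j where j: "y $ j \<noteq> 0" by (auto simp: vec_eq_iff)
    have "x $ j = y $ j \<or> x $ j = - y $ j" using xy[of j j] by (simp add: square_eq_iff)
    then show ?thesis
    proof
      assume "x $ j = y $ j"
      then have "x $ i = y $ i" for i using xy[of i j] j by simp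
      then show ?thesis by (simp add: vec_eq_iff)
    next
      assume a: "x $ j = - y $ j"
      have "x $ i = - y $ i" for i
      proof -
        have "(- x $ i) * y $ j = y $ i * y $ j" using xy[of i j] a by simp
        then have "- x $ i = y $ i" using j by (simp only: mult_right_cancel not_False_eq_True)
        then show ?thesis by (metis minus_minus)
      qed
      then show ?thesis by (simp add: vec_eq_iff)
    qed
  qed
qed (auto simp: vec_eq_iff)

text \<open>A factor other than 1 would express \<open>B\<close> by two squares, of rank at most
  two.\<close>

lemma add_outer_proportional:
  assumes r: "rank B \<ge> 3" and e: "B + outer x = smat c (B + outer y)"
  shows "outer x = outer y"
proof -
  have "smat (c - 1) B + smat c (outer y) = B + outer x - B"
    unfolding e by (simp add: smat.scale_left_diff_distrib smat.scale_right_distrib)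
  then have "smat (c - 1) B + smat c (outer y) = 0 + smat 1 (outer x)" by simp
  then have "rank (smat (c - 1) B) \<le> 2"
    using rank_le_add_outer[of "smat (c - 1) B" c y] rank_add_outer[of 0 1 x] by simp
  then have "c = 1" using r rank_smat[of "c - 1" B] by fastforce
  then show ?thesis using e by simp
qed

lemma quadric_in_B21:
  assumes g: "good_param x"
  shows "\<exists>p\<in>B21. represents_tuple (param_tuple x) p"
proof -
  have r: "rank (param_tuple x $ k) \<ge> 3" for k using g by (simp add: good_param_def)
  then have "param_tuple x $ k \<noteq> 0" for k by (metis not_numeral_le_zero rank_0_complex)
  then have "\<forall>k. \<exists>q. represents (param_tuple x $ k) q"
    using represents_exists transpose_param_tuple by blast
  then obtain f where f: "\<And>k. represents (param_tuple x $ k) (f k)" by metis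
  have b: "represents (param_basket x) (f 4)" using f[of 4] by (simp add: param_tuple_4)
  have rb: "rank (param_basket x) \<ge> 3" using r[of 4] by (simp add: param_tuple_4)
  have ne: "f i \<noteq> f k" if ik: "i \<noteq> k" for i k
  proof
    assume "f i = f k"
    then obtain c where "param_tuple x $ i = smat c (param_tuple x $ k)"
      using represents_proportional[OF f[of k], of "param_tuple x $ i"] f[of i] by auto
    then have "outer (param_form x i) = outer (param_form x k)"
      using add_outer_proportional[OF rb] by (simp add: param_tuple_def)
    then show False using g ik by (simp add: good_param_def outer_eq_iff)
  qed
  have rf: "qrank (f k) \<ge> 3" for k using represents_qrank[OF f] r by metis
  have "basket (f 4) (f k)" if "k \<noteq> 4" for k
    unfolding basket_iff_outer[OF b]
    using ne[of 4 k] that rf f[of k] by (auto simp: param_tuple_def)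
  then have "(\<chi> k. f k) \<in> B21"
    using ne rf by (simp add: B21_def common_basket_def)
  moreover have "represents_tuple (param_tuple x) (\<chi> k. f k)" using f by (simp add: represents_tuple_def)
  ultimately show ?thesis by blast
qed

text \<open>The representative of the basket can be prescribed; the dimension count uses this to
  make a chosen entry of it equal to 1.\<close>

lemma B21_param:
  assumes p: "p \<in> B21" and B: "represents B (p $ 4)"
  obtains x where "good_param x" "param_basket x = B" "represents_tuple (param_tuple x) p"
proof -
  have cb: "common_basket (p $ 4) [p $ 1, p $ 2, p $ 3]" using p by (simp add: B21_def)
  have ne: "p $ i \<noteq> p $ k" if "i \<noteq> k" for i k
    using cb that exhaust_4[of i] exhaust_4[of k] by (auto simp: common_basket_def)
  have r: "qrank (p $ k) \<ge> 3" for k using cb exhaust_4[of k] by (auto simp: common_basket_def)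
  have "basket (p $ 4) (p $ k)" if "k \<noteq> 4" for k
    using cb that exhaust_4[of k] by (auto simp: common_basket_def)
  then have "\<forall>k. \<exists>l. k \<noteq> 4 \<longrightarrow> represents (B + outer l) (p $ k)"
    using basket_iff_outer[OF B] by blast
  then obtain l where l: "\<And>k. k \<noteq> 4 \<Longrightarrow> represents (B + outer (l k)) (p $ k)" by metis
  \<comment> \<open>The choice is unambiguous because an entry of the symmetric matrix
    \<open>B\<close> depends only on the unordered pair of its indices.\<close>
  define x :: param where "x j = (case j of Inl S \<Rightarrow> (SOME c. \<exists>i j. S = {i, j} \<and> c = B $ i $ j)
     | Inr (k, j) \<Rightarrow> l k $ j)" for j
  have sym: "B $ i $ j = B $ j $ i" for i j by (rule symmetric_nth[OF represents_symmetric[OF B]])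
  have "(SOME c. \<exists>i' j'. {i, j} = {i', j'} \<and> c = B $ i' $ j') = B $ i $ j" for i j
  proof (rule some_equality)
    show "\<exists>i' j'. {i, j} = {i', j'} \<and> B $ i $ j = B $ i' $ j'" by blast
    fix c assume "\<exists>i' j'. {i, j} = {i', j'} \<and> c = B $ i' $ j'"
    then show "c = B $ i $ j" using sym by (auto simp: doubleton_eq_iff)
  qed
  then have xB: "param_basket x = B" by (simp add: param_basket_def x_def vec_eq_iff)
  have xl: "param_form x k = l k" if "k \<noteq> 4" for k
    using that by (simp add: param_form_def x_def vec_eq_iff)
  have rep: "represents (param_tuple x $ k) (p $ k)" for k
  proof (cases "k = 4")
    case True then show ?thesis using B by (simp add: param_tuple_4 xB)
  next
    case False then show ?thesis using l by (simp add: param_tuple_def xB xl)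
  qed
  have "good_param x"
    unfolding good_param_def
  proof (intro conjI allI impI)
    show "3 \<le> rank (param_tuple x $ k)" for k using represents_qrank[OF rep] r by simp
    fix i k :: 4 assume ik: "i \<noteq> k"
    have "outer (param_form x i) \<noteq> outer (param_form x k)"
    proof
      assume "outer (param_form x i) = outer (param_form x k)"
      then have "param_tuple x $ i = param_tuple x $ k" by (simp add: param_tuple_def)
      then show False using ne[OF ik] rep represents_unique by metis
    qed
    then show "param_form x i \<noteq> param_form x k" "param_form x i \<noteq> - param_form x k"
      by (auto simp: outer_eq_iff)
  qed
  then show thesis using that xB rep by (simp add: represents_tuple_def)
qed

section \<open>Segments of parameters\<close>

lemma polynomial_map_segment: "polynomial_map (\<lambda>t. segment x y t j)"
  unfolding segment_def
  by (intro polynomial_map_add polynomial_map_mult polynomial_map_const polynomial_map_id)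

lemma polynomial_map_param_form: "polynomial_map (\<lambda>t. param_form (segment x y t) k $ j)"
  by (cases "k = 4") (simp_all add: param_form_def polynomial_map_const polynomial_map_segment)

lemma polynomial_curve_segment: "polynomial_curve (\<lambda>t. param_tuple (segment x y t))"
  unfolding polynomial_curve_def param_tuple_def param_basket_def
  by (simp add: polynomial_map_add polynomial_map_mult polynomial_map_segment polynomial_map_param_form)

text \<open>Each requirement is implied by the nonvanishing of a polynomial in \<open>t\<close> that
  is nonzero at \<open>t = 0\<close>. So only the starting point has to be good, and
  \<open>y\<close> is arbitrary.\<close>

lemma finite_bad_params:
  assumes g: "good_param x"
  shows "finite {t. \<not> good_param (segment x y t)}"
proof -
  have fr: "finite {t. rank (param_tuple (segment x y t) $ k) < 3}" for k
    by (rule finite_rank_less_3[of _ 0])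
      (use g polynomial_curve_segment[of x y] in
        \<open>auto simp: polynomial_curve_def transpose_param_tuple good_param_def\<close>)
  have fm: "finite {t. param_form (segment x y t) i = param_form (segment x y t) k}"
    and fp: "finite {t. param_form (segment x y t) i = - param_form (segment x y t) k}"
    if ik: "i \<noteq> k" for i k
  proof -
    have ne: "param_form x i \<noteq> param_form x k" "param_form x i \<noteq> - param_form x k"
      using g ik by (auto simp: good_param_def)
    obtain j where j: "param_form x i $ j - param_form x k $ j \<noteq> 0"
      using ne(1) by (auto simp: vec_eq_iff)
    have "finite {t. param_form (segment x y t) i $ j - param_form (segment x y t) k $ j = 0}"
      by (rule polynomial_map_cofinite[of _ 0])
        (use j in \<open>auto intro: polynomial_map_diff polynomial_map_param_form\<close>)
    then show "finite {t. param_form (segment x y t) i = param_form (segment x y t) k}"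
      by (rule rev_finite_subset) auto
    obtain j where j: "param_form x i $ j + param_form x k $ j \<noteq> 0"
      using ne(2) by (auto simp: vec_eq_iff eq_neg_iff_add_eq_0)
    have "finite {t. param_form (segment x y t) i $ j + param_form (segment x y t) k $ j = 0}"
      by (rule polynomial_map_cofinite[of _ 0])
        (use j in \<open>auto intro: polynomial_map_add polynomial_map_param_form\<close>)
    then show "finite {t. param_form (segment x y t) i = - param_form (segment x y t) k}"
      by (rule rev_finite_subset) auto
  qed
  have "{t. \<not> good_param (segment x y t)} \<subseteq> (\<Union>k. {t. rank (param_tuple (segment x y t) $ k) < 3})
      \<union> (\<Union>(i, k)\<in>{(i, k). i \<noteq> k}. {t. param_form (segment x y t) i = param_form (segment x y t) k}
         \<union> {t. param_form (segment x y t) i = - param_form (segment x y t) k})"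
    by (auto simp: good_param_def not_le)
  moreover have "finite \<dots>"
    using fr fm fp by (intro finite_UnI finite_UN_I) auto
  ultimately show ?thesis by (rule finite_subset)
qed

lemma curve_in_B21:
  assumes "good_param x"
  shows "curve_in B21 (\<lambda>t. param_tuple (segment x y t))"
  unfolding curve_in_def
proof
  show "finite {t. \<not> (\<exists>s\<in>B21. represents_tuple (param_tuple (segment x y t)) s)}"
    by (rule finite_subset[OF _ finite_bad_params[OF assms, of y]]) (use quadric_in_B21 in blast)
qed (rule polynomial_curve_segment)

lemma B21_param_exists:
  assumes "p \<in> B21"
  obtains x where "good_param x" "represents_tuple (param_tuple x) p"
  using B21_param[OF assms represents_rep] by blast

text \<open>The basket is the nondegenerate form \<open>2 (x_1 x_4 + x_2 x_3)\<close>, which stays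
  nondegenerate when multiples of \<open>x_1^2\<close> are added; the forms
  \<open>x_1, 2 x_1, 3 x_1\<close> differ even up to sign. The same point is the start of the chain
  of length 21, where the many zeros keep the tests simple.\<close>

definition base_param :: param where
  "base_param j = (case j of Inl S \<Rightarrow> if S = {1, 4} \<or> S = {2, 3} then 1 else 0
     | Inr (k, i) \<Rightarrow> if i = 1 then (if k = 1 then 1 else if k = 2 then 2 else 3) else 0)"

lemma good_base_param: "good_param base_param"
proof -
  have n: "param_form base_param 1 = axis 1 1" "param_form base_param 2 = axis 1 2"
    "param_form base_param 3 = axis 1 3" "param_form base_param 4 = 0"
    by (simp_all add: param_form_def base_param_def vec_eq_iff axis_def)
  have b: "param_basket base_param $ i $ j = (if {i, j} = {1, 4} \<or> {i, j} = {2, 3} then 1 else 0)" for i j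
    by (simp add: param_basket_def base_param_def)
  have "det (param_tuple base_param $ k) \<noteq> 0" for k
  proof
    assume "det (param_tuple base_param $ k) = 0"
    then obtain v where v: "v \<noteq> 0" "param_tuple base_param $ k *v v = 0" by (auto simp: det_eq_0_iff_kernel)
    define c where "c = param_form base_param k $ 1"
    have f: "param_form base_param k $ i = (if i = 1 then c else 0)" for i
      using exhaust_4[of k] n by (auto simp: c_def axis_def)
    have e: "(param_tuple base_param $ k *v v) $ i = 0" for i using v by simp
    have "v $ 1 = 0 \<and> v $ 2 = 0 \<and> v $ 3 = 0 \<and> v $ 4 = 0"
      using e[of 1] e[of 2] e[of 3] e[of 4]
      by (simp add: matrix_vector_mult_def sum_4 param_tuple_def b f doubleton_eq_iff)
    then show False using v(1) by (simp add: vec_eq_iff forall_4)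
  qed
  then have "rank (param_tuple base_param $ k) \<ge> 3" for k
    using rank_eq_4_iff[of "param_tuple base_param $ k"] by simp
  moreover have "param_form base_param i \<noteq> param_form base_param k
      \<and> param_form base_param i \<noteq> - param_form base_param k" if "i \<noteq> k" for i k
    using that exhaust_4[of i] exhaust_4[of k] n by (auto simp: vec_eq_iff axis_def)
  ultimately show ?thesis by (simp add: good_param_def)
qed

theorem irreducible_B21: "irreducible_space (subtopology zariski B21)"
proof (rule irreducible_if_curves)
  show "B21 \<noteq> {}" using quadric_in_B21[OF good_base_param] by blast
  show "B21 \<subseteq> zariski closure_of B21" by (rule closure_of_subset) simp
  fix p q assume "p \<in> B21" "q \<in> B21"
  then obtain x y where "good_param x" "represents_tuple (param_tuple x) p"
    "represents_tuple (param_tuple y) q"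
    using B21_param_exists by metis
  then show "\<exists>\<gamma>. curve_in B21 \<gamma> \<and> represents_tuple (\<gamma> 0) p \<and> represents_tuple (\<gamma> 1) q"
    using curve_in_B21[of x y] by (intro exI[of _ "\<lambda>t. param_tuple (segment x y t)"]) simp
qed simp

section \<open>The generic triple has the property\<close>

text \<open>If \<open>q = b + l\<^sup>2\<close>, then the \<open>2 \<times> 2\<close> minors of \<open>q - c b\<close> vanish at \<open>c = 1\<close>. Eliminating \<open>c\<^sup>2\<close>
  from two of these quadratic equations in \<open>c\<close> gives \<open>c\<close> as a quotient of two polynomials in the
  entries that makes sense for arbitrary representing matrices, and \<open>square_part\<close> is the
  corresponding multiple of \<open>q - c b\<close>.\<close>

definition minor12 :: "complex^4^4 \<Rightarrow> complex^4^4 \<Rightarrow> complex" where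
  "minor12 M N = M $ 1 $ 1 * N $ 2 $ 2 - M $ 1 $ 2 * N $ 2 $ 1"

definition minor34 :: "complex^4^4 \<Rightarrow> complex^4^4 \<Rightarrow> complex" where
  "minor34 M N = M $ 3 $ 3 * N $ 4 $ 4 - M $ 3 $ 4 * N $ 4 $ 3"

definition square_part :: "(complex^4^4)^4 \<Rightarrow> 4 \<Rightarrow> 4 \<Rightarrow> complex" where
  "square_part A k j =
     (let b = A $ 4; q = A $ k in
       (minor34 b b * (minor12 q b + minor12 b q) - minor12 b b * (minor34 q b + minor34 b q)) * q $ 1 $ j
     - (minor34 b b * minor12 q q - minor12 b b * minor34 q q) * b $ 1 $ j)"

text \<open>For a tuple coming from parameters, the first three rows are multiples of the forms and
  the last row is the fourth unit vector. A nonzero value thus gives a nondegenerate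
  \<open>q_1\<close> and independent forms, together with a completion to a basis.\<close>

definition genericity :: "(complex^4^4)^4 \<Rightarrow> complex" where
  "genericity A = det (A $ 1) *
     det (\<chi> i j. if i = 4 then (if j = 4 then 1 else 0) else square_part A i j)"

abbreviation unit_degree :: "4 \<Rightarrow> 4 \<Rightarrow> nat" where
  "unit_degree k \<equiv> \<lambda>k'. if k' = k then 1 else 0"

lemma multidegree_minor:
  "multidegree (\<lambda>A. minor12 (A $ k) (A $ m)) (\<lambda>k'. unit_degree k k' + unit_degree m k')"
  "multidegree (\<lambda>A. minor34 (A $ k) (A $ m)) (\<lambda>k'. unit_degree k k' + unit_degree m k')"
  unfolding minor12_def minor34_def
  by (intro multidegree_diff multidegree_mult multidegree_coordinate)+

lemma multidegree_cong: "multidegree f d \<Longrightarrow> (\<And>k. d k = e k) \<Longrightarrow> multidegree f e"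
  by (metis ext)

text \<open>Both products have degree two in the quadric and three in the basket; this agreement
  makes their difference multihomogeneous.\<close>

lemma multidegree_square_part:
  "multidegree (\<lambda>A. square_part A k j) (\<lambda>k'. 2 * unit_degree k k' + 3 * unit_degree 4 k')"
  unfolding square_part_def Let_def
proof (intro multidegree_diff)
  let ?d = "\<lambda>k'. (unit_degree 4 k' + unit_degree 4 k') + (unit_degree k k' + unit_degree 4 k')"
  have mixed: "multidegree (\<lambda>A. minor12 (A $ k) (A $ 4) + minor12 (A $ 4) (A $ k)) (\<lambda>k'. unit_degree k k' + unit_degree 4 k')"
    "multidegree (\<lambda>A. minor34 (A $ k) (A $ 4) + minor34 (A $ 4) (A $ k)) (\<lambda>k'. unit_degree k k' + unit_degree 4 k')"
    using multidegree_minor[of k 4] multidegree_minor[of 4 k] by (auto intro!: multidegree_add simp: add.commute)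
  have "multidegree (\<lambda>A. minor34 (A $ 4) (A $ 4) * (minor12 (A $ k) (A $ 4) + minor12 (A $ 4) (A $ k))
      - minor12 (A $ 4) (A $ 4) * (minor34 (A $ k) (A $ 4) + minor34 (A $ 4) (A $ k))) ?d"
    by (intro multidegree_diff multidegree_mult multidegree_minor mixed)
  from multidegree_mult[OF this multidegree_coordinate[of k 1 j]]
  show "multidegree (\<lambda>A. (minor34 (A $ 4) (A $ 4) * (minor12 (A $ k) (A $ 4) + minor12 (A $ 4) (A $ k))
      - minor12 (A $ 4) (A $ 4) * (minor34 (A $ k) (A $ 4) + minor34 (A $ 4) (A $ k))) * A $ k $ 1 $ j)
     (\<lambda>k'. 2 * unit_degree k k' + 3 * unit_degree 4 k')"
    by (rule multidegree_cong) simp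
  have "multidegree (\<lambda>A. minor34 (A $ 4) (A $ 4) * minor12 (A $ k) (A $ k)
      - minor12 (A $ 4) (A $ 4) * minor34 (A $ k) (A $ k))
     (\<lambda>k'. (unit_degree 4 k' + unit_degree 4 k') + (unit_degree k k' + unit_degree k k'))"
    by (intro multidegree_diff multidegree_mult multidegree_minor)
  from multidegree_mult[OF this multidegree_coordinate[of 4 1 j]]
  show "multidegree (\<lambda>A. (minor34 (A $ 4) (A $ 4) * minor12 (A $ k) (A $ k)
      - minor12 (A $ 4) (A $ 4) * minor34 (A $ k) (A $ k)) * A $ 4 $ 1 $ j)
     (\<lambda>k'. 2 * unit_degree k k' + 3 * unit_degree 4 k')"
    by (rule multidegree_cong) simp
qed

lemma multihomogeneous_genericity: "genericity \<in> multihomogeneous"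
proof -
  define d :: "4 \<Rightarrow> 4 \<Rightarrow> nat" where
    "d i k' = (if i = 4 then 0 else 2 * unit_degree i k' + 3 * unit_degree 4 k')" for i k'
  have "multidegree (\<lambda>A. (\<chi> i j. if i = 4 then (if j = 4 then 1 else 0) else square_part A i j) $ i $ j) (d i)" for i j
    using multidegree_square_part[of i j] multidegree_const[of "if j = 4 then 1 else 0"]
    by (cases "i = 4") (simp_all add: d_def[abs_def])
  then have "multidegree (\<lambda>A. det (\<chi> i j. if i = 4 then (if j = 4 then 1 else 0) else square_part A i j))
      (\<lambda>k'. \<Sum>i\<in>UNIV. d i k')"
    unfolding det_def
    by (intro multidegree_sum multidegree_cmult multidegree_prod) simp_all
  then show ?thesis
    using multihomogeneous_mult[OF multihomogeneous_det[of 1]]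
    unfolding genericity_def[abs_def] by (blast intro: multidegree_multihomogeneous)
qed

text \<open>Expand the minors of \<open>q = b + l^2\<close>: the minors of a square vanish and the
  pure terms in \<open>b\<close> cancel, so \<open>q\<close> and \<open>b\<close> receive the same
  coefficient. What remains is a multiple of the first row of \<open>l^2\<close>, which is
  \<open>l_1\<close> times \<open>l\<close>.\<close>

lemma square_part_param:
  obtains c where "\<And>j. square_part (param_tuple x) k j = c * param_form x k $ j"
proof
  fix j
  let ?b = "param_basket x" and ?l = "param_form x k"
  show "square_part (param_tuple x) k j =
     ((minor34 ?b ?b * (minor12 (outer ?l) ?b + minor12 ?b (outer ?l))
       - minor12 ?b ?b * (minor34 (outer ?l) ?b + minor34 ?b (outer ?l))) * ?l $ 1) * ?l $ j"
    unfolding square_part_def Let_def param_tuple_4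
    by (simp add: param_tuple_def minor12_def minor34_def) algebra
qed

theorem generic_triple_property:
  "generically (subtopology zariski B21) (\<lambda>p. triple_property (triple_of p))"
proof (rule generically_if_curves[OF multihomogeneous_genericity])
  fix p assume p: "p \<in> B21" and v: "value_at genericity p \<noteq> 0"
  obtain x where g: "good_param x" and rep: "represents_tuple (param_tuple x) p"
    by (rule B21_param_exists[OF p])
  have "genericity (param_tuple x) \<noteq> 0"
    using value_at_eq_0_iff[OF multihomogeneous_genericity rep] v by blast
  then have det1: "det (param_tuple x $ 1) \<noteq> 0"
    and det2: "det (\<chi> i j. if i = 4 then (if j = 4 then 1 else 0) else square_part (param_tuple x) i j) \<noteq> 0"
    by (auto simp: genericity_def)
  define l where "l i = (if i = 4 then axis 4 1 else param_form x i)" for i :: 4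
  have "det (\<chi> i. l i) \<noteq> 0"
  proof
    assume "det (\<chi> i. l i) = 0"
    then obtain v where v: "v \<noteq> 0" "(\<chi> i. l i) *v v = 0" by (auto simp: det_eq_0_iff_kernel)
    have lv: "linform (l i) v = 0" for i
      using arg_cong[OF v(2), of "\<lambda>y. y $ i"] by (simp add: matrix_vector_nth)
    have "linform ((\<chi> i j. if i = 4 then (if j = 4 then 1 else 0) else square_part (param_tuple x) i j) $ i) v = 0" for i
    proof (cases "i = 4")
      case True
      then have "(\<chi> i j. if i = 4 then (if j = 4 then 1 else 0) else square_part (param_tuple x) i j) $ i = l i"
        by (auto simp: l_def vec_eq_iff axis_def)
      then show ?thesis using lv by simp
    next
      case False
      obtain c where c: "\<And>j. square_part (param_tuple x) i j = c * param_form x i $ j"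
        using square_part_param by blast
      have "(\<chi> i j. if i = 4 then (if j = 4 then 1 else 0) else square_part (param_tuple x) i j) $ i = c *s l i"
        using False by (simp add: l_def c vec_eq_iff)
      then show ?thesis using lv by (simp add: linform_scale_left)
    qed
    then have "(\<chi> i j. if i = 4 then (if j = 4 then 1 else 0) else square_part (param_tuple x) i j) *v v = 0"
      by (simp add: vec_eq_iff matrix_vector_nth)
    then show False using det2 v(1) det_eq_0_iff_kernel by blast
  qed
  then obtain w where w: "dual_basis l w" using dual_basis_exists by blast
  have t: "represents (param_basket x + outer (l k)) (p $ k)" if "k \<noteq> 4" for k
    using rep that by (simp add: represents_tuple_def param_tuple_def l_def)
  have r: "qrank (p $ k) \<ge> 3" for k
    using g rep represents_qrank by (metis good_param_def represents_tuple_def)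
  have "triple_of p \<in> property_triples"
    by (rule property_triples_if_decomposition[OF w transpose_param_basket])
      (use t[of 1] t[of 2] t[of 3] r det1 in \<open>auto simp: triple_of_def l_def param_tuple_def\<close>)
  then show "triple_property (triple_of p)" by (simp add: property_triples_def)
next
  fix p assume "p \<in> B21"
  then obtain x where g: "good_param x" and rep: "represents_tuple (param_tuple x) p"
    by (rule B21_param_exists)
  \<comment> \<open>The basket is \<open>x_2^2 + x_3^2 + x_4^2\<close> with the forms
    \<open>x_1, x_1 + x_2, x_1 + x_3\<close>. Then \<open>q_1\<close> is the identity, and since the
    two minors of the basket are 0 and 1, \<open>square_part\<close> returns the forms with factor
    1.\<close>
  define y :: param where "y j = (case j of Inl S \<Rightarrow> if S = {2} \<or> S = {3} \<or> S = {4} then 1 else 0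
     | Inr (k, i) \<Rightarrow> if i = 1 \<or> (k = 2 \<and> i = 2) \<or> (k = 3 \<and> i = 3) then 1 else 0)" for j
  have b: "param_basket y $ i $ j = (if i = j \<and> i \<noteq> 1 then 1 else 0)" for i j
    using exhaust_4[of i] by (auto simp: param_basket_def y_def)
  have l: "param_form y k $ i = (if k \<noteq> 4 \<and> (i = 1 \<or> (k = 2 \<and> i = 2) \<or> (k = 3 \<and> i = 3)) then 1 else 0)" for k i
    by (simp add: param_form_def y_def)
  have A: "param_tuple y $ k $ i $ j = param_basket y $ i $ j + param_form y k $ i * param_form y k $ j" for k i j
    by (simp add: param_tuple_def)
  have "param_tuple y $ 1 = mat 1"
    by (simp add: vec_eq_iff A b l mat_def)
  then have det1: "det (param_tuple y $ 1) = 1" by simp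
  have sq: "square_part (param_tuple y) k j = param_form y k $ j" if "k \<noteq> 4" for k j
    using that exhaust_4[of k]
    by (auto simp: square_part_def Let_def minor12_def minor34_def A b l)
  have "det (\<chi> i j. if i = 4 then (if j = 4 then 1 else 0) else square_part (param_tuple y) i j) \<noteq> 0"
  proof
    assume "det (\<chi> i j. if i = 4 then (if j = 4 then 1 else 0) else square_part (param_tuple y) i j) = 0"
    then obtain v where v: "v \<noteq> 0"
      "(\<chi> i j. if i = 4 then (if j = 4 then 1 else 0) else square_part (param_tuple y) i j) *v v = 0"
      by (auto simp: det_eq_0_iff_kernel)
    have e: "((\<chi> i j. if i = 4 then (if j = 4 then 1 else 0) else square_part (param_tuple y) i j) *v v) $ i = 0" for i
      unfolding v(2) by simp
    have "v $ 1 = 0 \<and> v $ 2 = 0 \<and> v $ 3 = 0 \<and> v $ 4 = 0"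
      using e[of 1] e[of 2] e[of 3] e[of 4] by (simp add: matrix_vector_mult_def sum_4 sq l)
    then show False using v(1) by (simp add: vec_eq_iff forall_4)
  qed
  then have "genericity (param_tuple (segment x y 1)) \<noteq> 0" using det1 by (simp add: genericity_def)
  then show "\<exists>\<gamma> t. curve_in B21 \<gamma> \<and> represents_tuple (\<gamma> 0) p \<and> genericity (\<gamma> t) \<noteq> 0"
    using curve_in_B21[OF g, of y] rep
    by (intro exI[of _ "\<lambda>t. param_tuple (segment x y t)"] exI[of _ 1]) simp
qed

section \<open>More polynomials than variables are algebraically dependent\<close>

text \<open>Gaussian elimination: equation \<open>t\<close> is solved for an unknown
  \<open>k\<close> with nonzero coefficient, and \<open>C'\<close> is the system after substitution,
  with one equation and one unknown fewer.\<close>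

lemma homogeneous_system_solution:
  fixes C :: "'i \<Rightarrow> 't \<Rightarrow> complex"
  assumes "finite T" "finite I" "card T < card I"
  shows "\<exists>a. (\<exists>i\<in>I. a i \<noteq> 0) \<and> (\<forall>t\<in>T. (\<Sum>i\<in>I. a i * C i t) = 0)"
  using assms
proof (induction T arbitrary: I C rule: finite_induct)
  case empty
  then have "I \<noteq> {}" by auto
  then show ?case by (intro exI[of _ "\<lambda>_. 1"]) auto
next
  case (insert t T)
  show ?case
  proof (cases "\<forall>i\<in>I. C i t = 0")
    case True
    have "card T < card I" using insert by simp
    from insert.IH[OF insert.prems(1) this, of C] obtain a where
      a: "\<exists>i\<in>I. a i \<noteq> 0" "\<forall>s\<in>T. (\<Sum>i\<in>I. a i * C i s) = 0" by blast
    have "(\<Sum>i\<in>I. a i * C i t) = 0" using True by simp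
    then show ?thesis using a by (intro exI[of _ a]) simp
  next
    case False
    then obtain k where k: "k \<in> I" "C k t \<noteq> 0" by blast
    define C' where "C' i s = C i s - C i t / C k t * C k s" for i s
    have "card T < card (I - {k})" using insert k by simp
    from insert.IH[OF _ this, of C'] insert.prems(1)
    obtain a where a: "\<exists>i\<in>I - {k}. a i \<noteq> 0" "\<forall>s\<in>T. (\<Sum>i\<in>I - {k}. a i * C' i s) = 0" by auto
    define b where "b i = (if i = k then - (\<Sum>i\<in>I - {k}. a i * (C i t / C k t)) else a i)" for i
    have sum_b: "(\<Sum>i\<in>I. b i * C i s) = (\<Sum>i\<in>I - {k}. a i * C' i s)" for s
    proof -
      have "(\<Sum>i\<in>I. b i * C i s) = b k * C k s + (\<Sum>i\<in>I - {k}. a i * C i s)"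
        using insert.prems(1) k(1) by (simp add: sum.remove[of I k] b_def)
      also have "b k * C k s = - (\<Sum>i\<in>I - {k}. a i * (C i t / C k t * C k s))"
        by (simp add: b_def sum_distrib_right mult.assoc)
      finally show ?thesis by (simp add: C'_def right_diff_distrib sum_subtractf)
    qed
    have "\<exists>i\<in>I. b i \<noteq> 0" using a(1) by (auto simp: b_def)
    moreover have "(\<Sum>i\<in>I. b i * C i s) = 0" if "s \<in> insert t T" for s
    proof (cases "s = t")
      case True
      then show ?thesis unfolding sum_b using k(2) by (simp add: C'_def)
    next
      case False
      then show ?thesis unfolding sum_b using a(2) that by blast
    qed
    ultimately show ?thesis by blast
  qed
qed

text \<open>The exponents are bounded separately instead of the total degree: the bounds still add
  under multiplication, and the number of monomials is simply
  \<open>(K + 1) ^ card J\<close>.\<close>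

inductive_set monomial_span :: "'v set \<Rightarrow> nat \<Rightarrow> (('v \<Rightarrow> complex) \<Rightarrow> complex) set" for J K where
  monomial: "\<alpha> \<in> J \<rightarrow>\<^sub>E {..K} \<Longrightarrow> (\<lambda>x. c * (\<Prod>j\<in>J. x j ^ \<alpha> j)) \<in> monomial_span J K"
| add: "f \<in> monomial_span J K \<Longrightarrow> g \<in> monomial_span J K \<Longrightarrow> (\<lambda>x. f x + g x) \<in> monomial_span J K"

lemma monomial_span_mult:
  assumes "f \<in> monomial_span J K" "g \<in> monomial_span J L"
  shows "(\<lambda>x. f x * g x) \<in> monomial_span J (K + L)"
  using assms(1)
proof induction
  case (monomial \<alpha> c)
  show ?case using assms(2)
  proof induction
    case (monomial \<beta> d)
    have "(\<lambda>j\<in>J. \<alpha> j + \<beta> j) \<in> J \<rightarrow>\<^sub>E {..K + L}"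
      using \<open>\<alpha> \<in> _\<close> monomial by (fastforce simp: PiE_iff intro: add_mono)
    from monomial_span.monomial[OF this, of "c * d"]
    show ?case by (simp add: power_add prod.distrib mult_ac)
  next
    case (add f g)
    then show ?case using monomial_span.add by (fastforce simp: algebra_simps)
  qed
next
  case (add f g)
  then show ?case using monomial_span.add by (fastforce simp: algebra_simps)
qed

lemma monomial_span_mono: "f \<in> monomial_span J K \<Longrightarrow> K \<le> L \<Longrightarrow> f \<in> monomial_span J L"
proof (induction rule: monomial_span.induct)
  case (monomial \<alpha> c)
  have "(J \<rightarrow>\<^sub>E {..K}) \<subseteq> (J \<rightarrow>\<^sub>E {..L})" by (rule PiE_mono) (use monomial in auto)
  then have "\<alpha> \<in> J \<rightarrow>\<^sub>E {..L}" using monomial(1) by blast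
  then show ?case by (rule monomial_span.monomial)
qed (auto intro: monomial_span.add)

lemma monomial_span_const: "(\<lambda>x. c) \<in> monomial_span J K"
proof -
  have "(\<lambda>j\<in>J. 0) \<in> J \<rightarrow>\<^sub>E {..K}" by auto
  from monomial_span.monomial[OF this, of c] show ?thesis by simp
qed

lemma monomial_span_power: "f \<in> monomial_span J K \<Longrightarrow> (\<lambda>x. f x ^ n) \<in> monomial_span J (n * K)"
  by (induction n) (auto intro: monomial_span_const monomial_span_mult)

lemma monomial_span_prod:
  assumes "finite I" "\<And>i. i \<in> I \<Longrightarrow> f i \<in> monomial_span J (K i)"
  shows "(\<lambda>x. \<Prod>i\<in>I. f i x) \<in> monomial_span J (\<Sum>i\<in>I. K i)"
  using assms by (induction I rule: finite_induct) (auto intro: monomial_span_const monomial_span_mult)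

lemma polyfun_monomial_span:
  assumes J: "finite J" and f: "f \<in> polyfun ((\<lambda>j x. x j) ` J)"
  shows "\<exists>K. f \<in> monomial_span J K"
  using f
proof induction
  case (const c)
  then show ?case using monomial_span_const by blast
next
  case (coord f)
  then obtain j where j: "j \<in> J" "f = (\<lambda>x. x j)" by auto
  have "(\<lambda>i\<in>J. if i = j then 1 else 0) \<in> J \<rightarrow>\<^sub>E {..1::nat}" by auto
  from monomial_span.monomial[OF this, of 1]
  have "(\<lambda>x. \<Prod>i\<in>J. x i ^ (if i = j then 1 else 0)) \<in> monomial_span J 1" by simp
  also have "(\<lambda>x. \<Prod>i\<in>J. x i ^ (if i = j then 1 else 0)) = f"
    using J j by (simp add: if_distrib cong: if_cong)
  finally show ?case by blast
next
  case (add f g)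
  then obtain K L where "f \<in> monomial_span J K" "g \<in> monomial_span J L" by blast
  then have "f \<in> monomial_span J (K + L)" "g \<in> monomial_span J (K + L)"
    by (auto intro: monomial_span_mono)
  then show ?case using monomial_span.add by blast
next
  case (mult f g)
  then show ?case using monomial_span_mult by blast
qed

lemma monomial_span_representation:
  assumes "finite J" "f \<in> monomial_span J K"
  shows "\<exists>c. \<forall>x. f x = (\<Sum>\<alpha>\<in>J \<rightarrow>\<^sub>E {..K}. c \<alpha> * (\<Prod>j\<in>J. x j ^ \<alpha> j))"
  using assms(2)
proof induction
  case (monomial \<alpha> c)
  have "finite (J \<rightarrow>\<^sub>E {..K})" using assms(1) by (simp add: finite_PiE)
  then have "(\<Sum>\<beta>\<in>J \<rightarrow>\<^sub>E {..K}. (if \<beta> = \<alpha> then c else 0) * (\<Prod>j\<in>J. x j ^ \<beta> j)) = c * (\<Prod>j\<in>J. x j ^ \<alpha> j)" for x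
    using monomial by (simp add: if_distribR if_distrib[of "\<lambda>y. y * _"] cong: if_cong)
  then show ?case by (intro exI[of _ "\<lambda>\<beta>. if \<beta> = \<alpha> then c else 0"]) simp
next
  case (add f g)
  then obtain c d where "\<And>x. f x = (\<Sum>\<alpha>\<in>J \<rightarrow>\<^sub>E {..K}. c \<alpha> * (\<Prod>j\<in>J. x j ^ \<alpha> j))"
    "\<And>x. g x = (\<Sum>\<alpha>\<in>J \<rightarrow>\<^sub>E {..K}. d \<alpha> * (\<Prod>j\<in>J. x j ^ \<alpha> j))" by blast
  then show ?case by (intro exI[of _ "\<lambda>\<alpha>. c \<alpha> + d \<alpha>"]) (simp add: distrib_right sum.distrib)
qed

text \<open>The relation is homogenized by the extra factor \<open>Q\<close>.\<close>

lemma algebraic_relation: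
  fixes P :: "nat \<Rightarrow> ('v \<Rightarrow> complex) \<Rightarrow> complex"
  assumes J: "finite J" and n: "card J < n"
    and P: "\<And>i. i < n \<Longrightarrow> P i \<in> polyfun ((\<lambda>j x. x j) ` J)"
    and Q: "Q \<in> polyfun ((\<lambda>j x. x j) ` J)"
  obtains m a where "\<exists>\<alpha>\<in>{..<n} \<rightarrow>\<^sub>E {..<m}. a \<alpha> \<noteq> 0"
    "\<And>x. (\<Sum>\<alpha>\<in>{..<n} \<rightarrow>\<^sub>E {..<m}. a \<alpha> * ((\<Prod>i<n. P i x ^ \<alpha> i) * Q x ^ (n * m - (\<Sum>i<n. \<alpha> i)))) = 0"
proof -
  have "\<forall>i. \<exists>K. i < n \<longrightarrow> P i \<in> monomial_span J K" using polyfun_monomial_span[OF J P] by blast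
  then obtain k where k: "\<And>i. i < n \<Longrightarrow> P i \<in> monomial_span J (k i)" by metis
  obtain k' where k': "Q \<in> monomial_span J k'" using polyfun_monomial_span[OF J Q] by blast
  define K where "K = k' + (\<Sum>i<n. k i)"
  have PK: "P i \<in> monomial_span J K" if "i < n" for i
    by (rule monomial_span_mono[OF k[OF that]]) (use that in \<open>auto simp: K_def intro!: trans_le_add2 member_le_sum\<close>)
  have QK: "Q \<in> monomial_span J K" by (rule monomial_span_mono[OF k']) (simp add: K_def)
  \<comment> \<open>There are \<open>m ^ n\<close> products in the span of
    \<open>(K * n * m + 1) ^ card J\<close> monomials. This \<open>m\<close> exceeds the constant
    factor \<open>(K * n + 1) ^ card J\<close>, and \<open>n\<close> provides at least one more
    power of \<open>m\<close>.\<close>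
  define m where "m = (K * n + 1) ^ card J + 1"
  define I where "I = ({..<n} \<rightarrow>\<^sub>E {..<m})"
  define v where "v \<alpha> x = (\<Prod>i<n. P i x ^ \<alpha> i) * Q x ^ (n * m - (\<Sum>i<n. \<alpha> i))" for \<alpha> x
  have v: "v \<alpha> \<in> monomial_span J (K * n * m)" if \<alpha>: "\<alpha> \<in> I" for \<alpha>
  proof -
    have "(\<Sum>i<n. \<alpha> i) \<le> (\<Sum>i<n. m)"
      by (rule sum_mono) (use \<alpha> in \<open>auto simp: I_def PiE_iff intro: less_imp_le\<close>)
    then have s: "(\<Sum>i<n. \<alpha> i) \<le> n * m" by simp
    have "(\<lambda>x. \<Prod>i<n. P i x ^ \<alpha> i) \<in> monomial_span J (\<Sum>i<n. \<alpha> i * K)"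
      by (rule monomial_span_prod) (auto intro: monomial_span_power PK)
    from monomial_span_mult[OF this monomial_span_power[OF QK, of "n * m - (\<Sum>i<n. \<alpha> i)"]]
    have "v \<alpha> \<in> monomial_span J ((\<Sum>i<n. \<alpha> i * K) + (n * m - (\<Sum>i<n. \<alpha> i)) * K)"
      by (simp add: v_def[abs_def])
    also have "(\<Sum>i<n. \<alpha> i * K) + (n * m - (\<Sum>i<n. \<alpha> i)) * K = ((\<Sum>i<n. \<alpha> i) + (n * m - (\<Sum>i<n. \<alpha> i))) * K"
      by (simp add: sum_distrib_right distrib_right)
    also have "\<dots> = K * n * m" using s by (simp add: mult_ac)
    finally show ?thesis .
  qed
  then have "\<forall>\<alpha>. \<exists>c. \<alpha> \<in> I \<longrightarrow> (\<forall>x. v \<alpha> x = (\<Sum>\<gamma>\<in>J \<rightarrow>\<^sub>E {..K * n * m}. c \<gamma> * (\<Prod>j\<in>J. x j ^ \<gamma> j)))"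
    using monomial_span_representation[OF J] by blast
  from choice[OF this] obtain C where
    C: "v \<alpha> x = (\<Sum>\<gamma>\<in>J \<rightarrow>\<^sub>E {..K * n * m}. C \<alpha> \<gamma> * (\<Prod>j\<in>J. x j ^ \<gamma> j))" if "\<alpha> \<in> I" for \<alpha> x
    by blast
  have finI: "finite I" by (simp add: I_def finite_PiE)
  have m1: "m \<ge> 1" by (simp add: m_def)
  have "card (J \<rightarrow>\<^sub>E {..K * n * m}) = (K * n * m + 1) ^ card J" using J by (simp add: card_PiE)
  also have "\<dots> \<le> ((K * n + 1) * m) ^ card J" using m1 by (intro power_mono) auto
  also have "\<dots> = (K * n + 1) ^ card J * m ^ card J" by (rule power_mult_distrib)
  also have "\<dots> < m * m ^ card J" using m1 by (intro mult_strict_right_mono) (auto simp: m_def)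
  also have "\<dots> = m ^ Suc (card J)" by simp
  also have "\<dots> \<le> m ^ n" using m1 n by (intro power_increasing) auto
  also have "\<dots> = card I" by (simp add: I_def card_PiE)
  finally have "card (J \<rightarrow>\<^sub>E {..K * n * m}) < card I" .
  moreover have "finite (J \<rightarrow>\<^sub>E {..K * n * m})" using J by (simp add: finite_PiE)
  ultimately obtain a where a: "\<exists>\<alpha>\<in>I. a \<alpha> \<noteq> 0" "\<forall>\<gamma>\<in>J \<rightarrow>\<^sub>E {..K * n * m}. (\<Sum>\<alpha>\<in>I. a \<alpha> * C \<alpha> \<gamma>) = 0"
    using homogeneous_system_solution[OF _ finI, of _ C] by blast
  have "(\<Sum>\<alpha>\<in>I. a \<alpha> * v \<alpha> x) = 0" for x
  proof -
    have "(\<Sum>\<alpha>\<in>I. a \<alpha> * v \<alpha> x)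
        = (\<Sum>\<alpha>\<in>I. \<Sum>\<gamma>\<in>J \<rightarrow>\<^sub>E {..K * n * m}. a \<alpha> * C \<alpha> \<gamma> * (\<Prod>j\<in>J. x j ^ \<gamma> j))"
      by (rule sum.cong) (simp_all add: C sum_distrib_left mult.assoc)
    also have "\<dots> = (\<Sum>\<gamma>\<in>J \<rightarrow>\<^sub>E {..K * n * m}. (\<Sum>\<alpha>\<in>I. a \<alpha> * C \<alpha> \<gamma>) * (\<Prod>j\<in>J. x j ^ \<gamma> j))"
      by (subst sum.swap) (simp add: sum_distrib_right)
    also have "\<dots> = 0" using a(2) by simp
    finally show ?thesis .
  qed
  then show thesis using that[of m a] a(1) by (simp add: I_def v_def)
qed

section \<open>Chains of primes give algebraically independent functions\<close>

lemma prime_power: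
  fixes f g :: "'a \<Rightarrow> complex"
  assumes prime: "\<And>f g. f \<in> R \<Longrightarrow> g \<in> R \<Longrightarrow> \<forall>p\<in>Z. f p * g p = 0 \<Longrightarrow> (\<forall>p\<in>Z. f p = 0) \<or> (\<forall>p\<in>Z. g p = 0)"
    and mult: "\<And>f g. f \<in> R \<Longrightarrow> g \<in> R \<Longrightarrow> (\<lambda>x. f x * g x) \<in> R"
    and f: "f \<in> R" "\<exists>p\<in>Z. f p \<noteq> 0" and g: "g \<in> R"
    and 0: "\<forall>p\<in>Z. f p ^ k * g p = 0"
  shows "\<forall>p\<in>Z. g p = 0"
  using g 0
proof (induction k arbitrary: g)
  case (Suc k)
  have "\<forall>p\<in>Z. f p ^ k * (f p * g p) = 0" using Suc.prems(2) by (simp add: mult_ac)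
  then have "\<forall>p\<in>Z. f p * g p = 0" using Suc.IH[of "\<lambda>p. f p * g p"] mult f(1) Suc.prems(1) by blast
  then show ?case using prime[OF f(1) Suc.prems(1)] f(2) by blast
qed simp

text \<open>The lowest power of the last function that occurs in a relation can be cancelled on the last
  set; restricting to the previous set then kills the higher powers.\<close>

lemma chain_algebraically_independent:
  fixes Z :: "nat \<Rightarrow> 'a set" and F :: "nat \<Rightarrow> 'a \<Rightarrow> complex"
  assumes prime: "\<And>i f g. i \<le> n \<Longrightarrow> f \<in> polyfun X \<Longrightarrow> g \<in> polyfun X \<Longrightarrow> \<forall>p\<in>Z i. f p * g p = 0
      \<Longrightarrow> (\<forall>p\<in>Z i. f p = 0) \<or> (\<forall>p\<in>Z i. g p = 0)"
    and F: "\<And>i. i < n \<Longrightarrow> F i \<in> polyfun X" "\<And>i p. i < n \<Longrightarrow> p \<in> Z i \<Longrightarrow> F i p = 0"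
      "\<And>i. i < n \<Longrightarrow> \<exists>p\<in>Z (Suc i). F i p \<noteq> 0"
    and Z: "Z 0 \<noteq> {}" "\<And>i. i < n \<Longrightarrow> Z i \<subseteq> Z (Suc i)"
    and rel: "\<forall>p\<in>Z n. (\<Sum>\<alpha>\<in>{..<n} \<rightarrow>\<^sub>E {..<m}. a \<alpha> * (\<Prod>i<n. F i p ^ \<alpha> i)) = 0"
  shows "\<forall>\<alpha>\<in>{..<n} \<rightarrow>\<^sub>E {..<m}. a \<alpha> = 0"
  using assms
proof (induction n arbitrary: a)
  case 0
  then show ?case by auto
next
  case (Suc n)
  define I where "I = ({..<n} \<rightarrow>\<^sub>E {..<m})"
  define G where "G k p = (\<Sum>\<beta>\<in>I. a (\<beta>(n := k)) * (\<Prod>i<n. F i p ^ \<beta> i))" for k p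
  have IH: "\<forall>\<beta>\<in>I. b \<beta> = 0" if "\<forall>p\<in>Z n. (\<Sum>\<beta>\<in>I. b \<beta> * (\<Prod>i<n. F i p ^ \<beta> i)) = 0" for b
    unfolding I_def
    by (rule Suc.IH) (use Suc.prems that in \<open>auto simp: I_def\<close>)
  have PiE: "({..<Suc n} \<rightarrow>\<^sub>E {..<m}) = (\<lambda>(y, g). g(n := y)) ` ({..<m} \<times> I)"
    unfolding lessThan_Suc I_def by (rule PiE_insert_eq)
  have inj: "inj_on (\<lambda>(y, g). g(n := y)) ({..<m} \<times> I)"
    unfolding I_def by (rule inj_combinator) simp
  have expand: "(\<Sum>\<alpha>\<in>{..<Suc n} \<rightarrow>\<^sub>E {..<m}. a \<alpha> * (\<Prod>i<Suc n. F i p ^ \<alpha> i)) = (\<Sum>k<m. F n p ^ k * G k p)" for p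
  proof -
    have "(\<Sum>\<alpha>\<in>{..<Suc n} \<rightarrow>\<^sub>E {..<m}. a \<alpha> * (\<Prod>i<Suc n. F i p ^ \<alpha> i))
        = (\<Sum>(k, \<beta>)\<in>{..<m} \<times> I. a (\<beta>(n := k)) * ((\<Prod>i<n. F i p ^ \<beta> i) * F n p ^ k))"
      unfolding PiE by (subst sum.reindex[OF inj]) (auto intro!: sum.cong)
    also have "\<dots> = (\<Sum>k<m. \<Sum>\<beta>\<in>I. a (\<beta>(n := k)) * ((\<Prod>i<n. F i p ^ \<beta> i) * F n p ^ k))"
      by (simp add: sum.cartesian_product)
    also have "\<dots> = (\<Sum>k<m. F n p ^ k * G k p)"
      by (simp add: G_def sum_distrib_left mult_ac)
    finally show ?thesis .
  qed
  have GX: "G k \<in> polyfun X" for k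
    unfolding G_def[abs_def]
    by (intro polyfun_sum polyfun_cmult polyfun_prod polyfun_power Suc.prems(2)) simp
  have all: "k < m \<Longrightarrow> \<forall>\<beta>\<in>I. a (\<beta>(n := k)) = 0" for k
  proof (induction k rule: less_induct)
    case (less k)
    have low: "G j p = 0" if "j < k" for j p
      unfolding G_def
    proof (rule sum.neutral, rule ballI)
      fix \<beta> assume "\<beta> \<in> I"
      then show "a (\<beta>(n := j)) * (\<Prod>i<n. F i p ^ \<beta> i) = 0"
        using bspec[OF less.IH[OF that less_trans[OF that less.prems]]] by (simp only: mult_zero_left)
    qed
    \<comment> \<open>The terms with exponent above \<open>k\<close>, divided by the common factor
      \<open>F n p ^ Suc k\<close>.\<close>
    define H where "H p = (\<Sum>j\<in>{Suc k..<m}. F n p ^ (j - Suc k) * G j p)" for p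
    have split: "(\<Sum>j<m. F n p ^ j * G j p) = F n p ^ k * (G k p + F n p * H p)" for p
    proof -
      have set: "{..<m} = {..<k} \<union> insert k {Suc k..<m}" using less.prems by auto
      have "(\<Sum>j<m. F n p ^ j * G j p)
          = (\<Sum>j<k. F n p ^ j * G j p) + (\<Sum>j\<in>insert k {Suc k..<m}. F n p ^ j * G j p)"
        unfolding set by (rule sum.union_disjoint) auto
      also have "(\<Sum>j<k. F n p ^ j * G j p) = 0" using low by simp
      also have "(\<Sum>j\<in>insert k {Suc k..<m}. F n p ^ j * G j p)
          = F n p ^ k * G k p + (\<Sum>j\<in>{Suc k..<m}. F n p ^ j * G j p)" by simp
      also have "(\<Sum>j\<in>{Suc k..<m}. F n p ^ j * G j p) = F n p ^ Suc k * H p"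
        unfolding H_def sum_distrib_left
      proof (rule sum.cong)
        fix j assume "j \<in> {Suc k..<m}"
        then have "F n p ^ j = F n p ^ Suc k * F n p ^ (j - Suc k)"
          using power_add[of "F n p" "Suc k" "j - Suc k"] by (simp del: power_Suc)
        then show "F n p ^ j * G j p = F n p ^ Suc k * (F n p ^ (j - Suc k) * G j p)" by simp
      qed simp
      finally show ?thesis by (simp add: algebra_simps)
    qed
    have HX: "H \<in> polyfun X"
      unfolding H_def[abs_def]
      by (intro polyfun_sum polyfun.mult polyfun_power GX Suc.prems(2)) simp
    have "\<forall>p\<in>Z (Suc n). G k p + F n p * H p = 0"
    proof (rule prime_power[where R = "polyfun X" and f = "F n" and k = k])
      show "\<forall>p\<in>Z (Suc n). F n p ^ k * (G k p + F n p * H p) = 0"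
        using Suc.prems(7) unfolding expand split .
      show "(\<lambda>p. G k p + F n p * H p) \<in> polyfun X"
        by (intro polyfun.add polyfun.mult GX HX Suc.prems(2)) simp
    qed (use Suc.prems(1)[of "Suc n"] Suc.prems(2)[of n] Suc.prems(4)[of n] in \<open>auto intro: polyfun.mult\<close>)
    \<comment> \<open>On \<open>Z n\<close> the function \<open>F n\<close> vanishes, which leaves a
      relation between the first \<open>n\<close> functions for the outer induction.\<close>
    then have "\<forall>p\<in>Z n. G k p = 0"
      using Suc.prems(3)[of n] Suc.prems(6)[of n] by fastforce
    then show ?case using IH[of "\<lambda>\<beta>. a (\<beta>(n := k))"] unfolding G_def by blast
  qed
  show ?case
    unfolding PiE
  proof
    fix \<alpha> assume "\<alpha> \<in> (\<lambda>(y, g). g(n := y)) ` ({..<m} \<times> I)"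
    then obtain k \<beta> where k: "k < m" "\<beta> \<in> I" "\<alpha> = \<beta>(n := k)" by auto
    show "a \<alpha> = 0" unfolding k(3) by (rule bspec[OF all[OF k(1)] k(2)])
  qed
qed

section \<open>Affine charts\<close>

text \<open>\<open>e\<close> selects one matrix entry for each quadric; the chart consists of the
  tuples for which all selected entries are nonzero.\<close>

definition chart_entry :: "('k \<Rightarrow> 4 \<times> 4) \<Rightarrow> (complex^4^4)^'k \<Rightarrow> 'k \<Rightarrow> complex" where
  "chart_entry e A k = A $ k $ fst (e k) $ snd (e k)"

definition chart_product :: "('k::finite \<Rightarrow> 4 \<times> 4) \<Rightarrow> (complex^4^4)^'k \<Rightarrow> complex" where
  "chart_product e A = (\<Prod>k\<in>UNIV. chart_entry e A k)"

text \<open>Dividing by the selected entry gives a matrix that depends only on the quadric, so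
  polynomials without any homogeneity can be evaluated. As \<open>inverse 0 = 0\<close>, a component
  whose selected entry is 0 becomes the zero matrix.\<close>

definition normalized :: "('k \<Rightarrow> 4 \<times> 4) \<Rightarrow> (complex^4^4)^'k \<Rightarrow> (complex^4^4)^'k" where
  "normalized e A = (\<chi> k. smat (inverse (chart_entry e A k)) (A $ k))"

lemma chart_product_nonzero: "chart_product e A \<noteq> 0 \<longleftrightarrow> (\<forall>k. chart_entry e A k \<noteq> 0)"
  by (simp add: chart_product_def)

lemma multidegree_chart_product: "multidegree (chart_product e) (\<lambda>k. 1)"
proof -
  have "multidegree (chart_product e) (\<lambda>k'. \<Sum>k\<in>UNIV. if k' = k then 1 else 0)"
    unfolding chart_product_def[abs_def] chart_entry_def
    by (intro multidegree_prod multidegree_coordinate) simp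
  then show ?thesis by simp
qed

text \<open>A power of \<open>chart_product\<close>, which has degree one in each quadric, clears
  the denominators. Having every large \<open>d\<close> available lets the summands of a sum, and
  later finitely many functions, share one exponent.\<close>

lemma homogenization:
  fixes e :: "'k::finite \<Rightarrow> 4 \<times> 4"
  assumes "f \<in> polyfun coordinates"
  shows "\<exists>D. \<forall>d\<ge>D. \<exists>g. multidegree g (\<lambda>k. d) \<and>
    (\<forall>A. chart_product e A \<noteq> 0 \<longrightarrow> g A = chart_product e A ^ d * f (normalized e A))"
  using assms
proof induction
  case (const c)
  have "multidegree (\<lambda>A. c * chart_product e A ^ d) (\<lambda>k. d)" for d
    using multidegree_cmult[OF multidegree_power[OF multidegree_chart_product, where n = d]] by simp
  then show ?case by (intro exI[of _ 0]) (auto simp: mult.commute)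
next
  case (coord f)
  then obtain k i j where f: "f = (\<lambda>A. A $ k $ i $ j)" by auto
  have "\<exists>g. multidegree g (\<lambda>k. d) \<and>
    (\<forall>A. chart_product e A \<noteq> 0 \<longrightarrow> g A = chart_product e A ^ d * f (normalized e A))" if "d \<ge> 1" for d
  proof (intro exI conjI allI impI)
    \<comment> \<open>One factor \<open>chart_product\<close> cancels the denominator of the
      \<open>k\<close>-th component and leaves the other selected entries; its remaining power only
      raises the degree to \<open>d\<close>.\<close>
    let ?g = "\<lambda>A. A $ k $ i $ j * (\<Prod>k'\<in>UNIV - {k}. chart_entry e A k') * chart_product e A ^ (d - 1)"
    have "multidegree ?g (\<lambda>k'. ((if k' = k then 1 else 0) + (\<Sum>k''\<in>UNIV - {k}. if k' = k'' then 1 else 0)) + (d - 1) * 1)"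
      unfolding chart_entry_def
      by (intro multidegree_mult multidegree_prod multidegree_coordinate multidegree_power multidegree_chart_product) simp
    then show "multidegree ?g (\<lambda>k. d)"
      by (rule multidegree_cong) (use that in auto)
    fix A assume A: "chart_product e A \<noteq> 0"
    then have k0: "chart_entry e A k \<noteq> 0" by (simp add: chart_product_nonzero)
    have "chart_product e A = chart_entry e A k * (\<Prod>k'\<in>UNIV - {k}. chart_entry e A k')"
      unfolding chart_product_def by (rule prod.remove) auto
    then have e1: "f (normalized e A) * chart_product e A = A $ k $ i $ j * (\<Prod>k'\<in>UNIV - {k}. chart_entry e A k')"
      using k0 by (simp add: f normalized_def)
    have e2: "chart_product e A ^ d = chart_product e A * chart_product e A ^ (d - 1)"
      using that by (simp flip: power_Suc)
    show "?g A = chart_product e A ^ d * f (normalized e A)"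
      unfolding e1[symmetric] e2 by (simp only: mult_ac)
  qed
  then show ?case by blast
next
  case (add f g)
  then obtain D1 D2 where D: "\<forall>d\<ge>D1. \<exists>h. multidegree h (\<lambda>k. d) \<and>
      (\<forall>A. chart_product e A \<noteq> 0 \<longrightarrow> h A = chart_product e A ^ d * f (normalized e A))"
    "\<forall>d\<ge>D2. \<exists>h. multidegree h (\<lambda>k. d) \<and>
      (\<forall>A. chart_product e A \<noteq> 0 \<longrightarrow> h A = chart_product e A ^ d * g (normalized e A))" by blast
  show ?case
  proof (rule exI[of _ "max D1 D2"], intro allI impI)
    fix d assume "max D1 D2 \<le> d"
    then obtain h1 h2 where "multidegree h1 (\<lambda>k. d)" "multidegree h2 (\<lambda>k. d)"
      "\<And>A. chart_product e A \<noteq> 0 \<Longrightarrow> h1 A = chart_product e A ^ d * f (normalized e A)"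
      "\<And>A. chart_product e A \<noteq> 0 \<Longrightarrow> h2 A = chart_product e A ^ d * g (normalized e A)"
      using D(1)[rule_format, of d] D(2)[rule_format, of d] by auto
    then show "\<exists>h. multidegree h (\<lambda>k. d) \<and> (\<forall>A. chart_product e A \<noteq> 0 \<longrightarrow>
        h A = chart_product e A ^ d * (f (normalized e A) + g (normalized e A)))"
      by (intro exI[of _ "\<lambda>A. h1 A + h2 A"]) (simp add: multidegree_add distrib_left)
  qed
next
  case (mult f g)
  then obtain D1 D2 where D: "\<forall>d\<ge>D1. \<exists>h. multidegree h (\<lambda>k. d) \<and>
      (\<forall>A. chart_product e A \<noteq> 0 \<longrightarrow> h A = chart_product e A ^ d * f (normalized e A))"
    "\<forall>d\<ge>D2. \<exists>h. multidegree h (\<lambda>k. d) \<and>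
      (\<forall>A. chart_product e A \<noteq> 0 \<longrightarrow> h A = chart_product e A ^ d * g (normalized e A))" by blast
  show ?case
  proof (rule exI[of _ "D1 + D2"], intro allI impI)
    fix d assume d: "D1 + D2 \<le> d"
    then have "D2 \<le> d - D1" by simp
    then obtain h1 h2 where h: "multidegree h1 (\<lambda>k. D1)" "multidegree h2 (\<lambda>k. d - D1)"
      "\<And>A. chart_product e A \<noteq> 0 \<Longrightarrow> h1 A = chart_product e A ^ D1 * f (normalized e A)"
      "\<And>A. chart_product e A \<noteq> 0 \<Longrightarrow> h2 A = chart_product e A ^ (d - D1) * g (normalized e A)"
      using D(1)[rule_format, of D1] D(2)[rule_format, of "d - D1"] by auto
    have "chart_product e A ^ d = chart_product e A ^ D1 * chart_product e A ^ (d - D1)" for A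
      using d by (simp flip: power_add)
    moreover have "multidegree (\<lambda>A. h1 A * h2 A) (\<lambda>k. d)"
      using multidegree_mult[OF h(1,2)] d by simp
    ultimately show "\<exists>h. multidegree h (\<lambda>k. d) \<and> (\<forall>A. chart_product e A \<noteq> 0 \<longrightarrow>
        h A = chart_product e A ^ d * (f (normalized e A) * g (normalized e A)))"
      using h(3,4) by (intro exI[of _ "\<lambda>A. h1 A * h2 A"]) (simp add: mult_ac)
  qed
qed

abbreviation rep_tuple :: "quadric^'k \<Rightarrow> (complex^4^4)^'k" where
  "rep_tuple p \<equiv> (\<chi> k. rep_quadric (p $ k))"

lemma normalized_eq:
  assumes "represents_tuple A p"
  shows "normalized e A = normalized e (rep_tuple p)"
proof -
  have "normalized e A $ k = normalized e (rep_tuple p) $ k" for k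
  proof -
    obtain c where "c \<noteq> 0" "A $ k = smat c (rep_quadric (p $ k))"
      using assms by (auto simp: represents_tuple_def represents_def)
    then show ?thesis by (simp add: normalized_def chart_entry_def vec_eq_iff field_simps)
  qed
  then show ?thesis by (simp add: vec_eq_iff)
qed

lemma represents_normalized:
  assumes "chart_product e (rep_tuple p) \<noteq> 0"
  shows "represents_tuple (normalized e (rep_tuple p)) p"
  using assms by (auto simp: represents_tuple_def normalized_def chart_product_nonzero intro: represents_smat)

lemma irreducible_prime:
  assumes irr: "irreducible_space (subtopology zariski Z)"
    and f: "f \<in> multihomogeneous" and g: "g \<in> multihomogeneous"
    and 0: "\<And>p. p \<in> Z \<Longrightarrow> value_at f p * value_at g p = 0"
  shows "(\<forall>p\<in>Z. value_at f p = 0) \<or> (\<forall>p\<in>Z. value_at g p = 0)"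
proof -
  have "topspace (subtopology zariski Z) = {p \<in> Z. value_at f p = 0} \<union> {p \<in> Z. value_at g p = 0}"
    using 0 by auto
  moreover have "\<forall>C D. closedin (subtopology zariski Z) C \<longrightarrow> closedin (subtopology zariski Z) D \<longrightarrow>
      topspace (subtopology zariski Z) = C \<union> D \<longrightarrow>
      C = topspace (subtopology zariski Z) \<or> D = topspace (subtopology zariski Z)"
    using irr unfolding irreducible_space_def by (rule conjunct2)
  ultimately have "{p \<in> Z. value_at f p = 0} = topspace (subtopology zariski Z)
      \<or> {p \<in> Z. value_at g p = 0} = topspace (subtopology zariski Z)"
    using closedin_zero_set[OF f] closedin_zero_set[OF g] by blast
  then have "{p \<in> Z. value_at f p = 0} = Z \<or> {p \<in> Z. value_at g p = 0} = Z" by simp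
  then show ?thesis by blast
qed

text \<open>The homogenizations are multiplied by \<open>chart_product\<close>, so that they vanish
  outside the chart too; then irreducibility of all of \<open>Z\<close> applies.\<close>

lemma chart_prime:
  assumes irr: "irreducible_space (subtopology zariski Z)"
    and f: "f \<in> polyfun coordinates" and g: "g \<in> polyfun coordinates"
    and 0: "\<forall>A\<in>(\<lambda>p. normalized e (rep_tuple p)) ` {p \<in> Z. chart_product e (rep_tuple p) \<noteq> 0}. f A * g A = 0"
  shows "(\<forall>A\<in>(\<lambda>p. normalized e (rep_tuple p)) ` {p \<in> Z. chart_product e (rep_tuple p) \<noteq> 0}. f A = 0)
    \<or> (\<forall>A\<in>(\<lambda>p. normalized e (rep_tuple p)) ` {p \<in> Z. chart_product e (rep_tuple p) \<noteq> 0}. g A = 0)"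
proof -
  have hom: "\<exists>h\<in>multihomogeneous. \<forall>p. value_at h p = 0 \<longleftrightarrow>
      chart_product e (rep_tuple p) = 0 \<or> f (normalized e (rep_tuple p)) = 0"
    if f: "f \<in> polyfun coordinates" for f
  proof -
    obtain d h where h: "multidegree h (\<lambda>k. d)"
      "\<And>A. chart_product e A \<noteq> 0 \<Longrightarrow> h A = chart_product e A ^ d * f (normalized e A)"
      using homogenization[OF f, of e] by blast
    have "(\<lambda>A. chart_product e A * h A) \<in> multihomogeneous"
      using multidegree_mult[OF multidegree_chart_product h(1)] by (rule multidegree_multihomogeneous)
    moreover have "value_at (\<lambda>A. chart_product e A * h A) p = 0 \<longleftrightarrow>
        chart_product e (rep_tuple p) = 0 \<or> f (normalized e (rep_tuple p)) = 0" for p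
      by (cases "chart_product e (rep_tuple p) = 0") (simp_all add: value_at_def h(2))
    ultimately show ?thesis by blast
  qed
  obtain f' where f': "f' \<in> multihomogeneous" "\<And>p. value_at f' p = 0 \<longleftrightarrow>
      chart_product e (rep_tuple p) = 0 \<or> f (normalized e (rep_tuple p)) = 0"
    using hom[OF f] by blast
  obtain g' where g': "g' \<in> multihomogeneous" "\<And>p. value_at g' p = 0 \<longleftrightarrow>
      chart_product e (rep_tuple p) = 0 \<or> g (normalized e (rep_tuple p)) = 0"
    using hom[OF g] by blast
  have "value_at f' p * value_at g' p = 0" if "p \<in> Z" for p
    using 0 that f'(2) g'(2) by auto
  from irreducible_prime[OF irr f'(1) g'(1) this] show ?thesis
    unfolding f'(2) g'(2) by blast
qed

section \<open>The dimension is at most twenty-one\<close>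

text \<open>The coordinates on which \<open>param_tuple\<close> depends: ten for a symmetric matrix
  and four for each of the three forms, 22 together.\<close>

definition param_indices :: "(4 set + 4 \<times> 4) set" where
  "param_indices = range (\<lambda>(i, j). Inl {i, j}) \<union> Inr ` ({1, 2, 3} \<times> UNIV)"

lemma card_param_indices:
  "finite param_indices" "card (param_indices - {Inl {i, j}}) = 21"
proof -
  show fin: "finite param_indices" by (simp add: param_indices_def)
  have "range (\<lambda>(i, j). {i, j :: 4})
      = {{1}, {2}, {3}, {4}, {1, 2}, {1, 3}, {1, 4}, {2, 3}, {2, 4}, {3, 4}}" (is "?L = ?R")
  proof
    show "?L \<subseteq> ?R"
    proof
      fix S assume "S \<in> ?L"
      then obtain i j where S: "S = {i, j}" by auto
      show "S \<in> ?R" unfolding S using exhaust_4[of i] exhaust_4[of j] by (elim disjE) (simp_all add: insert_commute)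
    qed
    have "{i} \<in> ?L" "{i, j} \<in> ?L" for i j
      by (rule range_eqI[of _ _ "(i, i)"], simp) (rule range_eqI[of _ _ "(i, j)"], simp)
    then show "?R \<subseteq> ?L" by simp
  qed
  then have "card (range (\<lambda>(i, j). {i, j :: 4})) = 10"
    by (simp add: card_insert_if doubleton_eq_iff insert_eq_iff)
  moreover have "range (\<lambda>(i, j). Inl {i, j}) = (Inl ` range (\<lambda>(i, j). {i, j :: 4}) :: (4 set + 4 \<times> 4) set)"
    by (auto simp: image_iff)
  ultimately have "card (range (\<lambda>(i, j). Inl {i, j}) :: (4 set + 4 \<times> 4) set) = 10"
    by (simp add: card_image)
  moreover have "card (Inr ` ({1, 2, 3} \<times> UNIV) :: (4 set + 4 \<times> 4) set) = 12"
    by (simp add: card_image card_cartesian_product)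
  moreover have "range (\<lambda>(i, j). Inl {i, j}) \<inter> Inr ` ({1, 2, 3} \<times> UNIV) = ({} :: (4 set + 4 \<times> 4) set)" by auto
  ultimately have "card param_indices = 22"
    unfolding param_indices_def by (subst card_Un_disjoint) auto
  moreover have "Inl {i, j} \<in> param_indices" by (auto simp: param_indices_def)
  ultimately show "card (param_indices - {Inl {i, j}}) = 21" using fin by simp
qed

lemma polyfun_param_tuple:
  assumes f: "f \<in> polyfun coordinates"
  shows "(\<lambda>y. f (param_tuple (y(j0 := 1)))) \<in> polyfun ((\<lambda>j x. x j) ` (param_indices - {j0}))"
proof (rule polyfun_comp[OF f])
  let ?X = "(\<lambda>j (x :: param). x j) ` (param_indices - {j0})"
  fix g :: "(complex^4^4)^4 \<Rightarrow> complex" assume "g \<in> coordinates"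
  then obtain k i j where g: "g = (\<lambda>A. A $ k $ i $ j)" by auto
  have upd: "(\<lambda>y. (y(j0 := 1)) m) \<in> polyfun ?X" if m: "m \<in> param_indices" for m
  proof (cases "m = j0")
    case True
    then show ?thesis using polyfun.const[of 1] by simp
  next
    case False
    then have "(\<lambda>y. y m) \<in> ?X" using m by blast
    then show ?thesis using False polyfun.coord by simp
  qed
  have form: "(\<lambda>y. param_form (y(j0 := 1)) k $ i) \<in> polyfun ?X" for i
  proof (cases "k = 4")
    case True
    then show ?thesis by (simp add: param_form_def polyfun.const)
  next
    case False
    then have "Inr (k, i) \<in> param_indices" using exhaust_4[of k] by (auto simp: param_indices_def)
    from upd[OF this] False show ?thesis by (simp add: param_form_def del: fun_upd_apply)
  qed
  have "Inl {i, j} \<in> param_indices" by (auto simp: param_indices_def)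
  from upd[OF this] have "(\<lambda>y. param_basket (y(j0 := 1)) $ i $ j) \<in> polyfun ?X"
    by (simp add: param_basket_def del: fun_upd_apply)
  then show "(\<lambda>y. g (param_tuple (y(j0 := 1)))) \<in> polyfun ?X"
    using polyfun.add[OF _ polyfun.mult[OF form[of i] form[of j]]] by (simp add: g param_tuple_def)
qed

text \<open>The chart contains a point of the smallest set and therefore meets every set of the
  chain. Normalizing an entry of the basket to 1 lowers the number of parameters from 22 to
  21.\<close>

lemma chain_length_le_21:
  fixes Z :: "nat \<Rightarrow> (quadric^4) set"
  assumes Z: "\<And>i. i \<le> n \<Longrightarrow> closedin (subtopology zariski B21) (Z i)"
    and irr: "\<And>i. i \<le> n \<Longrightarrow> irreducible_space (subtopology zariski (Z i))"
    and strict: "\<And>i. i < n \<Longrightarrow> Z i \<subset> Z (Suc i)"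
  shows "n \<le> 21"
proof (rule ccontr)
  assume "\<not> n \<le> 21"
  have ZB: "Z i \<subseteq> B21" if "i \<le> n" for i using closedin_subset[OF Z[OF that]] by simp
  obtain p0 where p0: "p0 \<in> Z 0" using irr[of 0] by (auto simp: irreducible_space_def)
  have p0Z: "p0 \<in> Z i" if "i \<le> n" for i
    using that
  proof (induction i)
    case (Suc i)
    then show ?case using strict[of i] by auto
  qed (rule p0)
  have "\<forall>k. \<exists>ij. rep_quadric (p0 $ k) $ fst ij $ snd ij \<noteq> 0"
  proof
    fix k
    have "\<exists>i j. rep_quadric (p0 $ k) $ i $ j \<noteq> 0" using rep_nonzero[of "p0 $ k"] by (auto simp: vec_eq_iff)
    then show "\<exists>ij. rep_quadric (p0 $ k) $ fst ij $ snd ij \<noteq> 0" by auto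
  qed
  from choice[OF this] obtain e where e: "\<And>k. rep_quadric (p0 $ k) $ fst (e k) $ snd (e k) \<noteq> 0" by blast
  have chart0: "chart_product e (rep_tuple p0) \<noteq> 0"
    unfolding chart_product_nonzero chart_entry_def using e by simp
  have E_hom: "chart_product e \<in> multihomogeneous"
    by (rule multidegree_multihomogeneous[OF multidegree_chart_product])
  define C where "C i = (\<lambda>p. normalized e (rep_tuple p)) ` {p \<in> Z i. chart_product e (rep_tuple p) \<noteq> 0}" for i
  have "\<forall>i. \<exists>f. i < n \<longrightarrow> f \<in> multihomogeneous \<and> (\<forall>z\<in>Z i. value_at f z = 0) \<and> (\<exists>p\<in>Z (Suc i). value_at f p \<noteq> 0)"
  proof (intro allI)
    fix i
    show "\<exists>f. i < n \<longrightarrow> f \<in> multihomogeneous \<and> (\<forall>z\<in>Z i. value_at f z = 0) \<and> (\<exists>p\<in>Z (Suc i). value_at f p \<noteq> 0)"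
    proof (cases "i < n")
      case True
      then obtain p where p: "p \<in> Z (Suc i)" "p \<notin> Z i" using strict by blast
      have "p \<in> B21" using p(1) ZB[of "Suc i"] True by auto
      from closedin_separate[OF Z[of i] this p(2)] True obtain f where
        "f \<in> multihomogeneous" "value_at f p \<noteq> 0" "\<And>z. z \<in> Z i \<Longrightarrow> value_at f z = 0" by auto
      then show ?thesis using p(1) by blast
    qed auto
  qed
  from choice[OF this] obtain F where F: "F i \<in> multihomogeneous" "\<forall>z\<in>Z i. value_at (F i) z = 0"
    "\<exists>p\<in>Z (Suc i). value_at (F i) p \<noteq> 0" if "i < n" for i by blast
  have FX: "F i \<in> polyfun coordinates" if "i < n" for i
    using multihomogeneous_polyfun[OF F(1)[OF that]] .
  have F_at: "F i (normalized e (rep_tuple p)) = 0 \<longleftrightarrow> value_at (F i) p = 0"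
    if "i < n" "chart_product e (rep_tuple p) \<noteq> 0" for i p
    using value_at_eq_0_iff[OF F(1)[OF that(1)] represents_normalized[OF that(2)]] by blast
  have F_zero: "F i A = 0" if "i < n" "A \<in> C i" for i A
    using that F(2)[OF that(1)] F_at[OF that(1)] by (auto simp: C_def)
  \<comment> \<open>If \<open>F i\<close> vanished on the chart part, its product with
    \<open>chart_product\<close> would vanish on the whole irreducible set, hence one of the factors
    would; neither does.\<close>
  have F_nonzero: "\<exists>A\<in>C (Suc i). F i A \<noteq> 0" if i: "i < n" for i
  proof (rule ccontr)
    assume no: "\<not> ?thesis"
    have "value_at (F i) p * value_at (chart_product e) p = 0" if p: "p \<in> Z (Suc i)" for p
    proof (cases "chart_product e (rep_tuple p) = 0")
      case True then show ?thesis by (simp add: value_at_def)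
    next
      case False
      then have "F i (normalized e (rep_tuple p)) = 0" using no p by (auto simp: C_def)
      then show ?thesis using F_at[OF i False] by simp
    qed
    from irreducible_prime[OF irr[of "Suc i"] F(1)[OF i] E_hom this] i
    have "(\<forall>p\<in>Z (Suc i). value_at (F i) p = 0) \<or> (\<forall>p\<in>Z (Suc i). value_at (chart_product e) p = 0)" by simp
    moreover have "value_at (chart_product e) p0 \<noteq> 0" using chart0 by (simp add: value_at_def)
    ultimately show False using F(3)[OF i] p0Z[of "Suc i"] i by auto
  qed
  have "\<forall>i. \<exists>D. i < n \<longrightarrow> (\<forall>d\<ge>D. \<exists>g. multidegree g (\<lambda>k. d) \<and>
      (\<forall>A. chart_product e A \<noteq> 0 \<longrightarrow> g A = chart_product e A ^ d * F i (normalized e A)))"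
    using homogenization[OF FX] by blast
  from choice[OF this] obtain D where D: "\<forall>d\<ge>D i. \<exists>g. multidegree g (\<lambda>k. d) \<and>
      (\<forall>A. chart_product e A \<noteq> 0 \<longrightarrow> g A = chart_product e A ^ d * F i (normalized e A))" if "i < n" for i
    by blast
  \<comment> \<open>A bound for all \<open>D i\<close>: with one exponent for all functions, the
    same factor \<open>q\<close> splits off from each of them.\<close>
  define d where "d = (\<Sum>i<n. D i)"
  have dD: "D i \<le> d" if "i < n" for i
    unfolding d_def using that by (intro member_le_sum) auto
  have "\<forall>i. \<exists>g. i < n \<longrightarrow> multidegree g (\<lambda>k. d) \<and>
      (\<forall>A. chart_product e A \<noteq> 0 \<longrightarrow> g A = chart_product e A ^ d * F i (normalized e A))"
    using D dD by blast
  from choice[OF this] obtain g where g: "multidegree (g i) (\<lambda>k. d)"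
    "\<forall>A. chart_product e A \<noteq> 0 \<longrightarrow> g i A = chart_product e A ^ d * F i (normalized e A)" if "i < n" for i
    by blast
  define j0 :: "4 set + 4 \<times> 4" where "j0 = Inl {fst (e 4), snd (e 4)}"
  have J: "finite (param_indices - {j0})" "card (param_indices - {j0}) < n"
    using card_param_indices \<open>\<not> n \<le> 21\<close> by (simp_all add: j0_def)
  have P: "(\<lambda>y. g i (param_tuple (y(j0 := 1)))) \<in> polyfun ((\<lambda>j x. x j) ` (param_indices - {j0}))"
    if "i < n" for i
    using g(1)[OF that] by (intro polyfun_param_tuple) (simp add: multidegree_def)
  have Q: "(\<lambda>y. chart_product e (param_tuple (y(j0 := 1))) ^ d) \<in> polyfun ((\<lambda>j x. x j) ` (param_indices - {j0}))"
    by (intro polyfun_power polyfun_param_tuple multihomogeneous_polyfun E_hom)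
  obtain m a where a: "\<exists>\<alpha>\<in>{..<n} \<rightarrow>\<^sub>E {..<m}. a \<alpha> \<noteq> 0"
    and rel: "\<And>y. (\<Sum>\<alpha>\<in>{..<n} \<rightarrow>\<^sub>E {..<m}. a \<alpha> * ((\<Prod>i<n. g i (param_tuple (y(j0 := 1))) ^ \<alpha> i)
        * (chart_product e (param_tuple (y(j0 := 1))) ^ d) ^ (n * m - (\<Sum>i<n. \<alpha> i)))) = 0"
    by (rule algebraic_relation[OF J P Q]) (assumption, rule that)
  \<comment> \<open>At parameters of a chart point each \<open>g i\<close> is \<open>q\<close> times
    \<open>F i\<close>. The padding brings the power of \<open>q\<close> to \<open>n * m\<close> in
    every term, so it can be cancelled.\<close>
  have relC: "\<forall>A\<in>C n. (\<Sum>\<alpha>\<in>{..<n} \<rightarrow>\<^sub>E {..<m}. a \<alpha> * (\<Prod>i<n. F i A ^ \<alpha> i)) = 0"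
  proof
    fix A assume "A \<in> C n"
    then obtain p where p: "p \<in> Z n" "chart_product e (rep_tuple p) \<noteq> 0" "A = normalized e (rep_tuple p)"
      by (auto simp: C_def)
    have rA: "represents_tuple A p" unfolding p(3) by (rule represents_normalized[OF p(2)])
    then have A4: "represents (A $ 4) (p $ 4)" by (simp add: represents_tuple_def)
    have "p \<in> B21" using p(1) ZB[of n] by auto
    then obtain x where x: "param_basket x = A $ 4" "represents_tuple (param_tuple x) p"
      using B21_param[OF _ A4] by blast
    have "A $ 4 $ fst (e 4) $ snd (e 4) = 1"
      using p(2) by (simp add: p(3) normalized_def chart_entry_def chart_product_nonzero)
    then have "x j0 = 1" unfolding x(1)[symmetric] by (simp add: param_basket_def j0_def)
    then have xj: "x(j0 := 1) = x" by (metis fun_upd_triv)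
    define q where "q = chart_product e (param_tuple x) ^ d"
    have q0: "chart_product e (param_tuple x) \<noteq> 0"
      using value_at_eq_0_iff[OF E_hom x(2)] p(2) by (simp add: value_at_def)
    have nA: "normalized e (param_tuple x) = A" unfolding p(3) by (rule normalized_eq[OF x(2)])
    have gx: "g i (param_tuple x) = q * F i A" if "i < n" for i
      using g(2)[OF that] q0 by (simp add: q_def nA)
    have monom: "(\<Prod>i<n. g i (param_tuple x) ^ \<alpha> i) * q ^ (n * m - (\<Sum>i<n. \<alpha> i))
        = q ^ (n * m) * (\<Prod>i<n. F i A ^ \<alpha> i)" if \<alpha>: "\<alpha> \<in> {..<n} \<rightarrow>\<^sub>E {..<m}" for \<alpha>
    proof -
      have "(\<Sum>i<n. \<alpha> i) \<le> (\<Sum>i<n. m)"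
        by (rule sum_mono) (use \<alpha> in \<open>auto simp: PiE_iff intro: less_imp_le\<close>)
      then have s: "(\<Sum>i<n. \<alpha> i) \<le> n * m" by simp
      have "(\<Prod>i<n. g i (param_tuple x) ^ \<alpha> i) = (\<Prod>i<n. q ^ \<alpha> i * F i A ^ \<alpha> i)"
        by (rule prod.cong) (simp_all add: gx power_mult_distrib)
      also have "\<dots> = q ^ (\<Sum>i<n. \<alpha> i) * (\<Prod>i<n. F i A ^ \<alpha> i)"
        by (simp add: prod.distrib power_sum)
      finally have "(\<Prod>i<n. g i (param_tuple x) ^ \<alpha> i) * q ^ (n * m - (\<Sum>i<n. \<alpha> i))
          = q ^ ((\<Sum>i<n. \<alpha> i) + (n * m - (\<Sum>i<n. \<alpha> i))) * (\<Prod>i<n. F i A ^ \<alpha> i)"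
        by (simp only: power_add mult_ac)
      then show ?thesis using s by simp
    qed
    have "q ^ (n * m) * (\<Sum>\<alpha>\<in>{..<n} \<rightarrow>\<^sub>E {..<m}. a \<alpha> * (\<Prod>i<n. F i A ^ \<alpha> i))
        = (\<Sum>\<alpha>\<in>{..<n} \<rightarrow>\<^sub>E {..<m}. a \<alpha> * ((\<Prod>i<n. g i (param_tuple x) ^ \<alpha> i) * q ^ (n * m - (\<Sum>i<n. \<alpha> i))))"
      unfolding sum_distrib_left by (rule sum.cong) (simp_all add: monom)
    also have "\<dots> = 0" using rel[of x] unfolding xj q_def .
    finally show "(\<Sum>\<alpha>\<in>{..<n} \<rightarrow>\<^sub>E {..<m}. a \<alpha> * (\<Prod>i<n. F i A ^ \<alpha> i)) = 0"
      using q0 by (simp add: q_def)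
  qed
  have prime: "(\<forall>A\<in>C i. u A = 0) \<or> (\<forall>A\<in>C i. v A = 0)"
    if "i \<le> n" "u \<in> polyfun coordinates" "v \<in> polyfun coordinates" "\<forall>A\<in>C i. u A * v A = 0" for i u v
    using that(4) unfolding C_def by (rule chart_prime[OF irr[OF that(1)] that(2,3)])
  have "\<forall>\<alpha>\<in>{..<n} \<rightarrow>\<^sub>E {..<m}. a \<alpha> = 0"
  proof (rule chain_algebraically_independent[where X = coordinates and Z = C and F = F])
    show "C i \<subseteq> C (Suc i)" if "i < n" for i
      unfolding C_def using strict[OF that] by blast
    show "C 0 \<noteq> {}" using p0 chart0 by (auto simp: C_def)
  qed (use prime FX F_zero F_nonzero relC in auto)
  then show False using a by blast
qed

section \<open>A chain of length twenty-one\<close>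

text \<open>The order of release: first the \<open>x_1\<close> coefficients of the forms, then their
  other coefficients, finally the basket. The test for a coordinate reads matrix entries into which
  coordinates of higher level enter, and these must still have their base values.\<close>

definition level :: "4 set + 4 \<times> 4 \<Rightarrow> nat" where
  "level j = (case j of Inl S \<Rightarrow> 2 | Inr (k, i) \<Rightarrow> if i = 1 then 0 else 1)"

text \<open>The equation \<open>x\<^sub>j = base_param j\<close> is not invariant under rescaling the quadrics; it becomes
  multihomogeneous once the coordinates of higher level are fixed.\<close>

lemma coordinate_test:
  assumes j: "j \<in> param_indices - {Inl {1, 4}}"
  obtains h where "h \<in> multihomogeneous" "h (param_tuple (base_param(j := 5))) \<noteq> 0"
    "\<And>x. x j = base_param j \<Longrightarrow> x (Inl {1, 4}) = 1
       \<Longrightarrow> (\<And>i. i \<in> param_indices - {Inl {1, 4}} \<Longrightarrow> level i > level j \<Longrightarrow> x i = base_param i)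
       \<Longrightarrow> h (param_tuple x) = 0"
proof -
  have base_Inl: "base_param (Inl S) = (if S = {1, 4} \<or> S = {2, 3} then 1 else 0)" for S
    by (simp add: base_param_def)
  have Inl: "Inl {i, i'} \<in> param_indices" for i i' by (auto simp: param_indices_def)
  have A: "param_tuple x $ k $ i $ i' = x (Inl {i, i'}) + (if k = 4 then 0 else x (Inr (k, i)) * x (Inr (k, i')))" for x k i i'
    by (simp add: param_tuple_def param_basket_def param_form_def)
  have "(\<exists>i i'. j = Inl {i, i'} \<and> {i, i'} \<noteq> {1, 4}) \<or> (\<exists>k i. j = Inr (k, i) \<and> k \<noteq> 4)"
  proof (cases j)
    case (Inl S)
    then obtain i i' where "S = {i, i'}" using j by (auto simp: param_indices_def)
    then show ?thesis using Inl j by blast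
  next
    case (Inr b)
    then show ?thesis using j by (auto simp: param_indices_def)
  qed
  then consider (basket) i i' where "j = Inl {i, i'}" "{i, i'} \<noteq> {1, 4}" "{i, i'} \<noteq> {2, 3}"
    | (basket23) "j = Inl {2, 3}"
    | (form1) k where "j = Inr (k, 1)" "k \<noteq> 4"
    | (form) k i where "j = Inr (k, i)" "k \<noteq> 4" "i \<noteq> 1"
    by (cases "j = Inl {2, 3}") blast+
  then show thesis
  proof cases
    case basket
    show ?thesis
    proof (rule that[of "\<lambda>A. A $ 4 $ i $ i'"])
      show "(\<lambda>A :: (complex^4^4)^4. A $ 4 $ i $ i') \<in> multihomogeneous"
        by (rule multidegree_multihomogeneous[OF multidegree_coordinate])
    qed (use basket in \<open>simp_all add: A base_Inl\<close>)
  next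
    case basket23
    show ?thesis
    \<comment> \<open>The entry at \<open>{1, 4}\<close> is kept at 1 and serves as the unit with
      which the entry at \<open>{2, 3}\<close> is compared.\<close>
    proof (rule that[of "\<lambda>A. A $ 4 $ 2 $ 3 - A $ 4 $ 1 $ 4"])
      show "(\<lambda>A :: (complex^4^4)^4. A $ 4 $ 2 $ 3 - A $ 4 $ 1 $ 4) \<in> multihomogeneous"
        by (rule multidegree_multihomogeneous[OF multidegree_diff[OF multidegree_coordinate multidegree_coordinate]])
    qed (use basket23 in \<open>simp_all add: A base_Inl doubleton_eq_iff\<close>)
  next
    case form1
    let ?t = "base_param (Inr (k, 1))"
    show ?thesis
    \<comment> \<open>The entries are \<open>b_11 + l_1^2\<close> and \<open>b_14 + l_1 l_4\<close>.
      With \<open>b_11 = l_4 = 0\<close> and \<open>b_14 = 1\<close> the function becomes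
      \<open>l_1^2\<close> minus the square of the base value; at 5 it is nonzero because the base
      values are 1, 2 and 3.\<close>
    proof (rule that[of "\<lambda>A. A $ k $ 1 $ 1 - ?t\<^sup>2 * A $ k $ 1 $ 4"])
      show "(\<lambda>A :: (complex^4^4)^4. A $ k $ 1 $ 1 - ?t\<^sup>2 * A $ k $ 1 $ 4) \<in> multihomogeneous"
        by (rule multidegree_multihomogeneous[OF multidegree_diff[OF multidegree_coordinate
              multidegree_cmult[OF multidegree_coordinate]]])
      show "param_tuple (base_param(j := 5)) $ k $ 1 $ 1 - ?t\<^sup>2 * param_tuple (base_param(j := 5)) $ k $ 1 $ 4 \<noteq> 0"
        using form1 by (simp add: A base_Inl base_param_def doubleton_eq_iff)
      fix x :: param
      assume x: "x j = base_param j" "x (Inl {1, 4}) = 1"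
        and hi: "\<And>i. i \<in> param_indices - {Inl {1, 4}} \<Longrightarrow> level i > level j \<Longrightarrow> x i = base_param i"
      have "x (Inl {1}) = 0" using hi[of "Inl {1}"] Inl[of 1 1] form1(1) by (simp add: level_def base_Inl doubleton_eq_iff)
      moreover have "x (Inr (k, 4)) = 0"
        using hi[of "Inr (k, 4)"] form1 exhaust_4[of k] by (auto simp: level_def base_param_def param_indices_def)
      ultimately show "param_tuple x $ k $ 1 $ 1 - ?t\<^sup>2 * param_tuple x $ k $ 1 $ 4 = 0"
        using form1 x by (simp add: A power2_eq_square)
    qed
  next
    case form
    show ?thesis
    \<comment> \<open>With \<open>b_ii = 0\<close> this entry is the square of the coefficient,
      whose base value is 0.\<close>
    proof (rule that[of "\<lambda>A. A $ k $ i $ i"])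
      show "(\<lambda>A :: (complex^4^4)^4. A $ k $ i $ i) \<in> multihomogeneous"
        by (rule multidegree_multihomogeneous[OF multidegree_coordinate])
      show "param_tuple (base_param(j := 5)) $ k $ i $ i \<noteq> 0"
        using form by (simp add: A base_Inl)
      fix x :: param
      assume x: "x j = base_param j"
        and hi: "\<And>i. i \<in> param_indices - {Inl {1, 4}} \<Longrightarrow> level i > level j \<Longrightarrow> x i = base_param i"
      have "x (Inl {i}) = 0" using hi[of "Inl {i}"] Inl[of i i] form by (simp add: level_def base_Inl doubleton_eq_iff)
      moreover have "x (Inr (k, i)) = 0" using x form by (simp add: base_param_def)
      ultimately show "param_tuple x $ k $ i $ i = 0" using form by (simp add: A)
    qed
  qed
qed

text \<open>Fixing coordinates is compatible with segments, so the closure of the image of each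
  \<open>V i\<close> is irreducible. A test function that vanishes on \<open>S i\<close> also
  vanishes on its closure, and this makes the inclusions strict.\<close>

lemma chain_of_length_21:
  obtains Z :: "nat \<Rightarrow> (quadric^4) set"
  where "\<And>i. closedin (subtopology zariski B21) (Z i)"
    "\<And>i. irreducible_space (subtopology zariski (Z i))" "\<And>i. i < 21 \<Longrightarrow> Z i \<subset> Z (Suc i)"
proof -
  let ?J = "param_indices - {Inl {1, 4}}"
  obtain xs where xs: "set xs = ?J" "distinct xs"
    using finite_distinct_list[of ?J] card_param_indices(1) by auto
  \<comment> \<open>Sorting by level ensures that all coordinates of higher level are still fixed
    when a coordinate is tested.\<close>
  define js where "js = sort_key level xs"
  have js: "set js = ?J" "distinct js" "sorted (map level js)"
    using xs by (simp_all add: js_def)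
  have len: "length js = 21"
    using distinct_card[OF js(2)] js(1) card_param_indices(2)[of 1 4] by simp
  define V where "V i = {x. good_param x \<and> (\<forall>j. j \<notin> set (take i js) \<longrightarrow> x j = base_param j)}" for i
  define S where "S i = {p \<in> B21. \<exists>x\<in>V i. represents_tuple (param_tuple x) p}" for i
  define Z where "Z i = subtopology zariski B21 closure_of (S i)" for i
  have SB: "S i \<subseteq> B21" for i by (auto simp: S_def)
  have SZ: "S i \<subseteq> Z i" for i unfolding Z_def by (rule closure_of_subset) (use SB in auto)
  have ZS: "Z i \<subseteq> zariski closure_of (S i)" for i
    using SB by (simp add: Z_def closure_of_subtopology Int_absorb1)
  have S_ex: "\<exists>p\<in>S i. represents_tuple (param_tuple x) p" if "x \<in> V i" for i x
    using quadric_in_B21[of x] that by (auto simp: S_def V_def)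
  have base: "base_param \<in> V i" for i using good_base_param by (simp add: V_def)
  have irrZ: "irreducible_space (subtopology zariski (Z i))" for i
  proof (rule irreducible_if_curves[OF _ SZ ZS])
    show "S i \<noteq> {}" using S_ex[OF base] by blast
    fix p q assume "p \<in> S i" "q \<in> S i"
    then obtain x y where x: "x \<in> V i" "represents_tuple (param_tuple x) p"
      and y: "y \<in> V i" "represents_tuple (param_tuple y) q" by (auto simp: S_def)
    have g: "good_param x" using x(1) by (simp add: V_def)
    have seg: "segment x y t \<in> V i" if "good_param (segment x y t)" for t
      using that x(1) y(1) by (simp add: V_def segment_def)
    have "{t. \<not> (\<exists>s\<in>S i. represents_tuple (param_tuple (segment x y t)) s)} \<subseteq> {t. \<not> good_param (segment x y t)}"
      using seg S_ex by blast
    then have "curve_in (S i) (\<lambda>t. param_tuple (segment x y t))"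
      unfolding curve_in_def using polynomial_curve_segment finite_subset[OF _ finite_bad_params[OF g]] by blast
    then show "\<exists>\<gamma>. curve_in (S i) \<gamma> \<and> represents_tuple (\<gamma> 0) p \<and> represents_tuple (\<gamma> 1) q"
      using x(2) y(2) by (intro exI[of _ "\<lambda>t. param_tuple (segment x y t)"]) simp
  qed
  have strict: "Z i \<subset> Z (Suc i)" if i: "i < 21" for i
  proof -
    define j where "j = js ! i"
    have jJ: "j \<in> ?J" using i len js(1) nth_mem[of i js] by (simp add: j_def)
    have take: "take (Suc i) js = take i js @ [j]" using i len by (simp add: j_def take_Suc_conv_app_nth)
    have jn: "j \<notin> set (take i js)"
      using distinct_take[OF js(2), of "Suc i"] unfolding take by simp
    have lower: "level j' \<le> level j" if j': "j' \<in> set (take i js)" for j'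
    proof -
      obtain i' where i': "i' < i" "j' = js ! i'" using j' i len by (auto simp: in_set_conv_nth)
      have "map level js ! i' \<le> map level js ! i"
        using i' i len by (intro sorted_nth_mono[OF js(3)]) auto
      then show ?thesis using i' i len by (simp add: j_def)
    qed
    obtain h where h: "h \<in> multihomogeneous" "h (param_tuple (base_param(j := 5))) \<noteq> 0"
      and test: "\<And>x. x j = base_param j \<Longrightarrow> x (Inl {1, 4}) = 1
       \<Longrightarrow> (\<And>i. i \<in> ?J \<Longrightarrow> level i > level j \<Longrightarrow> x i = base_param i) \<Longrightarrow> h (param_tuple x) = 0"
      using coordinate_test[OF jJ] by blast
    have "value_at h p = 0" if p: "p \<in> S i" for p
    proof -
      obtain x where x: "x \<in> V i" "represents_tuple (param_tuple x) p" using p by (auto simp: S_def)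
      have eq: "x j' = base_param j'" if "j' \<notin> set (take i js)" for j' using x(1) that by (simp add: V_def)
      have "h (param_tuple x) = 0"
      proof (rule test)
        show "x j = base_param j" using eq jn by blast
        have "Inl {1, 4} \<notin> set (take i js)" using set_take_subset[of i js] js(1) by blast
        then show "x (Inl {1, 4}) = 1" using eq by (simp add: base_param_def)
        fix j' assume "level j < level j'"
        then have "j' \<notin> set (take i js)" using lower by fastforce
        then show "x j' = base_param j'" by (rule eq)
      qed
      then show ?thesis using value_at_eq_0_iff[OF h(1) x(2)] by blast
    qed
    then have "S i \<subseteq> {p \<in> B21. value_at h p = 0}" using SB by blast
    then have Zh: "Z i \<subseteq> {p \<in> B21. value_at h p = 0}"
      unfolding Z_def by (rule closure_of_minimal[OF _ closedin_zero_set[OF h(1)]])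
    have "\<exists>p\<in>S (Suc i). value_at h p \<noteq> 0"
    proof -
      \<comment> \<open>\<open>base_param(j := 5)\<close> need not be good, so a general point of
        the segment from the good base point towards it is used.\<close>
      let ?s = "segment base_param (base_param(j := 5))"
      have "polynomial_map (\<lambda>t. h (param_tuple (?s t)))"
        by (rule polynomial_map_along_curve[OF h(1) polynomial_curve_segment])
      then have "finite {t. h (param_tuple (?s t)) = 0}"
        by (rule polynomial_map_cofinite[of _ 1]) (use h(2) in simp)
      then have "finite ({t. h (param_tuple (?s t)) = 0} \<union> {t. \<not> good_param (?s t)})"
        using finite_bad_params[OF good_base_param] by simp
      then have "\<exists>t. t \<notin> {t. h (param_tuple (?s t)) = 0} \<union> {t. \<not> good_param (?s t)}"
        by (rule ex_new_if_finite[OF infinite_UNIV_char_0])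
      then obtain t where t: "h (param_tuple (?s t)) \<noteq> 0" "good_param (?s t)" by auto
      have "?s t \<in> V (Suc i)" using t(2) unfolding V_def take by (auto simp: segment_def)
      then obtain p where p: "p \<in> S (Suc i)" "represents_tuple (param_tuple (?s t)) p" using S_ex by blast
      then show ?thesis using value_at_eq_0_iff[OF h(1) p(2)] t(1) by blast
    qed
    then have "Z i \<noteq> Z (Suc i)" using SZ[of "Suc i"] Zh by blast
    moreover have "V i \<subseteq> V (Suc i)" unfolding V_def take by auto
    then have "S i \<subseteq> S (Suc i)" unfolding S_def by blast
    then have "Z i \<subseteq> Z (Suc i)" unfolding Z_def by (rule closure_of_mono)
    ultimately show ?thesis by blast
  qed
  show thesis
    using that[of Z] irrZ strict closedin_closure_of by (simp add: Z_def)
qed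

lemma krull_dim_B21: "krull_dim (subtopology zariski B21) = 21"
proof -
  let ?X = "subtopology zariski B21"
  have sub: "subtopology ?X C = subtopology zariski C" if "closedin ?X C" for C
    using closedin_subset[OF that] by (simp add: subtopology_subtopology Int_absorb1)
  have "krull_dim ?X \<le> enat 21"
    unfolding krull_dim_def
  proof (rule Sup_least)
    fix d assume "d \<in> {enat n | n. \<exists>Z :: nat \<Rightarrow> (quadric^4) set.
      (\<forall>i\<le>n. closedin ?X (Z i) \<and> irreducible_space (subtopology ?X (Z i))) \<and> (\<forall>i<n. Z i \<subset> Z (Suc i))}"
    then obtain n Z where d: "d = enat n"
      and Z: "\<forall>i\<le>n. closedin ?X (Z i) \<and> irreducible_space (subtopology ?X (Z i))" "\<forall>i<n. Z i \<subset> Z (Suc i)"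
      by blast
    have "n \<le> 21"
      by (rule chain_length_le_21[of n Z]) (use Z sub in auto)
    then show "d \<le> enat 21" by (simp add: d)
  qed
  moreover have "enat 21 \<le> krull_dim ?X"
    unfolding krull_dim_def
  proof (rule Sup_upper)
    obtain Z :: "nat \<Rightarrow> (quadric^4) set"
      where Z: "\<And>i. closedin ?X (Z i)" "\<And>i. irreducible_space (subtopology zariski (Z i))"
        "\<And>i. i < 21 \<Longrightarrow> Z i \<subset> Z (Suc i)"
      using chain_of_length_21 by blast
    then have "(\<forall>i\<le>21. closedin ?X (Z i) \<and> irreducible_space (subtopology ?X (Z i))) \<and> (\<forall>i<21. Z i \<subset> Z (Suc i))"
      using sub by simp
    then show "enat 21 \<in> {enat n | n. \<exists>Z :: nat \<Rightarrow> (quadric^4) set.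
      (\<forall>i\<le>n. closedin ?X (Z i) \<and> irreducible_space (subtopology ?X (Z i))) \<and> (\<forall>i<n. Z i \<subset> Z (Suc i))}"
      by blast
  qed
  ultimately show ?thesis by (simp add: numeral_eq_enat)
qed

theorem proposition0p3:
  shows "irreducible_space (subtopology zariski B21) \<and>
         krull_dim (subtopology zariski B21) = 21 \<and>
         generically (subtopology zariski B21) (\<lambda>p. triple_property (triple_of p)) \<and>
         generically (subtopology zariski property_triples)
           (\<lambda>t. \<exists>b. common_basket b [t $ 1, t $ 2, t $ 3])"
  using irreducible_B21 krull_dim_B21 generic_triple_property generic_property_triple_has_basket
  by blast

end
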